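(* Let $K$ be an algebraically closed field of characteristic zero and let $R$ be a commutative finitely generated $K$-algebra with a locally nilpotent $K$-linear derivation $d$. Then $R[\theta;d]$ satisfies property $(\diamond)$.
   Context: A derivation $d$ of $R$ is locally nilpotent if for every $a\in R$ there is $n>0$ with $d^n(a)=0$. The differential operator ring $R[\theta;d]$ is the overring of $R$ that is free as a left $R$-module with basis $\{\theta^n\mid n\ge 0\}$, subject to $\theta a=a\theta+d(a)$ for all $a\in R$. A module is locally Artinian if each of its finitely generated submodules is Artinian. A ring $A$ satisfies property $(\diamond)$ if injective hulls of simple left $A$-modules are locally Artinian (equivalently, all finitely generated essential extensions of simple left $A$-modules are Artinian). *)

theory Defs
  imports "HOL-Algebra.Algebra"
begin

section \<open>Left modules over arbitrary rings\<close>

text \<open>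
  The locale \<^verbatim>\<open>module\<close> of \<^verbatim>\<open>HOL-Algebra\<close> assumes a commutative ring of scalars; the following
  has the same axioms without commutativity. Submodules are given by the library locale
  \<^verbatim>\<open>submodule\<close>, which does not refer to commutativity, and a submodule \<open>N\<close> of \<open>M\<close>
  is viewed as a module in its own right as \<open>M\<lparr>carrier := N\<rparr>\<close>.
\<close>

locale left_module = R?: ring R + M?: abelian_group M
  for R :: "('a, 'b) ring_scheme" (structure) and M :: "('a, 'm, 'c) module_scheme" (structure) +
  assumes smult_closed:
      "\<lbrakk> a \<in> carrier R; x \<in> carrier M \<rbrakk> \<Longrightarrow> a \<odot>\<^bsub>M\<^esub> x \<in> carrier M"
    and smult_l_distr:
      "\<lbrakk> a \<in> carrier R; b \<in> carrier R; x \<in> carrier M \<rbrakk> \<Longrightarrow>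
      (a \<oplus> b) \<odot>\<^bsub>M\<^esub> x = a \<odot>\<^bsub>M\<^esub> x \<oplus>\<^bsub>M\<^esub> b \<odot>\<^bsub>M\<^esub> x"
    and smult_r_distr:
      "\<lbrakk> a \<in> carrier R; x \<in> carrier M; y \<in> carrier M \<rbrakk> \<Longrightarrow>
      a \<odot>\<^bsub>M\<^esub> (x \<oplus>\<^bsub>M\<^esub> y) = a \<odot>\<^bsub>M\<^esub> x \<oplus>\<^bsub>M\<^esub> a \<odot>\<^bsub>M\<^esub> y"
    and smult_assoc1:
      "\<lbrakk> a \<in> carrier R; b \<in> carrier R; x \<in> carrier M \<rbrakk> \<Longrightarrow>
      (a \<otimes> b) \<odot>\<^bsub>M\<^esub> x = a \<odot>\<^bsub>M\<^esub> (b \<odot>\<^bsub>M\<^esub> x)"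
    and smult_one:
      "x \<in> carrier M \<Longrightarrow> \<one> \<odot>\<^bsub>M\<^esub> x = x"

definition left_module_hom ::
    "('a, 'b) ring_scheme \<Rightarrow> ('a, 'm, 'c) module_scheme \<Rightarrow> ('a, 'n, 'd) module_scheme \<Rightarrow> ('m \<Rightarrow> 'n) set"
  where "left_module_hom A M N =
    {f \<in> carrier M \<rightarrow> carrier N.
       (\<forall>x\<in>carrier M. \<forall>y\<in>carrier M. f (x \<oplus>\<^bsub>M\<^esub> y) = f x \<oplus>\<^bsub>N\<^esub> f y) \<and>
       (\<forall>a\<in>carrier A. \<forall>x\<in>carrier M. f (a \<odot>\<^bsub>M\<^esub> x) = a \<odot>\<^bsub>N\<^esub> f x)}"

definition simple_module :: "('a, 'b) ring_scheme \<Rightarrow> ('a, 'm, 'c) module_scheme \<Rightarrow> bool"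
  where "simple_module A M \<longleftrightarrow> left_module A M \<and> carrier M \<noteq> {\<zero>\<^bsub>M\<^esub>} \<and>
    (\<forall>N. submodule N A M \<longrightarrow> N = {\<zero>\<^bsub>M\<^esub>} \<or> N = carrier M)"

definition generated_submodule ::
    "('a, 'b) ring_scheme \<Rightarrow> ('a, 'm, 'c) module_scheme \<Rightarrow> 'm set \<Rightarrow> 'm set"
  where "generated_submodule A M G = \<Inter>{N. submodule N A M \<and> G \<subseteq> N}"

definition artinian_module :: "('a, 'b) ring_scheme \<Rightarrow> ('a, 'm, 'c) module_scheme \<Rightarrow> bool"
  where "artinian_module A M \<longleftrightarrow> left_module A M \<and>
    (\<forall>N :: nat \<Rightarrow> 'm set. (\<forall>i. submodule (N i) A M) \<and> (\<forall>i. N (Suc i) \<subseteq> N i) \<longrightarrow>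
       (\<exists>k. \<forall>i\<ge>k. N i = N k))"

definition locally_artinian :: "('a, 'b) ring_scheme \<Rightarrow> ('a, 'm, 'c) module_scheme \<Rightarrow> bool"
  where "locally_artinian A M \<longleftrightarrow> left_module A M \<and>
    (\<forall>G. finite G \<and> G \<subseteq> carrier M \<longrightarrow>
       artinian_module A (M\<lparr>carrier := generated_submodule A M G\<rparr>))"

definition essential_submodule ::
    "'m set \<Rightarrow> ('a, 'b) ring_scheme \<Rightarrow> ('a, 'm, 'c) module_scheme \<Rightarrow> bool"
  where "essential_submodule N A M \<longleftrightarrow> submodule N A M \<and>
    (\<forall>L. submodule L A M \<and> L \<inter> N = {\<zero>\<^bsub>M\<^esub>} \<longrightarrow> L = {\<zero>\<^bsub>M\<^esub>})"


section \<open>Injective hulls and the property \<open>(\<diamondop>)\<close>\<close>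

text \<open>
  HOL cannot quantify over all modules inside a definition, so injectivity is relative to test
  modules with carrier in a type \<open>'n\<close>, passed as a parameter. By Baer's criterion, this is
  absolute injectivity as soon as \<open>'n\<close> is at least as large as the ring; for smaller \<open>'n\<close> it is
  a weaker condition.
\<close>

definition injective_module ::
    "'n itself \<Rightarrow> ('a, 'b) ring_scheme \<Rightarrow> ('a, 'e, 'c) module_scheme \<Rightarrow> bool"
  where "injective_module TN A E \<longleftrightarrow> left_module A E \<and>
    (\<forall>(N :: ('a, 'n) module) L. left_module A N \<and> submodule L A N \<longrightarrow>
       (\<forall>f \<in> left_module_hom A (N\<lparr>carrier := L\<rparr>) E.
          \<exists>g \<in> left_module_hom A N E. \<forall>x\<in>L. g x = f x))"

definition injective_hull ::
    "'n itself \<Rightarrow> ('a, 'b) ring_scheme \<Rightarrow> ('a, 's, 'c) module_scheme \<Rightarrow>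
     ('a, 'e, 'd) module_scheme \<Rightarrow> ('s \<Rightarrow> 'e) \<Rightarrow> bool"
  where "injective_hull TN A S E \<iota> \<longleftrightarrow>
    left_module A S \<and> injective_module TN A E \<and>
    \<iota> \<in> left_module_hom A S E \<and> inj_on \<iota> (carrier S) \<and>
    essential_submodule (\<iota> ` carrier S) A E"

text \<open>
  The type parameters are the carrier types of the simple modules, of their injective hulls and of
  the test modules for injectivity. Property \<open>(\<diamondop>)\<close> for a ring is \<^verbatim>\<open>diamond_property\<close> for all choices
  of these types; since \<open>'n\<close> occurs only in a hypothesis, small \<open>'n\<close> make the property stronger.
\<close>

definition diamond_property ::
    "'s itself \<Rightarrow> 'e itself \<Rightarrow> 'n itself \<Rightarrow> ('a, 'b) ring_scheme \<Rightarrow> bool"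
  where "diamond_property TS TE TN A \<longleftrightarrow>
    (\<forall>(S :: ('a, 's) module) (E :: ('a, 'e) module) \<iota>.
       simple_module A S \<and> injective_hull TN A S E \<iota> \<longrightarrow> locally_artinian A E)"


section \<open>Algebras, derivations and differential operator rings\<close>

definition char_zero :: "('k, 'b) ring_scheme \<Rightarrow> bool"
  where "char_zero K \<longleftrightarrow> (\<forall>n::nat. n > 0 \<longrightarrow> [n] \<cdot>\<^bsub>K\<^esub> \<one>\<^bsub>K\<^esub> \<noteq> \<zero>\<^bsub>K\<^esub>)"

text \<open>The conjunction of \<^verbatim>\<open>subring\<close> and \<^verbatim>\<open>submodule\<close> says that \<open>B\<close> is a unital \<open>K\<close>-subalgebra.\<close>

definition finitely_generated_algebra ::
    "('k, 'b) ring_scheme \<Rightarrow> ('k, 'r, 'c) module_scheme \<Rightarrow> bool"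
  where "finitely_generated_algebra K R \<longleftrightarrow>
    (\<exists>G. finite G \<and> G \<subseteq> carrier R \<and>
       (\<forall>B. subring B R \<and> submodule B K R \<and> G \<subseteq> B \<longrightarrow> B = carrier R))"

definition linear_derivation ::
    "('k, 'b) ring_scheme \<Rightarrow> ('k, 'r, 'c) module_scheme \<Rightarrow> ('r \<Rightarrow> 'r) \<Rightarrow> bool"
  where "linear_derivation K R d \<longleftrightarrow>
    d \<in> carrier R \<rightarrow> carrier R \<and>
    (\<forall>a\<in>carrier R. \<forall>b\<in>carrier R. d (a \<oplus>\<^bsub>R\<^esub> b) = d a \<oplus>\<^bsub>R\<^esub> d b) \<and>
    (\<forall>k\<in>carrier K. \<forall>a\<in>carrier R. d (k \<odot>\<^bsub>R\<^esub> a) = k \<odot>\<^bsub>R\<^esub> d a) \<and>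
    (\<forall>a\<in>carrier R. \<forall>b\<in>carrier R. d (a \<otimes>\<^bsub>R\<^esub> b) = d a \<otimes>\<^bsub>R\<^esub> b \<oplus>\<^bsub>R\<^esub> a \<otimes>\<^bsub>R\<^esub> d b)"

definition locally_nilpotent :: "('r, 'b) ring_scheme \<Rightarrow> ('r \<Rightarrow> 'r) \<Rightarrow> bool"
  where "locally_nilpotent R d \<longleftrightarrow> (\<forall>a\<in>carrier R. \<exists>n>0. (d ^^ n) a = \<zero>\<^bsub>R\<^esub>)"

text \<open>
  \<open>A\<close> is (a model of) the ring \<open>R[\<theta>; d]\<close>, with \<open>R\<close> embedded by \<open>\<phi>\<close>. The last two assumptions
  say that the powers of \<open>\<theta>\<close> are a basis of \<open>A\<close> as a left \<open>R\<close>-module; these data determine \<open>A\<close>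
  up to unique isomorphism over \<open>R\<close> preserving \<open>\<theta>\<close>.
\<close>

locale differential_operator_ring = R?: ring R + A?: ring A
  for R :: "('r, 'b) ring_scheme" (structure) and d :: "'r \<Rightarrow> 'r"
    and A :: "('a, 'c) ring_scheme" (structure) and \<phi> :: "'r \<Rightarrow> 'a" and \<theta> :: 'a +
  assumes embedding: "\<phi> \<in> ring_hom R A" "inj_on \<phi> (carrier R)"
    and theta_closed: "\<theta> \<in> carrier A"
    and commutation:
      "a \<in> carrier R \<Longrightarrow> \<theta> \<otimes>\<^bsub>A\<^esub> \<phi> a = \<phi> a \<otimes>\<^bsub>A\<^esub> \<theta> \<oplus>\<^bsub>A\<^esub> \<phi> (d a)"
    and powers_span:
      "x \<in> carrier A \<Longrightarrow>
        \<exists>n c. c \<in> {..<n} \<rightarrow> carrier R \<and>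
          x = (\<Oplus>\<^bsub>A\<^esub> i \<in> {..<n::nat}. \<phi> (c i) \<otimes>\<^bsub>A\<^esub> \<theta> [^]\<^bsub>A\<^esub> i)"
    and powers_independent:
      "\<lbrakk> c \<in> {..<n::nat} \<rightarrow> carrier R;
         (\<Oplus>\<^bsub>A\<^esub> i \<in> {..<n}. \<phi> (c i) \<otimes>\<^bsub>A\<^esub> \<theta> [^]\<^bsub>A\<^esub> i) = \<zero>\<^bsub>A\<^esub>; i < n \<rbrakk>
        \<Longrightarrow> c i = \<zero>\<^bsub>R\<^esub>"

end

theory Submission
  imports Defs
begin

text \<open>
  Let \<open>N\<close> be a finitely generated essential extension of a simple module \<open>S\<close> over \<open>A = R[\<theta>; d]\<close>. Hilbert's
  basis argument, applied to modules and adjoining one generator at a time, shows that \<open>N\<close> and the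
  left regular module are Noetherian. If \<open>z\<close> acts centrally on \<open>N\<close> and kills \<open>S\<close>, Fitting's argument
  and essentiality make \<open>z\<close> nilpotent on \<open>N\<close>, so \<open>N\<close> is Artinian as soon as \<open>ker z\<close> is; by
  Noetherian induction on the annihilator one may assume that every such \<open>z\<close> kills \<open>N\<close>. As \<open>d\<close> is
  locally nilpotent, \<open>I = ann\<^sub>R S\<close> then kills \<open>N\<close>.

  If \<open>d R \<subseteq> I\<close>, then \<open>A\<close> acts on \<open>N\<close> through a field and \<open>N = S\<close>. Otherwise, a generic flatness
  argument shows that the constants of \<open>R/I\<close> act on \<open>S\<close> as scalars in \<open>K\<close>, so \<open>R/I\<close> behaves like \<open>K[x]\<close>
  with \<open>d/dx\<close> and \<open>A\<close> acts on \<open>N\<close> like the first Weyl algebra. In a descending chain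
  \<open>L\<^sub>0 \<supseteq> L\<^sub>1 \<supseteq> \<dots>\<close> between \<open>S\<close> and a cyclic submodule, the ideals of leading coefficients
  contain a fixed nonzero ideal and stabilise; from then on \<open>L\<^sub>j / L\<^sub>j\<^sub>+\<^sub>1\<close> is killed by a nonzero
  \<open>P \<in> R/I\<close>, hence by all its derivatives, one of which is a nonzero constant.
\<close>


section \<open>Chain conditions in the lattice of submodules\<close>

text \<open>Submodules are subsets of one ambient carrier, stable under a set of operators that
  varies, and quotients are replaced by congruences and by intervals of submodules. One extension
  step then serves both for a generator of \<open>R\<close>, which commutes with the operators
  already present, and for \<open>\<theta>\<close>, which commutes up to a correction.

  The obstacle is the claim that constants act as scalars. The field may be countable and the simple
  module infinite-dimensional, so neither the cardinality version of Schur's lemma nor an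
  eigenvector is at hand. Instead, the infinitely many operators \<open>c - k\<close> are played off
  against a finiteness statement that survives each extension step: all but finitely many of them
  are injective and have only torsion elements among the infinitely divisible ones.

  Algebraic closedness splits monic polynomials in \<open>c\<close> into factors
  \<open>c - k\<close>. Characteristic zero makes \<open>K\<close> infinite and keeps binomial
  coefficients nonzero, so that leading coefficients of products do not vanish.\<close>

definition acc_family :: "'x set set \<Rightarrow> bool"
  where "acc_family F \<longleftrightarrow>
    (\<forall>N :: nat \<Rightarrow> 'x set. (\<forall>i. N i \<in> F \<and> N i \<subseteq> N (Suc i)) \<longrightarrow> (\<exists>k. \<forall>i\<ge>k. N i = N k))"

definition dcc_family :: "'x set set \<Rightarrow> bool"
  where "dcc_family F \<longleftrightarrow>
    (\<forall>N :: nat \<Rightarrow> 'x set. (\<forall>i. N i \<in> F \<and> N (Suc i) \<subseteq> N i) \<longrightarrow> (\<exists>k. \<forall>i\<ge>k. N i = N k))"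

lemma acc_familyD:
  assumes "acc_family F" "\<And>i. N i \<in> F" "\<And>i. N i \<subseteq> N (Suc i)"
  obtains k where "\<And>i. i \<ge> k \<Longrightarrow> N i = N k"
  using assms unfolding acc_family_def by blast

lemma acc_family_stabilises:
  "\<lbrakk>acc_family F; \<And>i. N i \<in> F; \<And>i. N i \<subseteq> N (Suc i)\<rbrakk> \<Longrightarrow> \<exists>k. \<forall>i\<ge>k. N i = N k"
  unfolding acc_family_def by blast

lemma dcc_familyD:
  assumes "dcc_family F" "\<And>i. N i \<in> F" "\<And>i. N (Suc i) \<subseteq> N i"
  obtains k where "\<And>i. i \<ge> k \<Longrightarrow> N i = N k"
  using assms unfolding dcc_family_def by blast

lemma acc_family_subset: "\<lbrakk>acc_family F; G \<subseteq> F\<rbrakk> \<Longrightarrow> acc_family G"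
  unfolding acc_family_def by (meson subsetD)

lemma dcc_family_subset: "\<lbrakk>dcc_family F; G \<subseteq> F\<rbrakk> \<Longrightarrow> dcc_family G"
  unfolding dcc_family_def by (meson subsetD)

text \<open>The relation puts larger sets below smaller ones, so well-founded induction along it may
  assume the claim for all strictly larger members of the family.\<close>

lemma acc_family_wf:
  assumes "acc_family F"
  shows "wf {(U, Y) |U Y. U \<in> F \<and> Y \<in> F \<and> Y \<subset> U}"
  unfolding wf_iff_no_infinite_down_chain
proof
  assume "\<exists>f. \<forall>i. (f (Suc i), f i) \<in> {(U, Y) |U Y. U \<in> F \<and> Y \<in> F \<and> Y \<subset> U}"
  then obtain f where f: "\<And>i. f i \<in> F \<and> f i \<subset> f (Suc i)" by blast
  then obtain k where "\<And>i. i \<ge> k \<Longrightarrow> f i = f k"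
    by (metis acc_familyD[OF assms, of f] psubset_imp_subset)
  then show False using f[of k] by (metis le_SucI order_refl psubsetE)
qed

lemma acc_family_maximal:
  assumes "acc_family F" "U \<in> F" "P U"
  obtains Y where "Y \<in> F" "P Y" "\<And>Z. \<lbrakk>Z \<in> F; P Z; Y \<subseteq> Z\<rbrakk> \<Longrightarrow> Z = Y"
proof -
  have "U \<in> {Y \<in> F. P Y}" using assms by simp
  then obtain Y where Y: "Y \<in> {Y \<in> F. P Y}" and
    max: "\<And>Z. (Z, Y) \<in> {(U, Y) |U Y. U \<in> F \<and> Y \<in> F \<and> Y \<subset> U} \<Longrightarrow> Z \<notin> {Y \<in> F. P Y}"
    by (rule wfE_min[OF acc_family_wf[OF assms(1)]]) blast
  show ?thesis
  proof (rule that)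
    fix Z assume Z: "Z \<in> F" "P Z" "Y \<subseteq> Z"
    then show "Z = Y" using max[of Z] Y by auto
  qed (use Y in auto)
qed

lemma acc_finite_family: "finite (Q :: 'a set set) \<Longrightarrow> acc_family Q"
  unfolding acc_family_def
proof (intro allI impI)
  fix N :: "nat \<Rightarrow> 'a set" assume Q: "finite Q" and N: "\<forall>i. N i \<in> Q \<and> N i \<subseteq> N (Suc i)"
  have mono: "N i \<subseteq> N j" if "i \<le> j" for i j using lift_Suc_mono_le[of N i j] N that by simp
  have "range N \<subseteq> Q" using N by auto
  then have "finite (range N)" using Q finite_subset by blast
  then have "\<exists>U\<in>range N. \<forall>V\<in>range N. U \<subseteq> V \<longrightarrow> U = V"
    by (intro finite_has_maximal) simp_all
  then obtain k where k: "\<And>i. N k \<subseteq> N i \<Longrightarrow> N k = N i" by auto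
  have "N i = N k" if "i \<ge> k" for i using k[OF mono[OF that]] by simp
  then show "\<exists>k. \<forall>i\<ge>k. N i = N k" by blast
qed

text \<open>\<open>W\<close> is an arbitrary set of operators, closed under nothing:
  \<open>{}\<close> gives additive subgroups and the whole carrier gives submodules. This lets
  operators be adjoined one at a time without forming the subring they generate.\<close>

definition stable :: "('a, 'm, 'c) module_scheme \<Rightarrow> 'a set \<Rightarrow> 'm set \<Rightarrow> bool"
  where "stable M W N \<longleftrightarrow> subgroup N (add_monoid M) \<and> (\<forall>a\<in>W. \<forall>x\<in>N. a \<odot>\<^bsub>M\<^esub> x \<in> N)"

lemma submodule_iff_stable: "submodule N R M \<longleftrightarrow> stable M (carrier R) N"
  unfolding submodule_def submodule_axioms_def stable_def by auto

lemma stable_mono: "\<lbrakk>stable M W N; V \<subseteq> W\<rbrakk> \<Longrightarrow> stable M V N"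
  unfolding stable_def by blast

lemma stable_insert: "stable M (insert x W) N \<longleftrightarrow> stable M W N \<and> (\<forall>n\<in>N. x \<odot>\<^bsub>M\<^esub> n \<in> N)"
  unfolding stable_def by blast

lemma stable_Un: "stable M (V \<union> W) N \<longleftrightarrow> stable M V N \<and> stable M W N"
  unfolding stable_def by blast

lemma stable_smult: "\<lbrakk>stable M W N; a \<in> W; n \<in> N\<rbrakk> \<Longrightarrow> a \<odot>\<^bsub>M\<^esub> n \<in> N"
  unfolding stable_def by blast

context left_module
begin

abbreviation madd (infixl "\<boxplus>" 65) where "x \<boxplus> y \<equiv> x \<oplus>\<^bsub>M\<^esub> y"
abbreviation mdiff (infixl "\<boxminus>" 65) where "x \<boxminus> y \<equiv> x \<ominus>\<^bsub>M\<^esub> y"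
abbreviation act (infixr "\<bullet>" 75) where "a \<bullet> x \<equiv> a \<odot>\<^bsub>M\<^esub> x"
abbreviation mzero ("\<zero>\<zero>") where "\<zero>\<zero> \<equiv> \<zero>\<^bsub>M\<^esub>"

declare smult_closed [simp] smult_one [simp]

lemma smult_r_null [simp]: "a \<in> carrier R \<Longrightarrow> a \<bullet> \<zero>\<zero> = \<zero>\<zero>"
  by (metis M.add.r_cancel_one' M.zero_closed M.l_zero smult_closed smult_r_distr)

lemma smult_l_null [simp]: "x \<in> carrier M \<Longrightarrow> \<zero> \<bullet> x = \<zero>\<zero>"
  by (metis M.add.r_cancel_one' R.zero_closed R.l_zero smult_closed smult_l_distr)

lemma smult_r_minus: "\<lbrakk>a \<in> carrier R; x \<in> carrier M\<rbrakk> \<Longrightarrow> a \<bullet> (\<ominus>\<^bsub>M\<^esub> x) = \<ominus>\<^bsub>M\<^esub> (a \<bullet> x)"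
  by (metis M.add.inv_closed M.add.inv_equality M.l_neg smult_closed smult_r_distr smult_r_null)

lemma smult_l_minus: "\<lbrakk>a \<in> carrier R; x \<in> carrier M\<rbrakk> \<Longrightarrow> (\<ominus> a) \<bullet> x = \<ominus>\<^bsub>M\<^esub> (a \<bullet> x)"
  by (metis M.add.inv_equality R.add.inv_closed R.l_neg smult_closed smult_l_distr smult_l_null)

lemma smult_r_diff:
  "\<lbrakk>a \<in> carrier R; x \<in> carrier M; y \<in> carrier M\<rbrakk> \<Longrightarrow> a \<bullet> (x \<boxminus> y) = a \<bullet> x \<boxminus> a \<bullet> y"
  by (simp add: M.minus_eq smult_r_distr smult_r_minus)

lemma smult_l_diff:
  "\<lbrakk>a \<in> carrier R; b \<in> carrier R; x \<in> carrier M\<rbrakk> \<Longrightarrow> (a \<ominus> b) \<bullet> x = a \<bullet> x \<boxminus> b \<bullet> x"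
  by (simp add: M.minus_eq R.minus_eq smult_l_distr smult_l_minus)

lemma diff_eq_zero_iff: "\<lbrakk>x \<in> carrier M; y \<in> carrier M\<rbrakk> \<Longrightarrow> x \<boxminus> y = \<zero>\<zero> \<longleftrightarrow> x = y"
  by (metis M.minus_equality M.minus_minus M.minus_eq M.r_neg M.add.inv_closed)

lemma add_diff_add:
  "\<lbrakk>a \<in> carrier M; b \<in> carrier M; c \<in> carrier M; e \<in> carrier M\<rbrakk>
    \<Longrightarrow> (a \<boxplus> b) \<boxminus> (c \<boxplus> e) = (a \<boxminus> c) \<boxplus> (b \<boxminus> e)"
  by (simp add: M.minus_eq M.minus_add M.a_ac)

lemma diff_right_commute:
  "\<lbrakk>a \<in> carrier M; b \<in> carrier M; c \<in> carrier M\<rbrakk> \<Longrightarrow> a \<boxminus> b \<boxminus> c = a \<boxminus> c \<boxminus> b"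
  by (simp add: M.minus_eq M.a_ac)

lemma add_diff_cancel [simp]: "\<lbrakk>a \<in> carrier M; b \<in> carrier M\<rbrakk> \<Longrightarrow> a \<boxplus> b \<boxminus> b = a"
  by (simp add: M.minus_eq M.a_assoc M.r_neg)

lemma diff_add_cancel [simp]: "\<lbrakk>a \<in> carrier M; b \<in> carrier M\<rbrakk> \<Longrightarrow> a \<boxminus> b \<boxplus> b = a"
  by (simp add: M.minus_eq M.a_assoc M.l_neg)

lemma stable_carrier: "\<lbrakk>stable M W N; x \<in> N\<rbrakk> \<Longrightarrow> x \<in> carrier M"
  unfolding stable_def using subgroup.mem_carrier by fastforce

lemma stable_subset: "stable M W N \<Longrightarrow> N \<subseteq> carrier M"
  using stable_carrier by blast

lemma stable_zero: "stable M W N \<Longrightarrow> \<zero>\<zero> \<in> N"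
  unfolding stable_def using subgroup.one_closed by fastforce

lemma stable_add: "\<lbrakk>stable M W N; x \<in> N; y \<in> N\<rbrakk> \<Longrightarrow> x \<boxplus> y \<in> N"
  unfolding stable_def using subgroup.m_closed by fastforce

lemma stable_minus: "\<lbrakk>stable M W N; x \<in> N\<rbrakk> \<Longrightarrow> \<ominus>\<^bsub>M\<^esub> x \<in> N"
  unfolding stable_def a_inv_def using subgroup.m_inv_closed by fastforce

lemma stable_diff: "\<lbrakk>stable M W N; x \<in> N; y \<in> N\<rbrakk> \<Longrightarrow> x \<boxminus> y \<in> N"
  by (simp add: M.minus_eq stable_add stable_minus)

lemma stable_add_cancel:
  "\<lbrakk>stable M W N; x \<boxplus> y \<in> N; y \<in> N; x \<in> carrier M\<rbrakk> \<Longrightarrow> x \<in> N"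
  by (metis add_diff_cancel stable_carrier stable_diff)

lemma stable_diff_cancel:
  "\<lbrakk>stable M W N; x \<boxminus> y \<in> N; y \<in> N; x \<in> carrier M\<rbrakk> \<Longrightarrow> x \<in> N"
  by (metis diff_add_cancel stable_carrier stable_add)

lemma stable_diff_sym:
  "\<lbrakk>stable M W N; x \<boxminus> y \<in> N; x \<in> carrier M; y \<in> carrier M\<rbrakk> \<Longrightarrow> y \<boxminus> x \<in> N"
  by (metis M.minus_add M.minus_minus M.a_comm M.add.inv_closed M.minus_eq stable_minus)

lemma stableI:
  assumes "N \<subseteq> carrier M" "\<zero>\<zero> \<in> N" "\<And>x y. \<lbrakk>x \<in> N; y \<in> N\<rbrakk> \<Longrightarrow> x \<boxplus> y \<in> N"
    and "\<And>x. x \<in> N \<Longrightarrow> \<ominus>\<^bsub>M\<^esub> x \<in> N"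
    and "\<And>a x. \<lbrakk>a \<in> W; x \<in> N\<rbrakk> \<Longrightarrow> a \<bullet> x \<in> N"
  shows "stable M W N"
  unfolding stable_def
  using assms by (auto intro!: subgroup.intro simp: a_inv_def)

lemma stableI_diff:
  assumes "N \<subseteq> carrier M" "\<zero>\<zero> \<in> N" "\<And>x y. \<lbrakk>x \<in> N; y \<in> N\<rbrakk> \<Longrightarrow> x \<boxminus> y \<in> N"
    and "\<And>a x. \<lbrakk>a \<in> W; x \<in> N\<rbrakk> \<Longrightarrow> a \<bullet> x \<in> N"
  shows "stable M W N"
proof -
  have minus: "\<ominus>\<^bsub>M\<^esub> x \<in> N" if "x \<in> N" for x
    using assms(3)[OF assms(2) that] that assms(1) by (auto simp: M.minus_eq)
  have "x \<boxplus> y \<in> N" if "x \<in> N" "y \<in> N" for x y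
    using assms(3)[OF that(1) minus[OF that(2)]] that assms(1) by (auto simp: M.minus_eq)
  then show ?thesis using minus assms by (intro stableI) auto
qed

lemma stable_zero_set: "W \<subseteq> carrier R \<Longrightarrow> stable M W {\<zero>\<zero>}"
  by (rule stableI) auto

lemma stable_carrier_set: "W \<subseteq> carrier R \<Longrightarrow> stable M W (carrier M)"
  by (rule stableI) auto

lemma stable_Int: "\<lbrakk>stable M W U; stable M W Y\<rbrakk> \<Longrightarrow> stable M W (U \<inter> Y)"
  by (rule stableI) (auto intro: stable_add stable_minus stable_zero stable_smult dest: stable_carrier)

section \<open>Sums of submodules, the modular law and chain conditions in intervals\<close>

definition msum :: "'m set \<Rightarrow> 'm set \<Rightarrow> 'm set"
  where "msum U Y = {x \<boxplus> y |x y. x \<in> U \<and> y \<in> Y}"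

lemma msumI: "\<lbrakk>x \<in> U; y \<in> Y\<rbrakk> \<Longrightarrow> x \<boxplus> y \<in> msum U Y"
  unfolding msum_def by blast

lemma msumE:
  assumes "z \<in> msum U Y"
  obtains x y where "x \<in> U" "y \<in> Y" "z = x \<boxplus> y"
  using assms unfolding msum_def by blast

lemma msum_left: "\<lbrakk>stable M W U; stable M V Y\<rbrakk> \<Longrightarrow> U \<subseteq> msum U Y"
  by (metis M.r_zero msumI stable_carrier stable_zero subsetI)

lemma msum_right: "\<lbrakk>stable M W U; stable M V Y\<rbrakk> \<Longrightarrow> Y \<subseteq> msum U Y"
  by (metis M.l_zero msumI stable_carrier stable_zero subsetI)

lemma msum_least: "\<lbrakk>stable M W Z; U \<subseteq> Z; Y \<subseteq> Z\<rbrakk> \<Longrightarrow> msum U Y \<subseteq> Z"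
  by (auto elim!: msumE intro: stable_add)

lemma stable_msum:
  assumes "W \<subseteq> carrier R" "stable M W U" "stable M W Y"
  shows "stable M W (msum U Y)"
proof (rule stableI_diff)
  note c = stable_carrier[OF assms(2)] stable_carrier[OF assms(3)]
  show "msum U Y \<subseteq> carrier M" using c by (auto elim!: msumE)
  show "\<zero>\<zero> \<in> msum U Y" using msum_left[OF assms(2,3)] stable_zero[OF assms(2)] by blast
  fix u v assume "u \<in> msum U Y" "v \<in> msum U Y"
  then obtain x y x' y' where "x \<in> U" "y \<in> Y" "u = x \<boxplus> y" "x' \<in> U" "y' \<in> Y" "v = x' \<boxplus> y'"
    by (auto elim!: msumE)
  then show "u \<boxminus> v \<in> msum U Y"
    by (simp add: c add_diff_add msumI stable_diff[OF assms(2)] stable_diff[OF assms(3)])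
next
  note c = stable_carrier[OF assms(2)] stable_carrier[OF assms(3)]
  fix a u assume a: "a \<in> W" "u \<in> msum U Y"
  then obtain x y where xy: "x \<in> U" "y \<in> Y" "u = x \<boxplus> y" by (auto elim: msumE)
  have "a \<bullet> u = a \<bullet> x \<boxplus> a \<bullet> y" using a assms(1) c xy by (auto simp: smult_r_distr)
  then show "a \<bullet> u \<in> msum U Y"
    using xy a(1) by (auto intro!: msumI stable_smult[OF assms(2)] stable_smult[OF assms(3)])
qed

abbreviation stable_within :: "'a set \<Rightarrow> 'm set \<Rightarrow> 'm set set"
  where "stable_within W Y \<equiv> {U. stable M W U \<and> U \<subseteq> Y}"

abbreviation interval :: "'m set \<Rightarrow> 'm set \<Rightarrow> 'm set set"
  where "interval U Y \<equiv> {L. stable M (carrier R) L \<and> U \<subseteq> L \<and> L \<subseteq> Y}"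

text \<open>In \<open>y = x \<boxplus> z\<close> the summand \<open>z = y \<boxminus> x\<close> lies
  in \<open>Y \<inter> Z = U \<inter> Z\<close>. This stands in for short exact sequences: the
  intersection with \<open>Z\<close> and the sum with \<open>Z\<close> replace the kernel and the
  image of the projection modulo \<open>Z\<close>.\<close>

lemma modular_equality:
  assumes "stable M W U" "stable M W Y" "stable M W Z" "U \<subseteq> Y"
    and "U \<inter> Z = Y \<inter> Z" "msum U Z = msum Y Z"
  shows "U = Y"
proof (rule subset_antisym[OF assms(4)], rule subsetI)
  fix y assume y: "y \<in> Y"
  then have "y \<in> msum U Z" using msum_left[OF assms(2,3)] assms(6) by blast
  then obtain x z where xz: "x \<in> U" "z \<in> Z" "y = x \<boxplus> z" by (auto elim: msumE)
  have "z = y \<boxminus> x"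
    using xz stable_carrier[OF assms(1)] stable_carrier[OF assms(3)] M.a_comm[of x z] by simp
  then have "z \<in> Y" using y xz assms(2,4) stable_diff by blast
  then have "z \<in> U" using xz assms(5) by blast
  then show "y \<in> U" using xz stable_add[OF assms(1)] by blast
qed

lemma stable_msum_carrier:
  "\<lbrakk>stable M (carrier R) U; stable M (carrier R) Y\<rbrakk> \<Longrightarrow> stable M (carrier R) (msum U Y)"
  by (simp add: stable_msum)

lemma chain_antimono:
  fixes N :: "nat \<Rightarrow> 'x set"
  assumes "\<And>i. N (Suc i) \<subseteq> N i" "i \<le> j"
  shows "N j \<subseteq> N i"
  using assms by (metis lift_Suc_antimono_le)

lemma msum_mono: "\<lbrakk>U \<subseteq> U'; Y \<subseteq> Y'\<rbrakk> \<Longrightarrow> msum U Y \<subseteq> msum U' Y'"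
  unfolding msum_def by blast

text \<open>Intersecting a chain with \<open>Y\<close> and adding \<open>Y\<close> to it gives
  chains in the two intervals; once both are constant, the modular law makes the chain itself
  constant.\<close>

lemma dcc_trans:
  assumes "stable M (carrier R) Y" "U \<subseteq> Y" "Y \<subseteq> Z" "stable M (carrier R) Z"
    and "dcc_family (interval U Y)" "dcc_family (interval Y Z)"
  shows "dcc_family (interval U Z)"
  unfolding dcc_family_def
proof (intro allI impI)
  fix N :: "nat \<Rightarrow> 'm set" assume N: "\<forall>i. N i \<in> interval U Z \<and> N (Suc i) \<subseteq> N i"
  obtain k where k: "\<And>i. i \<ge> k \<Longrightarrow> N i \<inter> Y = N k \<inter> Y"
    by (rule dcc_familyD[OF assms(5), of "\<lambda>i. N i \<inter> Y"]) (use N assms in \<open>auto intro!: stable_Int\<close>)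
  obtain l where l: "\<And>i. i \<ge> l \<Longrightarrow> msum (N i) Y = msum (N l) Y"
  proof (rule dcc_familyD[OF assms(6), of "\<lambda>i. msum (N i) Y"])
    show "msum (N i) Y \<in> interval Y Z" for i
      using N assms msum_least[OF assms(4), of "N i" Y] msum_right[OF _ assms(1), of "carrier R" "N i"]
      by (simp add: stable_msum)
    show "msum (N (Suc i)) Y \<subseteq> msum (N i) Y" for i using N by (simp add: msum_mono)
  qed blast
  have "N i = N (max k l)" if "i \<ge> max k l" for i
  proof (rule modular_equality[OF _ _ assms(1)])
    show "N i \<subseteq> N (max k l)" using N that chain_antimono[of N "max k l" i] by simp
    show "N i \<inter> Y = N (max k l) \<inter> Y" using that k[of i] k[of "max k l"] by auto
    show "msum (N i) Y = msum (N (max k l)) Y" using that l[of i] l[of "max k l"] by auto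
  qed (use N in auto)
  then show "\<exists>k. \<forall>i\<ge>k. N i = N k" by blast
qed

text \<open>Second isomorphism theorem in lattice form. Every member of a chain between
  \<open>Y\<close> and \<open>Y + Z\<close> has the same sum with \<open>Z\<close>, so it is
  determined by its intersection with \<open>Z\<close>, which lies between \<open>U\<close> and
  \<open>Z\<close>.\<close>

lemma dcc_sum:
  assumes "stable M (carrier R) Y" "stable M (carrier R) Z" "U \<subseteq> Y"
    and "dcc_family (interval U Z)" "U \<subseteq> Z"
  shows "dcc_family (interval Y (msum Y Z))"
  unfolding dcc_family_def
proof (intro allI impI)
  fix N :: "nat \<Rightarrow> 'm set" assume N: "\<forall>i. N i \<in> interval Y (msum Y Z) \<and> N (Suc i) \<subseteq> N i"
  obtain k where k: "\<And>i. i \<ge> k \<Longrightarrow> N i \<inter> Z = N k \<inter> Z"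
  proof (rule dcc_familyD[OF assms(4), of "\<lambda>i. N i \<inter> Z"])
    show "N i \<inter> Z \<in> interval U Z" for i
      using N assms(3,5) stable_Int[OF _ assms(2), of "N i"] by (simp add: subset_iff)
    show "N (Suc i) \<inter> Z \<subseteq> N i \<inter> Z" for i using N by blast
  qed blast
  have eq: "msum (N i) Z = msum Y Z" for i
  proof
    show "msum (N i) Z \<subseteq> msum Y Z"
      using N msum_right[OF assms(1,2)] by (intro msum_least[OF stable_msum_carrier[OF assms(1,2)]]) auto
    show "msum Y Z \<subseteq> msum (N i) Z" using N by (intro msum_mono) auto
  qed
  have "N i = N k" if "i \<ge> k" for i
    by (rule modular_equality[OF _ _ assms(2)])
       (use N that k[of i] eq chain_antimono[of N k i] in simp_all)
  then show "\<exists>k. \<forall>i\<ge>k. N i = N k" by blast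
qed

text \<open>The modular law is used twice: \<open>N i\<close> is controlled by
  \<open>N i \<inter> Y\<close> and \<open>N i + Y\<close>, and the latter by its intersection with
  \<open>Z\<close>, because its sum with \<open>Z\<close> is always \<open>Y + Z\<close>.\<close>

lemma acc_sum:
  assumes W: "W \<subseteq> carrier R" and Y: "stable M W Y" and Z: "stable M W Z"
    and acc: "acc_family (stable_within W Y)" "acc_family (stable_within W Z)"
  shows "acc_family (stable_within W (msum Y Z))"
  unfolding acc_family_def
proof (intro allI impI)
  fix N :: "nat \<Rightarrow> 'm set"
  assume N: "\<forall>i. N i \<in> stable_within W (msum Y Z) \<and> N i \<subseteq> N (Suc i)"
  have st: "stable M W (N i)" "N i \<subseteq> msum Y Z" "N i \<subseteq> N (Suc i)" for i using N by simp_all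
  have mono: "N i \<subseteq> N j" if "i \<le> j" for i j using that by (rule lift_Suc_mono_le[of N, OF st(3)])
  have NY: "stable M W (msum (N i) Y)" for i by (rule stable_msum[OF W st(1) Y])
  obtain k where k: "\<And>i. i \<ge> k \<Longrightarrow> N i \<inter> Y = N k \<inter> Y"
    by (rule acc_familyD[OF acc(1), of "\<lambda>i. N i \<inter> Y"]) (use st(3) in \<open>auto intro!: stable_Int st(1) Y\<close>)
  obtain l where l: "\<And>i. i \<ge> l \<Longrightarrow> msum (N i) Y \<inter> Z = msum (N l) Y \<inter> Z"
  proof (rule acc_familyD[OF acc(2), of "\<lambda>i. msum (N i) Y \<inter> Z"])
    show "msum (N i) Y \<inter> Z \<in> stable_within W Z" for i using stable_Int[OF NY Z] by simp
    show "msum (N i) Y \<inter> Z \<subseteq> msum (N (Suc i)) Y \<inter> Z" for i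
      using msum_mono[OF st(3)[of i] subset_refl[of Y]] by blast
  qed blast
  have full: "msum (msum (N i) Y) Z = msum Y Z" for i
  proof
    have YZ: "stable M W (msum Y Z)" by (rule stable_msum[OF W Y Z])
    show "msum (msum (N i) Y) Z \<subseteq> msum Y Z"
      by (intro msum_least[OF YZ] st(2) msum_left[OF Y Z] msum_right[OF Y Z])
    show "msum Y Z \<subseteq> msum (msum (N i) Y) Z" by (rule msum_mono[OF msum_right[OF st(1) Y] subset_refl])
  qed
  have "N (max k l) = N i" if i: "i \<ge> max k l" for i
  proof (rule modular_equality[OF st(1) st(1) Y mono[OF i]])
    show "N (max k l) \<inter> Y = N i \<inter> Y" using i k[of i] k[of "max k l"] by simp
    show "msum (N (max k l)) Y = msum (N i) Y"
    proof (rule modular_equality[OF NY NY Z msum_mono[OF mono[OF i] subset_refl]])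
      show "msum (N (max k l)) Y \<inter> Z = msum (N i) Y \<inter> Z" using i l[of i] l[of "max k l"] by simp
    qed (simp add: full)
  qed
  then show "\<exists>k. \<forall>i\<ge>k. N i = N k" by metis
qed

end

section \<open>Adjoining one operator\<close>

text \<open>The condition \<open>comm\<close> covers both extensions in use: a new generator of the
  commutative ring, with \<open>b' = \<zero>\<close>, and \<open>\<theta>\<close>, with
  \<open>b'\<close> the derivative of \<open>b\<close>.\<close>

locale ore_step = left_module R M
  for R :: "('a, 'b) ring_scheme" (structure) and M :: "('a, 'm, 'c) module_scheme" (structure) +
  fixes W :: "'a set" and x :: 'a and N\<^sub>0 :: "'m set"
  assumes W_closed: "W \<subseteq> carrier R" and x_closed [simp]: "x \<in> carrier R"
    and comm: "b \<in> W \<Longrightarrow> \<exists>b'\<in>W. x \<otimes> b = b \<otimes> x \<oplus> b'"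
    and N0_stable: "stable M W N\<^sub>0"
begin

primrec xpow :: "nat \<Rightarrow> 'a" where
  "xpow 0 = \<one>"
| "xpow (Suc i) = x \<otimes> xpow i"

text \<open>Index \<open>i\<close> stands for degree strictly below \<open>i\<close>, so
  \<open>fil 0\<close> is zero and \<open>fil i\<close> collects exactly the terms that are lower
  than \<open>xpow i\<close>.\<close>

primrec fil :: "nat \<Rightarrow> 'm set" where
  "fil 0 = {\<zero>\<zero>}"
| "fil (Suc i) = {xpow i \<bullet> n \<boxplus> l |n l. n \<in> N\<^sub>0 \<and> l \<in> fil i}"

definition span :: "'m set"
  where "span = (\<Union>i. fil i)"

text \<open>The module need not be free over the powers of \<open>x\<close>, so an element has no
  well-defined leading coefficient. Membership modulo \<open>fil i\<close> avoids choosing a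
  representation; in particular \<open>lead i {\<zero>\<zero>}\<close> records relations and may be
  nonzero.\<close>

definition lead :: "nat \<Rightarrow> 'm set \<Rightarrow> 'm set"
  where "lead i L = {n \<in> N\<^sub>0. xpow i \<bullet> n \<in> msum L (fil i)}"

lemma N0_carrier [simp]: "n \<in> N\<^sub>0 \<Longrightarrow> n \<in> carrier M"
  using N0_stable stable_carrier by blast

lemma xpow_closed [simp]: "xpow i \<in> carrier R"
  by (induction i) auto

declare xpow.simps(2) [simp del]

lemma pow_Suc_act [simp]: "n \<in> carrier M \<Longrightarrow> xpow (Suc i) \<bullet> n = x \<bullet> xpow i \<bullet> n"
  by (simp add: xpow.simps(2) smult_assoc1)

lemma filI: "\<lbrakk>n \<in> N\<^sub>0; l \<in> fil i\<rbrakk> \<Longrightarrow> xpow i \<bullet> n \<boxplus> l \<in> fil (Suc i)"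
  by auto

lemma filE:
  assumes "y \<in> fil (Suc i)"
  obtains n l where "n \<in> N\<^sub>0" "l \<in> fil i" "y = xpow i \<bullet> n \<boxplus> l"
  using assms by auto

declare fil.simps(2) [simp del]

lemma fil_carrier: "y \<in> fil i \<Longrightarrow> y \<in> carrier M"
  by (induction i arbitrary: y) (auto elim!: filE)

lemma fil_additive: "stable M {} (fil i)"
proof (induction i)
  case 0
  then show ?case using stable_zero_set[of "{}"] by simp
next
  case (Suc i)
  show ?case
  proof (rule stableI_diff)
    show "fil (Suc i) \<subseteq> carrier M" using fil_carrier by blast
    have "xpow i \<bullet> \<zero>\<zero> \<boxplus> \<zero>\<zero> \<in> fil (Suc i)"
      by (rule filI[OF stable_zero[OF N0_stable] stable_zero[OF Suc]])
    then show "\<zero>\<zero> \<in> fil (Suc i)" by simp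
    fix u v assume "u \<in> fil (Suc i)" "v \<in> fil (Suc i)"
    then obtain n l n' l' where nl: "n \<in> N\<^sub>0" "l \<in> fil i" "u = xpow i \<bullet> n \<boxplus> l"
      "n' \<in> N\<^sub>0" "l' \<in> fil i" "v = xpow i \<bullet> n' \<boxplus> l'" by (elim filE)
    then have "u \<boxminus> v = xpow i \<bullet> (n \<boxminus> n') \<boxplus> (l \<boxminus> l')"
      by (simp add: add_diff_add smult_r_diff fil_carrier)
    then show "u \<boxminus> v \<in> fil (Suc i)"
      using filI stable_diff[OF N0_stable] stable_diff[OF Suc] nl by simp
  qed auto
qed

lemma fil_Suc: "fil i \<subseteq> fil (Suc i)"
proof
  fix y assume "y \<in> fil i"
  then show "y \<in> fil (Suc i)"
    using filI[OF stable_zero[OF N0_stable], of y i] by (simp add: fil_carrier)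
qed

lemma fil_mono: "i \<le> j \<Longrightarrow> fil i \<subseteq> fil j"
  by (rule lift_Suc_mono_le[of fil, OF fil_Suc])

lemma pow_act_fil: "n \<in> N\<^sub>0 \<Longrightarrow> xpow i \<bullet> n \<in> fil (Suc i)"
  using filI[of n "\<zero>\<zero>" i] stable_zero[OF fil_additive] by simp

lemma x_fil: "y \<in> fil i \<Longrightarrow> x \<bullet> y \<in> fil (Suc i)"
proof (induction i arbitrary: y)
  case 0
  then show ?case using stable_zero[OF fil_additive] by simp
next
  case (Suc i)
  then obtain n l where nl: "n \<in> N\<^sub>0" "l \<in> fil i" "y = xpow i \<bullet> n \<boxplus> l" by (elim filE)
  then have "x \<bullet> y = xpow (Suc i) \<bullet> n \<boxplus> x \<bullet> l"
    by (simp add: smult_r_distr fil_carrier)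
  then show ?case using filI[OF nl(1) Suc.IH[OF nl(2)]] by simp
qed

text \<open>Moving \<open>b\<close> past one factor \<open>x\<close> creates a term with another
  operator \<open>b'\<close> of \<open>W\<close>, to which the induction hypothesis is applied as
  well; hence \<open>b\<close> is arbitrary in the induction.\<close>

lemma commute_pow:
  "\<lbrakk>b \<in> W; n \<in> N\<^sub>0\<rbrakk> \<Longrightarrow> b \<bullet> xpow i \<bullet> n \<boxminus> xpow i \<bullet> b \<bullet> n \<in> fil i"
proof (induction i arbitrary: b)
  case 0
  then have "b \<in> carrier R" "n \<in> carrier M" using W_closed by auto
  then show ?case by (simp add: M.minus_eq M.r_neg)
next
  case (Suc i)
  obtain b' where b': "b' \<in> W" "x \<otimes> b = b \<otimes> x \<oplus> b'" using comm Suc.prems by blast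
  have [simp]: "b \<in> carrier R" "b' \<in> carrier R" using Suc.prems b' W_closed by auto
  define m where "m = xpow i \<bullet> n"
  have [simp]: "m \<in> carrier M" "n \<in> carrier M" using Suc.prems by (auto simp: m_def)
  have xbm: "x \<bullet> b \<bullet> m = b \<bullet> x \<bullet> m \<boxplus> b' \<bullet> m"
    using b'(2) by (metis R.m_closed smult_assoc1 smult_l_distr x_closed
        \<open>b \<in> carrier R\<close> \<open>b' \<in> carrier R\<close> \<open>m \<in> carrier M\<close>)
  have xm: "xpow (Suc i) \<bullet> n = x \<bullet> m"
    unfolding m_def by (rule pow_Suc_act) simp
  have bx: "b \<bullet> x \<bullet> m = x \<bullet> b \<bullet> m \<boxminus> b' \<bullet> m"
  proof -
    have "b \<bullet> x \<bullet> m \<in> carrier M" "b' \<bullet> m \<in> carrier M"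
      using \<open>b \<in> carrier R\<close> \<open>b' \<in> carrier R\<close> \<open>m \<in> carrier M\<close> x_closed smult_closed by blast+
    then show ?thesis unfolding xbm by (rule add_diff_cancel[symmetric])
  qed
  have b'n: "b' \<bullet> n \<in> N\<^sub>0" using stable_smult[OF N0_stable b'(1)] Suc.prems by simp
  have "b' \<bullet> m \<boxminus> xpow i \<bullet> b' \<bullet> n \<in> fil (Suc i)"
    using Suc.IH[OF b'(1)] Suc.prems fil_Suc unfolding m_def by blast
  then have 1: "b' \<bullet> m \<in> fil (Suc i)"
    by (rule stable_diff_cancel[OF fil_additive]) (auto intro: pow_act_fil b'n)
  have "x \<bullet> (b \<bullet> m \<boxminus> xpow i \<bullet> b \<bullet> n) \<in> fil (Suc i)"
    using Suc unfolding m_def by (intro x_fil) auto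
  then have 2: "x \<bullet> b \<bullet> m \<boxminus> xpow (Suc i) \<bullet> b \<bullet> n \<in> fil (Suc i)"
    by (simp add: smult_r_diff pow_Suc_act)
  have "b \<bullet> xpow (Suc i) \<bullet> n \<boxminus> xpow (Suc i) \<bullet> b \<bullet> n
      = (x \<bullet> b \<bullet> m \<boxminus> xpow (Suc i) \<bullet> b \<bullet> n) \<boxminus> b' \<bullet> m"
    unfolding xm bx by (rule diff_right_commute) simp_all
  then show ?case using stable_diff[OF fil_additive 2 1] by simp
qed

lemma fil_stable: "stable M W (fil i)"
proof (induction i)
  case 0
  then show ?case using stable_zero_set W_closed by simp
next
  case (Suc i)
  have "b \<bullet> y \<in> fil (Suc i)" if b: "b \<in> W" and "y \<in> fil (Suc i)" for b y
  proof -
    obtain n l where nl: "n \<in> N\<^sub>0" "l \<in> fil i" "y = xpow i \<bullet> n \<boxplus> l" using filE[OF \<open>y \<in> fil (Suc i)\<close>] by metis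
    have bR: "b \<in> carrier R" using b W_closed by blast
    have bn: "b \<bullet> n \<in> N\<^sub>0" using stable_smult[OF N0_stable b] nl by simp
    have "b \<bullet> xpow i \<bullet> n \<in> fil (Suc i)"
      by (rule stable_diff_cancel[OF fil_additive, of _ "xpow i \<bullet> b \<bullet> n"])
         (use commute_pow[OF b nl(1), of i] fil_Suc bR nl pow_act_fil[OF bn] in auto)
    moreover have "b \<bullet> l \<in> fil (Suc i)" using stable_smult[OF Suc b] nl fil_Suc by blast
    ultimately show ?thesis
      using stable_add[OF fil_additive] nl bR by (simp add: smult_r_distr fil_carrier)
  qed
  then show ?case using fil_additive[of "Suc i"] unfolding stable_def by blast
qed

lemma spanE:
  assumes "y \<in> span"
  obtains i where "y \<in> fil i"
  using assms unfolding span_def by blast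

lemma fil_subset_span: "fil i \<subseteq> span"
  unfolding span_def by blast

lemma span_stable: "stable M (insert x W) span"
proof (rule stableI_diff)
  show "span \<subseteq> carrier M" unfolding span_def using fil_carrier by blast
  show "\<zero>\<zero> \<in> span" using fil_subset_span[of 0] by simp
  show "u \<boxminus> v \<in> span" if "u \<in> span" "v \<in> span" for u v
  proof -
    obtain i j where "u \<in> fil i" "v \<in> fil j" using \<open>u \<in> span\<close> \<open>v \<in> span\<close> by (elim spanE)
    then have "u \<in> fil (max i j)" "v \<in> fil (max i j)" using fil_mono by (meson max.cobounded1 max.cobounded2 subsetD)+
    then show ?thesis using stable_diff[OF fil_additive] fil_subset_span by blast
  qed
  show "a \<bullet> y \<in> span" if "a \<in> insert x W" "y \<in> span" for a y
    using that x_fil stable_smult[OF fil_stable] fil_subset_span by (blast elim: spanE)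
qed

lemma N0_subset_span: "N\<^sub>0 \<subseteq> span"
proof
  fix n assume "n \<in> N\<^sub>0"
  then show "n \<in> span" using pow_act_fil[of n 0] fil_subset_span[of "Suc 0"] by auto
qed

lemma span_least:
  assumes "stable M (insert x W) L" "N\<^sub>0 \<subseteq> L"
  shows "span \<subseteq> L"
proof -
  have pow: "xpow i \<bullet> n \<in> L" if "n \<in> N\<^sub>0" for i n
  proof (induction i)
    case 0
    then show ?case using that assms by auto
  next
    case (Suc i)
    then show ?case using that stable_smult[OF assms(1), of x] by (simp add: pow_Suc_act)
  qed
  have "fil i \<subseteq> L" for i
    by (induction i) (use pow stable_add[OF assms(1)] stable_zero[OF assms(1)] in \<open>auto elim!: filE\<close>)
  then show ?thesis unfolding span_def by blast
qed

lemma msum_fil_stable: "stable M W L \<Longrightarrow> stable M W (msum L (fil i))"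
  using stable_msum[OF W_closed] fil_stable by blast

lemma leadD: "n \<in> lead i L \<Longrightarrow> n \<in> N\<^sub>0 \<and> xpow i \<bullet> n \<in> msum L (fil i)"
  unfolding lead_def by blast

lemma lead_subset: "lead i L \<subseteq> N\<^sub>0"
  unfolding lead_def by blast

lemma lead_stable:
  assumes "stable M W L"
  shows "stable M W (lead i L)"
proof -
  note S = msum_fil_stable[OF assms, of i]
  show ?thesis
  proof (rule stableI_diff)
    show "lead i L \<subseteq> carrier M" using lead_subset stable_subset[OF N0_stable] by blast
    show "\<zero>\<zero> \<in> lead i L" unfolding lead_def using stable_zero[OF S] stable_zero[OF N0_stable] by simp
    show "u \<boxminus> v \<in> lead i L" if "u \<in> lead i L" "v \<in> lead i L" for u v
      using leadD[OF that(1)] leadD[OF that(2)] stable_diff[OF S] stable_diff[OF N0_stable]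
      unfolding lead_def by (simp add: smult_r_diff)
    show "b \<bullet> n \<in> lead i L" if b: "b \<in> W" and n: "n \<in> lead i L" for b n
    proof -
      have bR: "b \<in> carrier R" using b W_closed by blast
      have "b \<bullet> xpow i \<bullet> n \<boxminus> xpow i \<bullet> b \<bullet> n \<in> msum L (fil i)"
        using commute_pow[OF b] leadD[OF n] msum_right[OF assms fil_stable] by blast
      moreover have "b \<bullet> xpow i \<bullet> n \<in> msum L (fil i)" using leadD[OF n] b stable_smult[OF S] by blast
      ultimately have "xpow i \<bullet> b \<bullet> n \<in> msum L (fil i)"
        using leadD[OF n] bR by (meson N0_carrier xpow_closed S smult_closed stable_diff_cancel stable_diff_sym x_closed)
      then show ?thesis using stable_smult[OF N0_stable b] leadD[OF n] unfolding lead_def by blast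
    qed
  qed
qed

lemma lead_mono: "L \<subseteq> L' \<Longrightarrow> lead i L \<subseteq> lead i L'"
  unfolding lead_def using msum_mono by blast

lemma lead_Suc:
  assumes "stable M (insert x W) L"
  shows "lead i L \<subseteq> lead (Suc i) L"
proof
  fix n assume "n \<in> lead i L"
  then obtain y l where yl: "n \<in> N\<^sub>0" "xpow i \<bullet> n = y \<boxplus> l" "y \<in> L" "l \<in> fil i"
    unfolding lead_def by (auto elim: msumE)
  then have "xpow (Suc i) \<bullet> n = x \<bullet> y \<boxplus> x \<bullet> l"
    using stable_carrier[OF assms] fil_carrier by (simp add: pow_Suc_act smult_r_distr)
  then show "n \<in> lead (Suc i) L"
    using yl x_fil stable_smult[OF assms, of x] msumI unfolding lead_def by auto
qed

lemma lead_le: "\<lbrakk>stable M (insert x W) L; i \<le> j\<rbrakk> \<Longrightarrow> lead i L \<subseteq> lead j L"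
  by (rule lift_Suc_mono_le[of "\<lambda>i. lead i L", OF lead_Suc])

text \<open>Subtracting from \<open>y\<close> an element of \<open>L\<close> with the same leading
  coefficient leaves an element of \<open>L'\<close> one step lower in the filtration, where
  induction applies.\<close>

lemma subset_by_lead:
  assumes "stable M W L" "stable M W L'" "L \<subseteq> L'" "L' \<subseteq> span"
    and "\<And>i. lead i L' \<subseteq> lead i L"
  shows "L' \<subseteq> L"
proof -
  have "y \<in> L" if "y \<in> L'" "y \<in> fil i" for i y
    using that
  proof (induction i arbitrary: y)
    case 0
    then show ?case using stable_zero[OF assms(1)] by simp
  next
    case (Suc i)
    then obtain n l where nl: "n \<in> N\<^sub>0" "l \<in> fil i" "y = xpow i \<bullet> n \<boxplus> l" by (elim filE)
    have yc: "y \<in> carrier M" "l \<in> carrier M" using nl fil_carrier by auto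
    have "xpow i \<bullet> n = y \<boxplus> (\<ominus>\<^bsub>M\<^esub> l)" using nl yc by (simp add: M.a_assoc M.r_neg)
    also have "\<dots> \<in> msum L' (fil i)"
      using Suc.prems nl stable_minus[OF fil_stable] by (intro msumI)
    finally have "n \<in> lead i L'" using nl unfolding lead_def by simp
    then obtain u k where uk: "u \<in> L" "k \<in> fil i" "xpow i \<bullet> n = u \<boxplus> k"
      using assms(5)[of i] leadD[of n i L] by (auto elim: msumE)
    have uc: "u \<in> carrier M" "k \<in> carrier M" using uk stable_carrier[OF assms(1)] fil_carrier by auto
    have eq: "y = u \<boxplus> (k \<boxplus> l)" using nl uk uc yc by (simp add: M.a_assoc)
    have "k \<boxplus> l \<in> fil i" using stable_add[OF fil_stable] uk nl by blast
    moreover have "k \<boxplus> l \<in> L'"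
      using Suc.prems(1) uk(1) assms(3) eq uc yc
      by (metis M.a_comm M.add.m_closed assms(2) stable_add_cancel subsetD)
    ultimately have "k \<boxplus> l \<in> L" using Suc.IH by blast
    then show ?case using eq uk stable_add[OF assms(1)] by blast
  qed
  then show ?thesis using assms(4) by (blast elim: spanE)
qed

lemma lead_stabilises:
  assumes "acc_family (stable_within W N\<^sub>0)" "stable M (insert x W) L"
  shows "\<exists>k. \<forall>i\<ge>k. lead i L = lead k L"
proof -
  have "stable M W L" using assms(2) by (simp add: stable_insert)
  then show ?thesis
    using lead_Suc[OF assms(2)] lead_stable lead_subset
    by (intro acc_family_stabilises[OF assms(1), of "\<lambda>i. lead i L"]) simp_all
qed

text \<open>Hilbert's basis argument on the double sequence \<open>lead i (L j)\<close>, increasing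
  in both indices. The diagonal is constant from \<open>k\<close> on, which settles all rows above
  \<open>k\<close> at once; the finitely many rows up to \<open>k\<close> stabilise
  separately.\<close>

theorem acc_step:
  assumes "acc_family (stable_within W N\<^sub>0)"
  shows "acc_family (stable_within (insert x W) span)"
  unfolding acc_family_def
proof (intro allI impI)
  fix L :: "nat \<Rightarrow> 'm set"
  assume L: "\<forall>j. L j \<in> stable_within (insert x W) span \<and> L j \<subseteq> L (Suc j)"
  have st: "stable M (insert x W) (L j)" "stable M W (L j)" "L j \<subseteq> span" for j
    using L by (simp_all add: stable_insert)
  have mono: "L i \<subseteq> L j" if "i \<le> j" for i j using lift_Suc_mono_le[of L i j] L that by simp
  have inF: "lead i (L j) \<in> stable_within W N\<^sub>0" for i j using lead_stable st lead_subset by blast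
  have "\<exists>k. \<forall>i\<ge>k. lead i (L i) = lead k (L k)"
  proof -
    have "lead i (L i) \<subseteq> lead (Suc i) (L (Suc i))" for i
      using lead_Suc[OF st(1), of i i] lead_mono[OF mono[of i "Suc i"], of "Suc i"] by simp
    with inF show ?thesis
      by (rule acc_family_stabilises[OF assms, of "\<lambda>i. lead i (L i)"])
  qed
  then obtain k where k: "\<And>i. i \<ge> k \<Longrightarrow> lead i (L i) = lead k (L k)" by blast
  have "\<exists>m. \<forall>j\<ge>m. lead i (L j) = lead i (L m)" for i
  proof -
    have "lead i (L j) \<subseteq> lead i (L (Suc j))" for j using lead_mono mono by simp
    with inF show ?thesis by (rule acc_family_stabilises[OF assms, of "\<lambda>j. lead i (L j)"])
  qed
  then obtain m where m: "\<And>i j. j \<ge> m i \<Longrightarrow> lead i (L j) = lead i (L (m i))" by metis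
  define K where "K = Max (insert k (m ` {..k}))"
  have K: "k \<le> K" "\<And>i. i \<le> k \<Longrightarrow> m i \<le> K" unfolding K_def by (rule Max_ge; simp)+
  have "lead i (L j) \<subseteq> lead i (L K)" if "j \<ge> K" for i j
  proof (cases "i \<le> k")
    case True
    then show ?thesis using m[of i j] m[of i K] K(2)[OF True] that by auto
  next
    case False
    \<comment> \<open>For \<open>i\<close> above \<open>k\<close> the value is squeezed: it lies
      below the diagonal value at \<open>h\<close>, which equals the one at \<open>k\<close>, and
      that lies below \<open>lead i (L K)\<close>.\<close>
    define h where "h = max i j"
    have "lead i (L j) \<subseteq> lead h (L h)"
      using lead_le[OF st(1), of i h j] lead_mono[OF mono[of j h], of h] unfolding h_def by auto
    also have "\<dots> = lead k (L k)" using k[of h] False unfolding h_def by simp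
    also have "\<dots> \<subseteq> lead i (L K)"
      using lead_le[OF st(1), of k i K] lead_mono[OF mono[OF K(1)], of k] False by auto
    finally show ?thesis .
  qed
  then have "L j = L K" if "j \<ge> K" for j
    using subset_by_lead[OF st(2) st(2) mono[OF that] st(3)] mono[OF that] that by blast
  then show "\<exists>k. \<forall>i\<ge>k. L i = L k" by blast
qed

end

text \<open>
  Modulo \<open>L\<close>, the operator \<open>t\<close> is injective on \<open>Y\<close> and the infinitely \<open>t\<close>-divisible elements of \<open>Y\<close> are
  torsion with respect to \<open>T\<close>. Unlike freeness over a localisation, which generic flatness would
  give, this passes to extensions and to ascending unions by elementary arguments.
\<close>

definition (in left_module) separates :: "'a set \<Rightarrow> 'a \<Rightarrow> 'm set \<Rightarrow> 'm set \<Rightarrow> bool"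
  where "separates T t L Y \<longleftrightarrow> (\<forall>y\<in>Y. t \<bullet> y \<in> L \<longrightarrow> y \<in> L) \<and>
    (\<forall>y\<in>Y. (\<forall>n::nat. \<exists>z\<in>Y. y \<boxminus> (t [^] n) \<bullet> z \<in> L) \<longrightarrow> (\<exists>\<tau>\<in>T. \<tau> \<bullet> y \<in> L))"

text \<open>\<open>T\<close> is the multiplicative set that generic flatness would invert. Its
  elements act centrally on \<open>M\<close> and therefore pass through \<open>xpow i\<close>
  without correction terms.\<close>

locale ore_step_torsion = ore_step R M W x N\<^sub>0
  for R :: "('a, 'b) ring_scheme" (structure) and M :: "('a, 'm, 'c) module_scheme" (structure)
    and W x N\<^sub>0 +
  fixes T :: "'a set"
  assumes T_closed: "T \<subseteq> carrier R" and T_one: "\<one> \<in> T"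
    and T_mult: "\<lbrakk>s \<in> T; t \<in> T\<rbrakk> \<Longrightarrow> s \<otimes> t \<in> T"
    and T_commute: "\<lbrakk>s \<in> T; a \<in> carrier R; m \<in> carrier M\<rbrakk> \<Longrightarrow> s \<bullet> a \<bullet> m = a \<bullet> s \<bullet> m"
    and T_N0: "stable M T N\<^sub>0"
begin

lemma T_carrier [simp]: "s \<in> T \<Longrightarrow> s \<in> carrier R"
  using T_closed by blast

lemma T_pow: "s \<in> T \<Longrightarrow> s [^] (n::nat) \<in> T"
  by (induction n) (simp_all add: T_one T_mult)

lemma T_xpow: "\<lbrakk>s \<in> T; n \<in> carrier M\<rbrakk> \<Longrightarrow> s \<bullet> xpow i \<bullet> n = xpow i \<bullet> s \<bullet> n"
  by (rule T_commute) simp_all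

lemma T_fil: "stable M T (fil i)"
proof (induction i)
  case 0
  then show ?case using stable_zero_set T_closed by simp
next
  case (Suc i)
  have "s \<bullet> y \<in> fil (Suc i)" if s: "s \<in> T" and "y \<in> fil (Suc i)" for s y
  proof -
    obtain n l where nl: "n \<in> N\<^sub>0" "l \<in> fil i" "y = xpow i \<bullet> n \<boxplus> l"
      using filE[OF \<open>y \<in> fil (Suc i)\<close>] by metis
    have "s \<bullet> y = xpow i \<bullet> s \<bullet> n \<boxplus> s \<bullet> l"
      using nl s by (simp add: smult_r_distr fil_carrier T_xpow)
    then show ?thesis
      using filI[OF stable_smult[OF T_N0 s nl(1)] stable_smult[OF Suc s nl(2)]] by simp
  qed
  then show ?case using fil_additive[of "Suc i"] unfolding stable_def by blast
qed

lemma T_span: "stable M T span"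
proof -
  have "s \<bullet> y \<in> span" if "s \<in> T" "y \<in> span" for s y
    using stable_smult[OF T_fil that(1)] that(2) fil_subset_span by (blast elim: spanE)
  then show ?thesis using span_stable unfolding stable_def by blast
qed

lemma mod_fil_diff:
  assumes "y \<in> msum L (fil i)" "stable M V L"
  obtains u l where "u \<in> L" "l \<in> fil i" "y = u \<boxplus> l" "y \<boxminus> l = u" "y \<boxminus> u = l"
    "u \<in> carrier M" "l \<in> carrier M" "y \<in> carrier M"
proof -
  obtain u l where ul: "u \<in> L" "l \<in> fil i" "y = u \<boxplus> l" using assms by (auto elim: msumE)
  moreover have "u \<in> carrier M" "l \<in> carrier M" using ul stable_carrier[OF assms(2)] fil_carrier by auto
  moreover from this have "y \<boxminus> l = u" "y \<boxminus> u = l"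
    using ul(3) add_diff_cancel[of u l] add_diff_cancel[of l u] M.a_comm[of u l] by simp_all
  ultimately show ?thesis using that by simp
qed

context
  fixes L t
  assumes L_stable: "stable M (insert x W) L" "stable M T L"
    and t: "t \<in> T"
    and sep: "\<And>i. separates T t (lead i L) N\<^sub>0"
begin

lemma mod_fil_T: "stable M T (msum L (fil i))"
  by (rule stable_msum[OF T_closed L_stable(2) T_fil])

lemma L_mod_fil: "L \<subseteq> msum L (fil i)"
  by (rule msum_left[OF L_stable(2) T_fil])

lemma fil_mod_fil: "fil i \<subseteq> msum L (fil i)"
  by (rule msum_right[OF L_stable(2) T_fil])

lemma mod_fil_mono: "i \<le> j \<Longrightarrow> msum L (fil i) \<subseteq> msum L (fil j)"
  using msum_mono[OF subset_refl fil_mono] .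

text \<open>The degree is lowered one step at a time. As long as it exceeds \<open>j\<close>, the
  leading coefficient \<open>n\<close> of \<open>y\<close> satisfies
  \<open>t \<bullet> n \<in> lead i L\<close>, so injectivity modulo \<open>lead i L\<close> puts
  \<open>n\<close> there and \<open>y\<close> drops into \<open>msum L (fil i)\<close>.\<close>

lemma injective_mod_fil:
  "\<lbrakk>y \<in> msum L (fil i); t \<bullet> y \<in> msum L (fil j)\<rbrakk> \<Longrightarrow> y \<in> msum L (fil j)"
proof (induction i arbitrary: y)
  case 0
  then show ?case using mod_fil_mono[of 0 j] by auto
next
  case (Suc i)
  show ?case
  proof (cases "Suc i \<le> j")
    case True
    then show ?thesis using mod_fil_mono Suc.prems by blast
  next
    case False
    obtain u v where uv: "u \<in> L" "v \<in> fil (Suc i)" "y = u \<boxplus> v" "u \<in> carrier M" "v \<in> carrier M"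
      using mod_fil_diff[OF Suc.prems(1) L_stable(2)] by metis
    obtain n l where nl: "n \<in> N\<^sub>0" "l \<in> fil i" "v = xpow i \<bullet> n \<boxplus> l"
      using filE[OF uv(2)] by metis
    define w where "w = u \<boxplus> l"
    have w: "w \<in> msum L (fil i)" "w \<in> carrier M"
      unfolding w_def using uv nl msumI fil_carrier by auto
    have y: "y = xpow i \<bullet> n \<boxplus> w"
      unfolding w_def using uv nl fil_carrier by (simp add: M.a_ac)
    have "t \<bullet> y = xpow i \<bullet> t \<bullet> n \<boxplus> t \<bullet> w"
      using y nl w t by (simp add: smult_r_distr T_xpow)
    moreover have "t \<bullet> y \<in> msum L (fil i)" using Suc.prems(2) mod_fil_mono[of j i] False by auto
    moreover have "t \<bullet> w \<in> msum L (fil i)" by (rule stable_smult[OF mod_fil_T t w(1)])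
    ultimately have "xpow i \<bullet> t \<bullet> n \<in> msum L (fil i)"
      using stable_add_cancel[OF mod_fil_T] nl t by simp
    then have "t \<bullet> n \<in> lead i L"
      unfolding lead_def using stable_smult[OF T_N0 t nl(1)] by simp
    then have "n \<in> lead i L" using sep[of i] nl unfolding separates_def by blast
    then have "y \<in> msum L (fil i)" unfolding y using leadD w(1) stable_add[OF mod_fil_T] by blast
    then show ?thesis by (rule Suc.IH[OF _ Suc.prems(2)])
  qed
qed

lemma span_mod_fil: "y \<in> span \<Longrightarrow> \<exists>i. y \<in> msum L (fil i)"
  using fil_mod_fil by (blast elim: spanE)

lemma msum_fil_0: "msum L (fil 0) = L"
  using L_mod_fil[of 0] stable_carrier[OF L_stable(2)] by (auto elim!: msumE)

lemma injective_pow_mod_fil: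
  "\<lbrakk>y \<in> span; (t [^] (k::nat)) \<bullet> y \<in> msum L (fil j)\<rbrakk> \<Longrightarrow> y \<in> msum L (fil j)"
proof (induction k)
  case 0
  then show ?case using stable_carrier[OF span_stable] by simp
next
  case (Suc k)
  have yc: "y \<in> carrier M" using stable_carrier[OF span_stable Suc.prems(1)] .
  have "(t [^] Suc k) \<bullet> y = t \<bullet> (t [^] k) \<bullet> y"
    using t yc T_commute[OF t, of "t [^] k" y] by (simp add: smult_assoc1)
  moreover have "(t [^] k) \<bullet> y \<in> span" by (rule stable_smult[OF T_span T_pow[OF t] Suc.prems(1)])
  ultimately have "(t [^] k) \<bullet> y \<in> msum L (fil j)"
    using injective_mod_fil span_mod_fil Suc.prems(2) by metis
  then show ?case using Suc by blast
qed

text \<open>Divisibility of \<open>y\<close> modulo \<open>L\<close> passes to its leading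
  coefficient modulo \<open>lead i L\<close>, so some \<open>\<tau>\<close> kills the latter and
  \<open>\<tau> \<bullet> y\<close> falls into \<open>msum L (fil i)\<close>. Its component in
  \<open>fil i\<close> is again divisible, since \<open>T\<close> acts centrally, and is killed by
  some \<open>\<tau>'\<close>; the product \<open>\<tau>' \<otimes> \<tau>\<close> then works for
  \<open>y\<close>.\<close>

lemma torsion_of_divisible:
  "\<lbrakk>y \<in> fil i; \<And>n::nat. \<exists>z\<in>span. y \<boxminus> (t [^] n) \<bullet> z \<in> L\<rbrakk> \<Longrightarrow> \<exists>\<tau>\<in>T. \<tau> \<bullet> y \<in> L"
proof (induction i arbitrary: y)
  case 0
  then show ?case using T_one stable_zero[OF L_stable(2)] by (intro bexI[of _ \<one>]) simp_all
next
  case (Suc i)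
  obtain n l where nl: "n \<in> N\<^sub>0" "l \<in> fil i" "y = xpow i \<bullet> n \<boxplus> l"
    using filE[OF Suc.prems(1)] by metis
  have c [simp]: "n \<in> carrier M" "l \<in> carrier M" "y \<in> carrier M" using nl fil_carrier by auto
  have "\<exists>n'\<in>N\<^sub>0. n \<boxminus> (t [^] k) \<bullet> n' \<in> lead i L" for k :: nat
  proof -
    have tk: "t [^] k \<in> T" "t [^] k \<in> carrier R" using T_pow[OF t] by simp_all
    obtain z where z: "z \<in> span" "y \<boxminus> (t [^] k) \<bullet> z \<in> L" using Suc.prems(2) by blast
    have zc: "z \<in> carrier M" using stable_carrier[OF span_stable z(1)] .
    \<comment> \<open>A priori \<open>z\<close> lies only somewhere in \<open>span\<close>. Modulo
      \<open>L\<close> its multiple by \<open>t [^] k\<close> is \<open>y\<close>, so injectivity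
      bounds the degree of \<open>z\<close> by that of \<open>y\<close>, and the leading terms can
      be compared.\<close>
    have "(t [^] k) \<bullet> z \<in> msum L (fil (Suc i))"
    proof (rule stable_diff_cancel[OF mod_fil_T])
      show "(t [^] k) \<bullet> z \<boxminus> y \<in> msum L (fil (Suc i))"
        using stable_diff_sym[OF L_stable(2) z(2)] tk zc L_mod_fil by auto
      show "y \<in> msum L (fil (Suc i))" using Suc.prems(1) fil_mod_fil by blast
    qed (use tk zc in simp)
    then have "z \<in> msum L (fil (Suc i))" using injective_pow_mod_fil[OF z(1)] by blast
    then obtain u v where uv: "u \<in> L" "v \<in> fil (Suc i)" "z = u \<boxplus> v" "u \<in> carrier M" "v \<in> carrier M"
      using mod_fil_diff[OF _ L_stable(2)] by metis
    obtain n' l' where nl': "n' \<in> N\<^sub>0" "l' \<in> fil i" "v = xpow i \<bullet> n' \<boxplus> l'"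
      using filE[OF uv(2)] by metis
    have c' [simp]: "n' \<in> carrier M" "l' \<in> carrier M" using nl' fil_carrier by auto
    define w where "w = u \<boxplus> l'"
    have w: "w \<in> msum L (fil i)" "w \<in> carrier M" unfolding w_def using uv nl' msumI by auto
    have z': "z = xpow i \<bullet> n' \<boxplus> w" unfolding w_def using uv nl' by (simp add: M.a_ac)
    have "(t [^] k) \<bullet> z = xpow i \<bullet> (t [^] k) \<bullet> n' \<boxplus> (t [^] k) \<bullet> w"
      unfolding z' using w tk by (simp add: smult_r_distr T_xpow)
    then have eq: "y \<boxminus> (t [^] k) \<bullet> z = xpow i \<bullet> (n \<boxminus> (t [^] k) \<bullet> n') \<boxplus> (l \<boxminus> (t [^] k) \<bullet> w)"
      using nl w tk by (simp add: add_diff_add smult_r_diff)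
    have "l \<boxminus> (t [^] k) \<bullet> w \<in> msum L (fil i)"
      using stable_diff[OF mod_fil_T] stable_smult[OF mod_fil_T tk(1) w(1)] nl fil_mod_fil by blast
    moreover have "y \<boxminus> (t [^] k) \<bullet> z \<in> msum L (fil i)" using z L_mod_fil by blast
    ultimately have "xpow i \<bullet> (n \<boxminus> (t [^] k) \<bullet> n') \<in> msum L (fil i)"
      using stable_add_cancel[OF mod_fil_T] tk unfolding eq by simp
    then show ?thesis
      unfolding lead_def using nl nl' stable_diff[OF T_N0] stable_smult[OF T_N0 tk(1)] by blast
  qed
  then obtain \<tau> where tau: "\<tau> \<in> T" "\<tau> \<bullet> n \<in> lead i L"
    using sep[of i] nl(1) unfolding separates_def by blast
  have "\<tau> \<bullet> y = xpow i \<bullet> \<tau> \<bullet> n \<boxplus> \<tau> \<bullet> l"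
    using nl tau by (simp add: smult_r_distr T_xpow)
  moreover have "xpow i \<bullet> \<tau> \<bullet> n \<in> msum L (fil i)" using leadD[OF tau(2)] by blast
  moreover have "\<tau> \<bullet> l \<in> msum L (fil i)" using stable_smult[OF T_fil tau(1) nl(2)] fil_mod_fil by blast
  ultimately have "\<tau> \<bullet> y \<in> msum L (fil i)" using stable_add[OF mod_fil_T] by simp
  then obtain u v where uv: "u \<in> L" "v \<in> fil i" "\<tau> \<bullet> y \<boxminus> u = v" "\<tau> \<bullet> y = u \<boxplus> v" "u \<in> carrier M" "v \<in> carrier M"
    using mod_fil_diff[OF _ L_stable(2)] by metis
  have "\<exists>z\<in>span. v \<boxminus> (t [^] k) \<bullet> z \<in> L" for k :: nat
  proof -
    obtain z where z: "z \<in> span" "y \<boxminus> (t [^] k) \<bullet> z \<in> L" using Suc.prems(2) by blast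
    have zc [simp]: "z \<in> carrier M" using stable_carrier[OF span_stable z(1)] .
    have tk: "t [^] k \<in> carrier R" using T_pow[OF t] by simp
    have "\<tau> \<bullet> (y \<boxminus> (t [^] k) \<bullet> z) = \<tau> \<bullet> y \<boxminus> (t [^] k) \<bullet> \<tau> \<bullet> z"
      using tau tk T_commute[OF tau(1), of "t [^] k" z] by (simp add: smult_r_diff)
    moreover have "v \<boxminus> (t [^] k) \<bullet> \<tau> \<bullet> z = \<tau> \<bullet> y \<boxminus> (t [^] k) \<bullet> \<tau> \<bullet> z \<boxminus> u"
      unfolding uv(3)[symmetric] by (rule diff_right_commute) (use tau tk uv in simp_all)
    ultimately have "v \<boxminus> (t [^] k) \<bullet> \<tau> \<bullet> z \<in> L"
      using stable_diff[OF L_stable(2) stable_smult[OF L_stable(2) tau(1) z(2)] uv(1)] by simp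
    then show ?thesis using stable_smult[OF T_span tau(1) z(1)] by blast
  qed
  then obtain \<tau>' where tau': "\<tau>' \<in> T" "\<tau>' \<bullet> v \<in> L" using Suc.IH[OF uv(2)] by blast
  have "(\<tau>' \<otimes> \<tau>) \<bullet> y = \<tau>' \<bullet> u \<boxplus> \<tau>' \<bullet> v"
    using tau tau' uv by (simp add: smult_assoc1 smult_r_distr)
  also have "\<dots> \<in> L" using stable_add[OF L_stable(2) stable_smult[OF L_stable(2) tau'(1) uv(1)] tau'(2)] .
  finally show ?case using T_mult[OF tau'(1) tau(1)] by blast
qed

theorem separates_step: "separates T t L span"
  unfolding separates_def
proof (intro conjI ballI impI)
  fix y assume "y \<in> span" "t \<bullet> y \<in> L"
  then show "y \<in> L" using injective_mod_fil[of y _ 0] span_mod_fil unfolding msum_fil_0 by blast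
next
  fix y assume "y \<in> span" "\<forall>n::nat. \<exists>z\<in>span. y \<boxminus> (t [^] n) \<bullet> z \<in> L"
  then show "\<exists>\<tau>\<in>T. \<tau> \<bullet> y \<in> L" using torsion_of_divisible by (blast elim: spanE)
qed

end

text \<open>The sets \<open>lead i L\<close> increase with \<open>i\<close> and are constant from
  some \<open>m\<close> on, so a value that is bad for \<open>L\<close> is bad for one of finitely
  many \<open>lead i L\<close>.\<close>

theorem finite_bad_step:
  assumes "acc_family (stable_within W N\<^sub>0)" and "T \<subseteq> W"
    and "\<And>L. \<lbrakk>stable M W L; L \<subseteq> N\<^sub>0\<rbrakk> \<Longrightarrow> finite {k \<in> \<Lambda>. f k \<in> T \<and> \<not> separates T (f k) L N\<^sub>0}"
    and "stable M (insert x W) L"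
  shows "finite {k \<in> \<Lambda>. f k \<in> T \<and> \<not> separates T (f k) L span}"
proof -
  obtain m where m: "\<And>i. i \<ge> m \<Longrightarrow> lead i L = lead m L"
    using lead_stabilises[OF assms(1,4)] by blast
  have L: "stable M W L" using assms(4) by (simp add: stable_insert)
  have T: "stable M T L" using stable_mono[OF L assms(2)] .
  have "{k \<in> \<Lambda>. f k \<in> T \<and> \<not> separates T (f k) L span}
      \<subseteq> (\<Union>i\<in>{..m}. {k \<in> \<Lambda>. f k \<in> T \<and> \<not> separates T (f k) (lead i L) N\<^sub>0})"
  proof (rule subsetI, rule ccontr)
    fix k assume k: "k \<in> {k \<in> \<Lambda>. f k \<in> T \<and> \<not> separates T (f k) L span}"
      and "k \<notin> (\<Union>i\<in>{..m}. {k \<in> \<Lambda>. f k \<in> T \<and> \<not> separates T (f k) (lead i L) N\<^sub>0})"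
    then have "separates T (f k) (lead i L) N\<^sub>0" for i
      using m[of i] by (cases "i \<le> m") auto
    then show False using separates_step[OF assms(4) T, of "f k"] k by blast
  qed
  moreover have "finite {k \<in> \<Lambda>. f k \<in> T \<and> \<not> separates T (f k) (lead i L) N\<^sub>0}" for i
    using assms(3)[OF lead_stable[OF L] lead_subset] .
  ultimately show ?thesis by (meson finite_UN finite_atMost finite_subset)
qed

end

section \<open>Essential extensions of a simple module\<close>

text \<open>Its submodules are the left ideals. The module record extends the ring record, so a
  product and a unit have to be supplied too.\<close>

definition regular_module :: "('a, 'b) ring_scheme \<Rightarrow> ('a, 'a) module"
  where "regular_module A = \<lparr>carrier = carrier A, monoid.mult = monoid.mult A, monoid.one = monoid.one A,
    ring.zero = ring.zero A, ring.add = ring.add A, smult = monoid.mult A\<rparr>"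

lemma regular_module_simps [simp]:
  "carrier (regular_module A) = carrier A" "ring.zero (regular_module A) = ring.zero A"
  "ring.add (regular_module A) = ring.add A" "smult (regular_module A) = monoid.mult A"
  unfolding regular_module_def by simp_all

lemma regular_module_uminus [simp]: "a_inv (regular_module A) x = a_inv A x"
  by (simp add: a_inv_def m_inv_def regular_module_def)

lemma (in ring) regular_left_module: "left_module R (regular_module R)"
proof -
  have "abelian_group (regular_module R)"
    by (rule abelian_groupI) (auto simp: a_ac intro: bexI[of _ "\<ominus> _"] l_neg)
  then show ?thesis
    by (intro left_module.intro left_module_axioms.intro)
       (auto simp: l_distr r_distr m_assoc intro: ring_axioms)
qed

context left_module
begin

definition cyclic :: "'m \<Rightarrow> 'm set"
  where "cyclic m = {a \<bullet> m |a. a \<in> carrier R}"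

lemma cyclic_stable: "m \<in> carrier M \<Longrightarrow> stable M (carrier R) (cyclic m)"
proof (rule stableI_diff)
  assume m: "m \<in> carrier M"
  show "\<zero>\<zero> \<in> cyclic m" unfolding cyclic_def using m by (auto intro!: exI[of _ \<zero>])
  show "u \<boxminus> v \<in> cyclic m" if "u \<in> cyclic m" "v \<in> cyclic m" for u v
    using that m unfolding cyclic_def by (auto simp: smult_l_diff[symmetric])
  show "b \<bullet> u \<in> cyclic m" if "b \<in> carrier R" "u \<in> cyclic m" for b u
    using that m unfolding cyclic_def by (auto simp: smult_assoc1[symmetric])
qed (auto simp: cyclic_def)

lemma cyclic_self: "m \<in> carrier M \<Longrightarrow> m \<in> cyclic m"
  unfolding cyclic_def by (auto intro!: exI[of _ \<one>])

lemma cyclic_least: "\<lbrakk>stable M (carrier R) N; m \<in> N\<rbrakk> \<Longrightarrow> cyclic m \<subseteq> N"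
  unfolding cyclic_def using stable_smult by fastforce

text \<open>Commutation is required only for the action on \<open>N\<close>, not in the ring. This
  suffices for the kernel and the image of \<open>z\<close> on \<open>N\<close> to be
  submodules.\<close>

definition central_on :: "'a \<Rightarrow> 'm set \<Rightarrow> bool"
  where "central_on z N \<longleftrightarrow> z \<in> carrier R \<and> (\<forall>a\<in>carrier R. \<forall>n\<in>N. z \<bullet> a \<bullet> n = a \<bullet> z \<bullet> n)"

definition annihilator :: "'m set \<Rightarrow> 'a set"
  where "annihilator N = {a \<in> carrier R. \<forall>n\<in>N. a \<bullet> n = \<zero>\<zero>}"

lemma stable_kernel:
  assumes "stable M (carrier R) N" "central_on z N"
  shows "stable M (carrier R) {n \<in> N. z \<bullet> n = \<zero>\<zero>}"
proof (rule stableI_diff)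
  note c = stable_carrier[OF assms(1)]
  have z: "z \<in> carrier R" using assms(2) unfolding central_on_def by simp
  show "{n \<in> N. z \<bullet> n = \<zero>\<zero>} \<subseteq> carrier M" using c by auto
  show "\<zero>\<zero> \<in> {n \<in> N. z \<bullet> n = \<zero>\<zero>}" using z stable_zero[OF assms(1)] by simp
  show "u \<boxminus> v \<in> {n \<in> N. z \<bullet> n = \<zero>\<zero>}" if "u \<in> {n \<in> N. z \<bullet> n = \<zero>\<zero>}" "v \<in> {n \<in> N. z \<bullet> n = \<zero>\<zero>}" for u v
    using that c z stable_diff[OF assms(1)] by (simp add: smult_r_diff diff_eq_zero_iff)
  show "a \<bullet> u \<in> {n \<in> N. z \<bullet> n = \<zero>\<zero>}" if "a \<in> carrier R" "u \<in> {n \<in> N. z \<bullet> n = \<zero>\<zero>}" for a u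
    using that assms(2) stable_smult[OF assms(1)] unfolding central_on_def by simp
qed

lemma stable_image:
  assumes "stable M (carrier R) N" "central_on z N"
  shows "stable M (carrier R) ((\<lambda>n. z \<bullet> n) ` N)"
proof (rule stableI_diff)
  note c = stable_carrier[OF assms(1)]
  have z: "z \<in> carrier R" using assms(2) unfolding central_on_def by simp
  show "(\<lambda>n. z \<bullet> n) ` N \<subseteq> carrier M" using c z by auto
  show "\<zero>\<zero> \<in> (\<lambda>n. z \<bullet> n) ` N" using z stable_zero[OF assms(1)] by (intro image_eqI[of _ _ "\<zero>\<zero>"]) simp_all
  show "u \<boxminus> v \<in> (\<lambda>n. z \<bullet> n) ` N" if uv: "u \<in> (\<lambda>n. z \<bullet> n) ` N" "v \<in> (\<lambda>n. z \<bullet> n) ` N" for u v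
  proof -
    obtain m n where "m \<in> N" "n \<in> N" "u = z \<bullet> m" "v = z \<bullet> n" using uv by blast
    then show ?thesis using c z stable_diff[OF assms(1)] by (intro image_eqI[of _ _ "m \<boxminus> n"]) (simp_all add: smult_r_diff)
  qed
  show "a \<bullet> u \<in> (\<lambda>n. z \<bullet> n) ` N" if "a \<in> carrier R" "u \<in> (\<lambda>n. z \<bullet> n) ` N" for a u
  proof -
    obtain m where m: "m \<in> N" "u = z \<bullet> m" using \<open>u \<in> (\<lambda>n. z \<bullet> n) ` N\<close> by blast
    then have "a \<bullet> u = z \<bullet> a \<bullet> m" using that(1) assms(2) unfolding central_on_def by simp
    then show ?thesis using stable_smult[OF assms(1) that(1) m(1)] by blast
  qed
qed

lemma central_on_subset: "\<lbrakk>central_on z N; N' \<subseteq> N\<rbrakk> \<Longrightarrow> central_on z N'"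
  unfolding central_on_def by blast

lemma central_on_pow:
  assumes "stable M (carrier R) N" "central_on z N"
  shows "central_on (z [^] (k::nat)) N"
proof (induction k)
  case 0
  then show ?case using stable_smult[OF assms(1)] stable_carrier[OF assms(1)] by (simp add: central_on_def)
next
  case (Suc k)
  have c: "z \<in> carrier R" "z [^] k \<in> carrier R" using assms(2) by (simp_all add: central_on_def)
  show ?case unfolding central_on_def
  proof (intro conjI ballI)
    fix a n assume an: "a \<in> carrier R" "n \<in> N"
    have zn: "z \<bullet> n \<in> N" by (rule stable_smult[OF assms(1) c(1) an(2)])
    have nc: "n \<in> carrier M" using stable_carrier[OF assms(1) an(2)] .
    have "(z [^] Suc k) \<bullet> a \<bullet> n = (z [^] k) \<bullet> z \<bullet> a \<bullet> n"
      using an c nc by (simp add: smult_assoc1)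
    also have "\<dots> = (z [^] k) \<bullet> a \<bullet> z \<bullet> n" using assms(2) an unfolding central_on_def by simp
    also have "\<dots> = a \<bullet> (z [^] k) \<bullet> z \<bullet> n" using Suc an(1) zn unfolding central_on_def by blast
    also have "\<dots> = a \<bullet> (z [^] Suc k) \<bullet> n" using c nc by (simp add: smult_assoc1)
    finally show "(z [^] Suc k) \<bullet> a \<bullet> n = a \<bullet> (z [^] Suc k) \<bullet> n" .
  qed (use c in simp)
qed

text \<open>This is \<open>N / ker z \<cong> z N\<close> without quotients: elements of a chain with
  equal images under \<open>z\<close> differ by an element of the kernel.\<close>

lemma dcc_kernel_image:
  assumes "stable M (carrier R) N" "central_on z N"
    and "dcc_family (stable_within (carrier R) {n \<in> N. z \<bullet> n = \<zero>\<zero>})"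
    and "dcc_family (stable_within (carrier R) ((\<lambda>n. z \<bullet> n) ` N))"
  shows "dcc_family (stable_within (carrier R) N)"
  unfolding dcc_family_def
proof (intro allI impI)
  fix L :: "nat \<Rightarrow> 'm set" assume L: "\<forall>i. L i \<in> stable_within (carrier R) N \<and> L (Suc i) \<subseteq> L i"
  have z: "z \<in> carrier R" using assms(2) unfolding central_on_def by simp
  have Li: "stable M (carrier R) (L i)" "L i \<subseteq> N" for i using L by simp_all
  obtain k where k: "\<And>i. i \<ge> k \<Longrightarrow> L i \<inter> {n \<in> N. z \<bullet> n = \<zero>\<zero>} = L k \<inter> {n \<in> N. z \<bullet> n = \<zero>\<zero>}"
  proof (rule dcc_familyD[OF assms(3), of "\<lambda>i. L i \<inter> {n \<in> N. z \<bullet> n = \<zero>\<zero>}"])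
    show "L i \<inter> {n \<in> N. z \<bullet> n = \<zero>\<zero>} \<in> stable_within (carrier R) {n \<in> N. z \<bullet> n = \<zero>\<zero>}" for i
      using stable_Int[OF Li(1) stable_kernel[OF assms(1,2)]] by simp
    show "L (Suc i) \<inter> {n \<in> N. z \<bullet> n = \<zero>\<zero>} \<subseteq> L i \<inter> {n \<in> N. z \<bullet> n = \<zero>\<zero>}" for i using L by blast
  qed blast
  obtain l where l: "\<And>i. i \<ge> l \<Longrightarrow> (\<lambda>n. z \<bullet> n) ` L i = (\<lambda>n. z \<bullet> n) ` L l"
  proof (rule dcc_familyD[OF assms(4), of "\<lambda>i. (\<lambda>n. z \<bullet> n) ` L i"])
    show "(\<lambda>n. z \<bullet> n) ` L i \<in> stable_within (carrier R) ((\<lambda>n. z \<bullet> n) ` N)" for i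
      using stable_image[OF Li(1) central_on_subset[OF assms(2) Li(2)]] image_mono[OF Li(2)] by simp
    show "(\<lambda>n. z \<bullet> n) ` L (Suc i) \<subseteq> (\<lambda>n. z \<bullet> n) ` L i" for i using L by blast
  qed blast
  have "L i = L (max k l)" if "i \<ge> max k l" for i
  proof
    show sub: "L i \<subseteq> L (max k l)" using L chain_antimono[of L "max k l" i] that by simp
    show "L (max k l) \<subseteq> L i"
    proof
      fix y assume y: "y \<in> L (max k l)"
      then have "z \<bullet> y \<in> (\<lambda>n. z \<bullet> n) ` L i" using l[of i] l[of "max k l"] that by auto
      then obtain y' where y': "y' \<in> L i" "z \<bullet> y = z \<bullet> y'" by blast
      have c: "y \<in> carrier M" "y' \<in> carrier M" using y y' stable_carrier[OF Li(1)] by auto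
      have "y \<boxminus> y' \<in> L (max k l)" using stable_diff[OF Li(1) y] y' sub by blast
      moreover have "z \<bullet> (y \<boxminus> y') = \<zero>\<zero>" using y' c z by (simp add: smult_r_diff diff_eq_zero_iff)
      ultimately have "y \<boxminus> y' \<in> L (max k l) \<inter> {n \<in> N. z \<bullet> n = \<zero>\<zero>}" using Li(2) by blast
      then have "y \<boxminus> y' \<in> L i" using k[of i] k[of "max k l"] that by auto
      then show "y \<in> L i" using stable_diff_cancel[OF Li(1) _ y'(1)] c by blast
    qed
  qed
  then show "\<exists>k. \<forall>i\<ge>k. L i = L k" by blast
qed

lemma dcc_zero: "dcc_family (stable_within W {\<zero>\<zero>})"
proof -
  have "U = {\<zero>\<zero>}" if "U \<in> stable_within W {\<zero>\<zero>}" for U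
    using that stable_zero by blast
  then show ?thesis unfolding dcc_family_def by blast
qed

text \<open>On the image of \<open>z\<close> the exponent is smaller by one, and the kernel of
  \<open>z\<close> there is part of its kernel on \<open>N\<close>; so induction covers the image
  and the assumption covers the kernel.\<close>

lemma dcc_nilpotent:
  assumes "stable M (carrier R) N" "central_on z N" "\<And>n. n \<in> N \<Longrightarrow> (z [^] (k::nat)) \<bullet> n = \<zero>\<zero>"
    and "dcc_family (stable_within (carrier R) {n \<in> N. z \<bullet> n = \<zero>\<zero>})"
  shows "dcc_family (stable_within (carrier R) N)"
  using assms
proof (induction k arbitrary: N)
  case 0
  have "n = \<zero>\<zero>" if "n \<in> N" for n
    using 0(3)[OF that] stable_carrier[OF 0(1) that] by simp
  then have "N = {\<zero>\<zero>}" using stable_zero[OF 0(1)] by blast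
  then show ?case by (simp add: dcc_zero)
next
  case (Suc k)
  have z: "z \<in> carrier R" using Suc.prems(2) unfolding central_on_def by simp
  have sub: "(\<lambda>n. z \<bullet> n) ` N \<subseteq> N" using stable_smult[OF Suc.prems(1) z] by blast
  show ?case
  proof (rule dcc_kernel_image[OF Suc.prems(1,2,4)], rule Suc.IH)
    show "stable M (carrier R) ((\<lambda>n. z \<bullet> n) ` N)" by (rule stable_image[OF Suc.prems(1,2)])
    show "central_on z ((\<lambda>n. z \<bullet> n) ` N)" by (rule central_on_subset[OF Suc.prems(2) sub])
    show "dcc_family (stable_within (carrier R) {n \<in> (\<lambda>n. z \<bullet> n) ` N. z \<bullet> n = \<zero>\<zero>})"
      by (rule dcc_family_subset[OF Suc.prems(4)]) (use sub in blast)
    fix n assume "n \<in> (\<lambda>n. z \<bullet> n) ` N"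
    then obtain m where m: "m \<in> N" "n = z \<bullet> m" by blast
    then show "(z [^] k) \<bullet> n = \<zero>\<zero>"
      using Suc.prems(3)[OF m(1)] stable_carrier[OF Suc.prems(1)] z by (simp add: smult_assoc1)
  qed
qed

end

text \<open>Reduces stability under a generated ring to stability under its generators. The next
  lemma does the same for commutation.\<close>

lemma (in left_module) subring_stabiliser:
  assumes "stable M {} N"
  shows "subring {a \<in> carrier R. \<forall>n\<in>N. a \<bullet> n \<in> N} R"
proof (rule R.subringI)
  note c [simp] = stable_carrier[OF assms]
  note s = stable_add[OF assms] stable_minus[OF assms]
  show "\<ominus> h \<in> {a \<in> carrier R. \<forall>n\<in>N. a \<bullet> n \<in> N}" if "h \<in> {a \<in> carrier R. \<forall>n\<in>N. a \<bullet> n \<in> N}" for h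
    using that s by (simp add: smult_l_minus)
  show "h1 \<otimes> h2 \<in> {a \<in> carrier R. \<forall>n\<in>N. a \<bullet> n \<in> N}"
    if "h1 \<in> {a \<in> carrier R. \<forall>n\<in>N. a \<bullet> n \<in> N}" "h2 \<in> {a \<in> carrier R. \<forall>n\<in>N. a \<bullet> n \<in> N}" for h1 h2
    using that by (simp add: smult_assoc1)
  show "h1 \<oplus> h2 \<in> {a \<in> carrier R. \<forall>n\<in>N. a \<bullet> n \<in> N}"
    if "h1 \<in> {a \<in> carrier R. \<forall>n\<in>N. a \<bullet> n \<in> N}" "h2 \<in> {a \<in> carrier R. \<forall>n\<in>N. a \<bullet> n \<in> N}" for h1 h2
    using that s by (simp add: smult_l_distr)
qed (use stable_carrier[OF assms] in auto)

lemma (in left_module) commutant_subring: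
  assumes "stable M (carrier R) N" "b \<in> carrier R"
  shows "subring {a \<in> carrier R. \<forall>m\<in>N. b \<bullet> a \<bullet> m = a \<bullet> b \<bullet> m} R"
proof (rule R.subringI)
  let ?C = "{a \<in> carrier R. \<forall>m\<in>N. b \<bullet> a \<bullet> m = a \<bullet> b \<bullet> m}"
  note c [simp] = stable_carrier[OF assms(1)]
  note st = stable_smult[OF assms(1)]
  note assms(2) [simp]
  show "\<ominus> h \<in> ?C" if "h \<in> ?C" for h using that by (simp add: smult_l_minus smult_r_minus)
  show "h1 \<otimes> h2 \<in> ?C" if "h1 \<in> ?C" "h2 \<in> ?C" for h1 h2
    using that st by (simp add: smult_assoc1)
  show "h1 \<oplus> h2 \<in> ?C" if "h1 \<in> ?C" "h2 \<in> ?C" for h1 h2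
    using that by (simp add: smult_l_distr smult_r_distr)
qed (use stable_carrier[OF assms(1)] assms(2) in auto)

section \<open>Fitting's argument over an essential simple submodule\<close>

locale essential_simple = left_module R M
  for R :: "('a, 'b) ring_scheme" (structure) and M :: "('a, 'm, 'c) module_scheme" (structure) +
  fixes S :: "'m set"
  assumes S_stable: "stable M (carrier R) S" and S_nonzero: "S \<noteq> {\<zero>\<zero>}"
    and S_simple: "\<lbrakk>stable M (carrier R) L; L \<subseteq> S\<rbrakk> \<Longrightarrow> L = {\<zero>\<zero>} \<or> L = S"
    and S_essential: "\<lbrakk>stable M (carrier R) L; L \<inter> S = {\<zero>\<zero>}\<rbrakk> \<Longrightarrow> L = {\<zero>\<zero>}"
begin

text \<open>A nonzero submodule meets \<open>S\<close> nontrivially, and by simplicity the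
  intersection is all of \<open>S\<close>. Essentiality is always used in this form.\<close>

lemma S_least: "\<lbrakk>stable M (carrier R) L; L \<noteq> {\<zero>\<zero>}\<rbrakk> \<Longrightarrow> S \<subseteq> L"
  using S_essential[of L] S_simple[OF stable_Int[OF _ S_stable], of L] by blast

lemma S_elem: obtains s where "s \<in> S" "s \<noteq> \<zero>\<zero>" "s \<in> carrier M"
  using S_nonzero stable_zero[OF S_stable] stable_carrier[OF S_stable] by blast

text \<open>Let the kernels of the powers of \<open>z\<close> be constant from \<open>k\<close> on.
  If \<open>z [^] k\<close> had a nonzero image, that image would contain \<open>S\<close>; a
  nonzero \<open>s = (z [^] k) \<bullet> n\<close> in \<open>S\<close> is killed by
  \<open>z\<close>, so \<open>n\<close> lies in the next kernel, hence in the \<open>k\<close>-th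
  one, and \<open>s\<close> vanishes.\<close>

lemma fitting:
  assumes "stable M (carrier R) N" "central_on z N" "acc_family (stable_within (carrier R) N)"
    and "z \<in> annihilator S"
  shows "\<exists>k::nat. \<forall>n\<in>N. (z [^] k) \<bullet> n = \<zero>\<zero>"
proof -
  have z: "z \<in> carrier R" using assms(2) unfolding central_on_def by simp
  note cz = central_on_pow[OF assms(1,2)]
  note c = stable_carrier[OF assms(1)]
  define Ker where "Ker = (\<lambda>k::nat. {n \<in> N. (z [^] k) \<bullet> n = \<zero>\<zero>})"
  have step: "(z [^] Suc k) \<bullet> n = z \<bullet> (z [^] k) \<bullet> n" if "n \<in> N" for k n
  proof -
    have "(z [^] Suc k) \<bullet> n = (z [^] k) \<bullet> z \<bullet> n" using z c[OF that] by (simp add: smult_assoc1)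
    also have "\<dots> = z \<bullet> (z [^] k) \<bullet> n" using cz[of k] z that unfolding central_on_def by simp
    finally show ?thesis .
  qed
  obtain k where k: "\<And>i. i \<ge> k \<Longrightarrow> Ker i = Ker k"
  proof (rule acc_familyD[OF assms(3), of Ker])
    show "Ker i \<in> stable_within (carrier R) N" for i
      unfolding Ker_def using stable_kernel[OF assms(1) cz] by auto
    show "Ker i \<subseteq> Ker (Suc i)" for i unfolding Ker_def using step z by (auto simp del: R.nat_pow_Suc)
  qed blast
  have "(\<lambda>n. (z [^] k) \<bullet> n) ` N = {\<zero>\<zero>}"
  proof (rule ccontr)
    assume "(\<lambda>n. (z [^] k) \<bullet> n) ` N \<noteq> {\<zero>\<zero>}"
    then have sub: "S \<subseteq> (\<lambda>n. (z [^] k) \<bullet> n) ` N" by (rule S_least[OF stable_image[OF assms(1) cz]])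
    obtain s where s: "s \<in> S" "s \<noteq> \<zero>\<zero>" using S_elem by blast
    then obtain n where n: "n \<in> N" "s = (z [^] k) \<bullet> n" using sub by blast
    have "z \<bullet> s = \<zero>\<zero>" using assms(4) s unfolding annihilator_def by blast
    then have "n \<in> Ker (Suc k)" unfolding Ker_def using step[OF n(1)] n by simp
    then have "s = \<zero>\<zero>" using k[of "Suc k"] n(2) unfolding Ker_def by auto
    then show False using s by simp
  qed
  then show ?thesis by blast
qed

lemma annihilator_left_ideal:
  assumes "N \<subseteq> carrier M"
  shows "stable (regular_module R) (carrier R) (annihilator N)"
proof -
  interpret reg: left_module R "regular_module R" by (rule R.regular_left_module)
  show ?thesis
    by (rule reg.stableI)
       (use assms in \<open>auto simp: annihilator_def smult_l_distr smult_assoc1 subset_iff smult_l_minus\<close>)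
qed

text \<open>Replacing \<open>N'\<close> by the kernel of a \<open>z\<close> that kills
  \<open>S\<close> but not \<open>N'\<close> strictly enlarges the annihilator, because
  \<open>z\<close> enters it; the chain condition on left ideals stops this.\<close>

theorem reduction:
  assumes "acc_family {J. stable (regular_module R) (carrier R) J}"
    and "stable M (carrier R) N" "S \<subseteq> N" "acc_family (stable_within (carrier R) N)"
    and base: "\<And>N'. \<lbrakk>stable M (carrier R) N'; S \<subseteq> N'; N' \<subseteq> N;
        \<And>z. \<lbrakk>central_on z N'; z \<in> annihilator S\<rbrakk> \<Longrightarrow> z \<in> annihilator N'\<rbrakk>
        \<Longrightarrow> dcc_family (stable_within (carrier R) N')"
  shows "dcc_family (stable_within (carrier R) N)"
proof -
  have "N' \<subseteq> N \<Longrightarrow> stable M (carrier R) N' \<Longrightarrow> S \<subseteq> N' \<Longrightarrow> dcc_family (stable_within (carrier R) N')" for N'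
  proof (induction N' rule: wf_induct_rule[OF wf_inv_image[OF acc_family_wf[OF assms(1)], of annihilator]])
    case (1 N')
    show ?case
    proof (cases "\<forall>z. central_on z N' \<and> z \<in> annihilator S \<longrightarrow> z \<in> annihilator N'")
      case True
      then show ?thesis using base 1 by blast
    next
      case False
      then obtain z where z: "central_on z N'" "z \<in> annihilator S" "z \<notin> annihilator N'" by blast
      have zR: "z \<in> carrier R" using z unfolding central_on_def by simp
      define N'' where "N'' = {n \<in> N'. z \<bullet> n = \<zero>\<zero>}"
      have N'': "stable M (carrier R) N''" "N'' \<subseteq> N'" "S \<subseteq> N''"
        unfolding N''_def using stable_kernel[OF 1(3) z(1)] 1(4) z(2) by (auto simp: annihilator_def)
      have "annihilator N' \<subset> annihilator N''"
        using N''(2) z(3) zR unfolding annihilator_def N''_def by blast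
      then have "dcc_family (stable_within (carrier R) N'')"
        using 1 N'' annihilator_left_ideal[OF stable_subset] by (intro 1) auto
      moreover have "acc_family (stable_within (carrier R) N')"
        by (rule acc_family_subset[OF assms(4)]) (use 1(2) in blast)
      then obtain k :: nat where "\<forall>n\<in>N'. (z [^] k) \<bullet> n = \<zero>\<zero>"
        using fitting[OF 1(3) z(1) _ z(2)] by blast
      ultimately show ?thesis using dcc_nilpotent[OF 1(3) z(1), of k] unfolding N''_def by blast
    qed
  qed
  then show ?thesis using assms by blast
qed

end

section \<open>Finitely generated differential operator rings\<close>

text \<open>Horner's scheme. Coefficient lists start with the highest degree, so appending
  \<open>b\<close> means multiplying by the variable and adding \<open>b\<close>, which explains the
  reverse induction. The element \<open>c\<close> lies in a noncommutative ring and only commutes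
  with \<open>H\<close>.\<close>

lemma (in ring) synthetic_division:
  assumes "subcring H R" "set p \<subseteq> H" "c \<in> carrier R" "\<mu> \<in> H" "p \<noteq> []"
    and "\<And>h. h \<in> H \<Longrightarrow> h \<otimes> c = c \<otimes> h"
  shows "\<exists>q. set q \<subseteq> H \<and> length p = Suc (length q) \<and> (q \<noteq> [] \<longrightarrow> hd q = hd p) \<and>
    eval p c = (c \<ominus> \<mu>) \<otimes> eval q c \<oplus> eval p \<mu>"
  using assms(2,5)
proof (induction p rule: rev_induct)
  case Nil
  then show ?case by simp
next
  case (snoc b p)
  note H = subcring.axioms(1)[OF assms(1)]
  have HR: "H \<subseteq> carrier R" by (rule subringE(1)[OF H])
  have [simp]: "\<mu> \<in> carrier R" "b \<in> carrier R" "c \<in> carrier R" and bH: "b \<in> H" and pH: "set p \<subseteq> H"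
    using snoc.prems assms HR by auto
  have pR: "set p \<subseteq> carrier R" using pH HR by blast
  have ep [simp]: "eval p \<mu> \<in> carrier R" using eval_in_carrier[OF pR] by simp
  have evH: "set l \<subseteq> H \<Longrightarrow> eval l \<mu> \<in> H" for l
  proof (induction l rule: rev_induct)
    case (snoc a l)
    then have "set l \<subseteq> carrier R" "a \<in> carrier R" using HR by auto
    then show ?case using snoc assms(4) subringE(6,7)[OF H] HR by (simp add: eval_append_aux subsetD)
  qed (use subringE(2)[OF H] in simp)
  show ?case
  proof (cases "p = []")
    case True
    then show ?thesis using bH by (intro exI[of _ "[]"]) simp
  next
    case False
    then obtain q where q: "set q \<subseteq> H" "length p = Suc (length q)" "q \<noteq> [] \<longrightarrow> hd q = hd p"
      "eval p c = (c \<ominus> \<mu>) \<otimes> eval q c \<oplus> eval p \<mu>" using snoc.IH[OF pH] by blast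
    have qR: "set q \<subseteq> carrier R" using q HR by blast
    have [simp]: "eval q c \<in> carrier R" using eval_in_carrier[OF qR] by simp
    have comm: "eval p \<mu> \<otimes> c = c \<otimes> eval p \<mu>" "eval p \<mu> \<otimes> \<mu> = \<mu> \<otimes> eval p \<mu>"
      using assms(6) evH[OF pH] subcring.sub_m_comm[OF assms(1)] assms(4) by auto
    have "eval (p @ [b]) c = ((c \<ominus> \<mu>) \<otimes> eval q c \<oplus> eval p \<mu>) \<otimes> c \<oplus> b"
      using eval_append_aux[OF pR] q(4) by simp
    also have "\<dots> = (c \<ominus> \<mu>) \<otimes> (eval q c \<otimes> c \<oplus> eval p \<mu>) \<oplus> (eval p \<mu> \<otimes> \<mu> \<oplus> b)"
      by (simp add: comm minus_eq l_distr r_distr l_minus r_minus m_assoc a_assoc r_neg1)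
    also have "\<dots> = (c \<ominus> \<mu>) \<otimes> eval (q @ [eval p \<mu>]) c \<oplus> eval (p @ [b]) \<mu>"
      using eval_append_aux[OF qR] eval_append_aux[OF pR] by simp
    finally have eq: "eval (p @ [b]) c = (c \<ominus> \<mu>) \<otimes> eval (q @ [eval p \<mu>]) c \<oplus> eval (p @ [b]) \<mu>" .
    have "hd (q @ [eval p \<mu>]) = hd (p @ [b])"
    proof (cases "q = []")
      case True
      then obtain e where "p = [e]" using q(2) by (metis length_0_conv length_Suc_conv)
      then show ?thesis using True pR by simp
    next
      case False
      then show ?thesis using q(3) \<open>p \<noteq> []\<close> by simp
    qed
    then show ?thesis using eq q evH[OF pH] by (intro exI[of _ "q @ [eval p \<mu>]"]) simp
  qed
qed

text \<open>Roots are split off one at a time; the quotient keeps the leading coefficient, so it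
  stays monic. What is factored is the value at \<open>c\<close>, which is the operator that will
  act.\<close>

lemma (in ring) monic_factorisation:
  assumes "subcring H R" "c \<in> carrier R" and comm: "\<And>h. h \<in> H \<Longrightarrow> h \<otimes> c = c \<otimes> h"
    and "\<And>p. \<lbrakk>set p \<subseteq> H; length p \<ge> 2; hd p = \<one>\<rbrakk> \<Longrightarrow> \<exists>\<mu>\<in>H. eval p \<mu> = \<zero>"
    and "set p \<subseteq> H" "p \<noteq> []" "hd p = \<one>"
  shows "\<exists>ms. set ms \<subseteq> H \<and> eval p c = foldr (\<lambda>\<mu> a. (c \<ominus> \<mu>) \<otimes> a) ms \<one>"
  using assms(5-7)
proof (induction "length p" arbitrary: p)
  case 0
  then show ?case by simp
next
  case (Suc n)
  have HR: "H \<subseteq> carrier R" using subringE(1)[OF subcring.axioms(1)[OF assms(1)]] .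
  show ?case
  proof (cases "n = 0")
    case True
    then have "p = [\<one>]" using Suc by (cases p) auto
    then show ?thesis using assms(2) by (intro exI[of _ "[]"]) simp
  next
    case False
    then have "length p \<ge> 2" using Suc by linarith
    then obtain \<mu> where mu: "\<mu> \<in> H" "eval p \<mu> = \<zero>" using assms(4) Suc.prems by blast
    obtain q where q: "set q \<subseteq> H" "length p = Suc (length q)" "q \<noteq> [] \<longrightarrow> hd q = hd p"
      "eval p c = (c \<ominus> \<mu>) \<otimes> eval q c \<oplus> eval p \<mu>"
      using synthetic_division[OF assms(1) Suc.prems(1) assms(2) mu(1) Suc.prems(2) comm] by blast
    have "q \<noteq> []" "n = length q" using q(2) Suc(2) False by auto
    then obtain ms where ms: "set ms \<subseteq> H" "eval q c = foldr (\<lambda>\<mu> a. (c \<ominus> \<mu>) \<otimes> a) ms \<one>"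
      using Suc.hyps(1)[of q] q Suc.prems by auto
    have qc: "eval q c \<in> carrier R" using q(1) HR eval_in_carrier assms(2) by blast
    then have "eval p c = foldr (\<lambda>\<mu> a. (c \<ominus> \<mu>) \<otimes> a) (\<mu> # ms) \<one>"
      using q(4) mu ms assms(2) HR by (simp add: subsetD)
    then show ?thesis using mu(1) ms(1) by (intro exI[of _ "\<mu> # ms"]) simp
  qed
qed

text \<open>\<open>F\<close> and \<open>B\<close> are the images of the field and of the algebra
  inside \<open>A\<close>, and the derivation becomes the commutator with \<open>\<theta>\<close>,
  so only one ring structure occurs. Algebraic closedness appears as the existence of roots of monic
  coefficient lists.\<close>

locale fg_diff_ring = A?: ring A for A :: "('a, 'x) ring_scheme" (structure) +
  fixes F B G :: "'a set" and \<theta> :: 'a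
  assumes F_subfield: "subfield F A" and B_subcring: "subcring B A"
    and F_B: "F \<subseteq> B" and G_B: "G \<subseteq> B" and G_finite: "finite G"
    and B_generated: "\<lbrakk>subring C A; F \<union> G \<subseteq> C\<rbrakk> \<Longrightarrow> B \<subseteq> C"
    and theta_closed [simp]: "\<theta> \<in> carrier A"
    and A_generated: "\<lbrakk>subring C A; insert \<theta> B \<subseteq> C\<rbrakk> \<Longrightarrow> carrier A \<subseteq> C"
    and F_theta: "k \<in> F \<Longrightarrow> \<theta> \<otimes> k = k \<otimes> \<theta>"
    and commutator_closed: "b \<in> B \<Longrightarrow> \<theta> \<otimes> b \<ominus> b \<otimes> \<theta> \<in> B"
    and commutator_nilpotent: "b \<in> B \<Longrightarrow> \<exists>n. ((\<lambda>b. \<theta> \<otimes> b \<ominus> b \<otimes> \<theta>) ^^ n) b = \<zero>"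
    and F_roots: "\<lbrakk>set p \<subseteq> F; length p \<ge> 2; hd p = \<one>\<rbrakk> \<Longrightarrow> \<exists>\<mu>\<in>F. eval p \<mu> = \<zero>"
    and F_char_zero: "n > 0 \<Longrightarrow> add_pow A (n::nat) \<one> \<noteq> \<zero>"
begin

definition \<delta> :: "'a \<Rightarrow> 'a" where "\<delta> b = \<theta> \<otimes> b \<ominus> b \<otimes> \<theta>"

lemma B_subring: "subring B A"
  using B_subcring by (rule subcring.axioms)

lemma B_comm: "\<lbrakk>a \<in> B; b \<in> B\<rbrakk> \<Longrightarrow> a \<otimes> b = b \<otimes> a"
  using subcring.sub_m_comm[OF B_subcring] .

lemma F_subring: "subring F A"
  using subfieldE(1)[OF F_subfield] .

lemmas B_closed [simp] = subringE(1)[OF B_subring, THEN subsetD]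
lemmas B_zero [simp] = subringE(2)[OF B_subring]
lemmas B_one [simp] = subringE(3)[OF B_subring]
lemmas B_minus [simp] = subringE(5)[OF B_subring]
lemmas B_mult [simp] = subringE(6)[OF B_subring]
lemmas B_add [simp] = subringE(7)[OF B_subring]
lemmas F_zero [simp] = subringE(2)[OF F_subring]
lemmas F_one [simp] = subringE(3)[OF F_subring]
lemmas F_minus [simp] = subringE(5)[OF F_subring]
lemmas F_mult [simp] = subringE(6)[OF F_subring]
lemmas F_add [simp] = subringE(7)[OF F_subring]

lemma B_diff [simp]: "\<lbrakk>a \<in> B; b \<in> B\<rbrakk> \<Longrightarrow> a \<ominus> b \<in> B"
  by (simp add: minus_eq)

lemma F_diff [simp]: "\<lbrakk>a \<in> F; b \<in> F\<rbrakk> \<Longrightarrow> a \<ominus> b \<in> F"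
  by (simp add: minus_eq)

lemma F_in_B [simp]: "k \<in> F \<Longrightarrow> k \<in> B"
  using F_B by blast

lemma F_closed [simp]: "k \<in> F \<Longrightarrow> k \<in> carrier A"
  by simp

lemma F_inverse:
  assumes "k \<in> F" "k \<noteq> \<zero>"
  obtains k' where "k' \<in> F" "k' \<otimes> k = \<one>" "k \<otimes> k' = \<one>"
  using subfield_m_inv[OF F_subfield, of k] assms by blast

lemma one_not_zero: "\<one> \<noteq> \<zero>"
  using F_char_zero[of 1] by simp

lemma F_nat [simp]: "add_pow A (n::nat) \<one> \<in> F"
  by (induction n) (simp_all add: add.nat_pow_Suc)

lemma F_infinite: "infinite F"
proof
  assume "finite F"
  have inj: "inj (\<lambda>n::nat. add_pow A n \<one>)"
  proof (rule linorder_injI)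
    fix m n :: nat assume "m < n"
    then have "add_pow A n \<one> = add_pow A m \<one> \<oplus> add_pow A (n - m) \<one>"
      by (metis add.nat_pow_mult le_add_diff_inverse less_imp_le one_closed)
    then show "add_pow A m \<one> \<noteq> add_pow A n \<one>"
      using F_char_zero[of "n - m"] \<open>m < n\<close> add.r_cancel_one'[OF F_closed F_closed, OF F_nat F_nat]
      by force
  qed
  have "range (\<lambda>n::nat. add_pow A n \<one>) \<subseteq> F" by auto
  then show False using inj \<open>finite F\<close> by (meson finite_imageD finite_subset infinite_UNIV_nat)
qed

lemma delta_B [simp]: "b \<in> B \<Longrightarrow> \<delta> b \<in> B"
  unfolding \<delta>_def by (rule commutator_closed)

lemma delta_pow_B [simp]: "b \<in> B \<Longrightarrow> (\<delta> ^^ n) b \<in> B"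
  by (induction n) simp_all

lemma theta_mult: "b \<in> B \<Longrightarrow> \<theta> \<otimes> b = b \<otimes> \<theta> \<oplus> \<delta> b"
  unfolding \<delta>_def by (simp add: minus_eq a_ac r_neg1 r_neg2 r_neg)

lemma delta_add: "\<lbrakk>a \<in> B; b \<in> B\<rbrakk> \<Longrightarrow> \<delta> (a \<oplus> b) = \<delta> a \<oplus> \<delta> b"
  unfolding \<delta>_def by (simp add: l_distr r_distr minus_eq minus_add a_ac)

lemma delta_F: "k \<in> F \<Longrightarrow> \<delta> k = \<zero>"
  unfolding \<delta>_def using F_theta[of k] by (simp add: minus_eq r_neg)

lemma delta_mult:
  assumes "a \<in> B" "b \<in> B"
  shows "\<delta> (a \<otimes> b) = \<delta> a \<otimes> b \<oplus> a \<otimes> \<delta> b"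
proof -
  have "\<delta> a \<otimes> b \<oplus> a \<otimes> \<delta> b = (\<theta> \<otimes> a \<otimes> b \<ominus> a \<otimes> \<theta> \<otimes> b) \<oplus> (a \<otimes> \<theta> \<otimes> b \<ominus> a \<otimes> b \<otimes> \<theta>)"
    unfolding \<delta>_def using assms by (simp add: l_distr r_distr minus_eq l_minus r_minus m_assoc)
  also have "\<dots> = \<delta> (a \<otimes> b)"
    unfolding \<delta>_def using assms by (simp add: minus_eq a_assoc m_assoc r_neg1 r_neg2)
  finally show ?thesis by simp
qed

lemma delta_F_mult: "\<lbrakk>k \<in> F; b \<in> B\<rbrakk> \<Longrightarrow> \<delta> (k \<otimes> b) = k \<otimes> \<delta> b"
  by (simp add: delta_mult delta_F)

lemma delta_nilpotent: "b \<in> B \<Longrightarrow> \<exists>n. (\<delta> ^^ n) b = \<zero>"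
  using commutator_nilpotent unfolding \<delta>_def .

end

locale fg_diff_module = fg_diff_ring A F B G \<theta> + left_module A M
  for A :: "('a, 'x) ring_scheme" (structure) and F B G \<theta>
    and M :: "('a, 'm, 'c) module_scheme" (structure)
begin

lemma stable_additive: "stable M W N \<Longrightarrow> stable M {} N"
  by (erule stable_mono) simp

lemma stable_B:
  assumes "stable M (F \<union> G) N"
  shows "stable M B N"
proof -
  have "B \<subseteq> {a \<in> carrier A. \<forall>n\<in>N. a \<bullet> n \<in> N}"
    by (rule B_generated[OF subring_stabiliser[OF stable_additive[OF assms]]])
       (use stable_smult[OF assms] G_B in auto)
  then show ?thesis using assms unfolding stable_def by auto
qed

lemma stable_A:
  assumes "stable M (insert \<theta> B) N"
  shows "stable M (carrier A) N"
proof -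
  have "carrier A \<subseteq> {a \<in> carrier A. \<forall>n\<in>N. a \<bullet> n \<in> N}"
    by (rule A_generated[OF subring_stabiliser[OF stable_additive[OF assms]]])
       (use stable_smult[OF assms] in auto)
  then show ?thesis using assms unfolding stable_def by auto
qed

lemma line_stable:
  assumes "m \<in> carrier M"
  shows "stable M F {k \<bullet> m |k. k \<in> F}"
proof (rule stableI_diff)
  show "\<zero>\<zero> \<in> {k \<bullet> m |k. k \<in> F}" using assms by (auto intro!: exI[of _ \<zero>])
  show "u \<boxminus> v \<in> {k \<bullet> m |k. k \<in> F}" if uv: "u \<in> {k \<bullet> m |k. k \<in> F}" "v \<in> {k \<bullet> m |k. k \<in> F}" for u v
  proof -
    obtain k l where "k \<in> F" "l \<in> F" "u = k \<bullet> m" "v = l \<bullet> m" using uv by blast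
    then show ?thesis using assms by (auto intro!: exI[of _ "k \<ominus> l"] simp: smult_l_diff)
  qed
  show "b \<bullet> u \<in> {k \<bullet> m |k. k \<in> F}" if bu: "b \<in> F" "u \<in> {k \<bullet> m |k. k \<in> F}" for b u
  proof -
    obtain k where "k \<in> F" "u = k \<bullet> m" using bu by blast
    then show ?thesis using assms bu by (auto intro!: exI[of _ "b \<otimes> k"] simp: smult_assoc1)
  qed
qed (use assms in auto)

lemma line_self: "m \<in> carrier M \<Longrightarrow> m \<in> {k \<bullet> m |k. k \<in> F}"
  by (auto intro!: exI[of _ \<one>])

lemma line_simple:
  assumes "m \<in> carrier M" "stable M F L" "L \<subseteq> {k \<bullet> m |k. k \<in> F}" "L \<noteq> {\<zero>\<zero>}"
  shows "m \<in> L"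
proof -
  obtain k where k: "k \<in> F" "k \<bullet> m \<in> L" "k \<bullet> m \<noteq> \<zero>\<zero>"
    using assms(3,4) stable_zero[OF assms(2)] by blast
  then have "k \<noteq> \<zero>" using assms(1) by auto
  then obtain k' where k': "k' \<in> F" "k' \<otimes> k = \<one>" using F_inverse[OF k(1)] by metis
  have "m = k' \<bullet> k \<bullet> m" using k(1) k' assms(1) by (simp add: smult_assoc1[symmetric])
  then show ?thesis using stable_smult[OF assms(2) k'(1) k(2)] by simp
qed

lemma line_subspaces:
  assumes "m \<in> carrier M" "stable M F L" "L \<subseteq> {k \<bullet> m |k. k \<in> F}"
  shows "L = {\<zero>\<zero>} \<or> L = {k \<bullet> m |k. k \<in> F}"
  using line_simple[OF assms] stable_smult[OF assms(2)] assms(3) by blast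

lemma line_acc: "m \<in> carrier M \<Longrightarrow> acc_family (stable_within F {k \<bullet> m |k. k \<in> F})"
  by (rule acc_family_subset[OF acc_finite_family[of "{{\<zero>\<zero>}, {k \<bullet> m |k. k \<in> F}}"]])
     (use line_subspaces in auto)

lemma ore_step_B:
  assumes "W \<subseteq> B" "\<zero> \<in> W" "g \<in> B" "stable M W N"
  shows "ore_step A M W g N"
proof (intro ore_step.intro ore_step_axioms.intro)
  show "left_module A M" by (rule left_module_axioms)
  fix b assume "b \<in> W"
  then have "b \<in> B" using assms by blast
  then show "\<exists>b'\<in>W. g \<otimes> b = b \<otimes> g \<oplus> b'"
    using assms B_comm[of g b] by (intro bexI[of _ \<zero>]) auto
qed (use assms in auto)

lemma ore_step_theta:
  assumes "stable M B N"
  shows "ore_step A M B \<theta> N"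
  by (intro ore_step.intro ore_step_axioms.intro left_module_axioms)
     (use assms theta_mult delta_B in auto)

text \<open>The induction starts from the line through \<open>m\<close>, which has only two
  \<open>F\<close>-subspaces. Each new generator commutes with the operators already present, so the
  extension step applies with zero corrections.\<close>

lemma acc_generators:
  assumes "m \<in> carrier M" "set gs \<subseteq> B"
  shows "\<exists>N. m \<in> N \<and> stable M (F \<union> set gs) N \<and> acc_family (stable_within (F \<union> set gs) N)"
  using assms(2)
proof (induction gs)
  case Nil
  show ?case
    using line_stable[OF assms(1)] line_acc[OF assms(1)] line_self[OF assms(1)]
    by (intro exI[of _ "{k \<bullet> m |k. k \<in> F}"]) simp
next
  case (Cons g gs)
  then obtain N where N: "m \<in> N" "stable M (F \<union> set gs) N" "acc_family (stable_within (F \<union> set gs) N)"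
    by auto
  interpret step: ore_step A M "F \<union> set gs" g N
    by (rule ore_step_B) (use Cons.prems N F_B in auto)
  have "insert g (F \<union> set gs) = F \<union> set (g # gs)" by simp
  then show ?case
    using step.acc_step[OF N(3)] step.span_stable step.N0_subset_span N(1) by (metis subsetD)
qed

theorem acc_cyclic:
  assumes "m \<in> carrier M"
  shows "acc_family (stable_within (carrier A) (cyclic m))"
proof -
  obtain gs where gs: "set gs = G" using finite_list[OF G_finite] by blast
  obtain N where N: "m \<in> N" "stable M (F \<union> G) N" "acc_family (stable_within (F \<union> G) N)"
    using acc_generators[OF assms, of gs] gs G_B by auto
  have "stable_within B N \<subseteq> stable_within (F \<union> G) N"
    using stable_mono[of M B _ "F \<union> G"] F_B G_B by auto
  then have acc: "acc_family (stable_within B N)" using N(3) acc_family_subset by blast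
  interpret step: ore_step A M B \<theta> N by (rule ore_step_theta[OF stable_B[OF N(2)]])
  have "cyclic m \<subseteq> step.span"
    using cyclic_least[OF stable_A[OF step.span_stable]] step.N0_subset_span N(1) by blast
  moreover have "insert \<theta> B \<subseteq> carrier A" by auto
  ultimately have "stable_within (carrier A) (cyclic m) \<subseteq> stable_within (insert \<theta> B) step.span"
    using stable_mono[of M "carrier A" _ "insert \<theta> B"] by auto
  then show ?thesis using step.acc_step[OF acc] acc_family_subset by blast
qed

theorem acc_finitely_generated:
  assumes "finite Q" "Q \<subseteq> carrier M"
  shows "\<exists>N. stable M (carrier A) N \<and> Q \<subseteq> N \<and> acc_family (stable_within (carrier A) N)"
  using assms
proof (induction Q)
  case empty
  have "stable_within (carrier A) {\<zero>\<zero>} \<subseteq> {{\<zero>\<zero>}}" using stable_zero by blast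
  then have "acc_family (stable_within (carrier A) {\<zero>\<zero>})"
    by (rule acc_family_subset[OF acc_finite_family, rotated]) simp
  then show ?case using stable_zero_set[of "carrier A"] by blast
next
  case (insert m Q)
  then obtain N where N: "stable M (carrier A) N" "Q \<subseteq> N" "acc_family (stable_within (carrier A) N)"
    by auto
  have m: "m \<in> carrier M" using insert by simp
  note C = cyclic_stable[OF m]
  have "insert m Q \<subseteq> msum N (cyclic m)"
    using msum_left[OF N(1) C] msum_right[OF N(1) C] N(2) cyclic_self[OF m] by blast
  then show ?case
    using acc_sum[OF _ N(1) C N(3) acc_cyclic[OF m]] stable_msum_carrier[OF N(1) C] by blast
qed

end

section \<open>Central elements act as scalars on simple modules\<close>

lemma (in ore_step) xpow_eq: "xpow i = x [^] i"
  by (induction i) (simp_all add: xpow.simps(2) R.nat_pow_Suc2[symmetric])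

text \<open>
  If \<open>c\<close> acts centrally on a simple module, but not as a scalar, then all \<open>c - k\<close> are injective and the
  central injective operators in \<open>F[c]\<close> form such a \<open>T\<close>; \<open>not_simple\<close> below refutes this.
\<close>

locale torsion_module = fg_diff_module A F B G \<theta> M
  for A :: "('a, 'x) ring_scheme" (structure) and F B G \<theta>
    and M :: "('a, 'm, 'c) module_scheme" (structure) +
  fixes c :: 'a and T :: "'a set"
  assumes c_B: "c \<in> B" and T_B: "T \<subseteq> B" and T_one: "\<one> \<in> T"
    and T_mult: "\<lbrakk>s \<in> T; t \<in> T\<rbrakk> \<Longrightarrow> s \<otimes> t \<in> T"
    and T_central: "t \<in> T \<Longrightarrow> central_on t (carrier M)"
    and T_injective: "\<lbrakk>t \<in> T; m \<in> carrier M; t \<bullet> m = \<zero>\<zero>\<rbrakk> \<Longrightarrow> m = \<zero>\<zero>"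
    and T_stable: "stable M (insert c F) N \<Longrightarrow> stable M T N"
    and shift_T: "k \<in> F \<Longrightarrow> c \<ominus> k \<in> T"
begin

lemma T_closed [simp]: "t \<in> T \<Longrightarrow> t \<in> carrier A"
  using T_B by auto

lemma c_closed [simp]: "c \<in> carrier A"
  using c_B by simp

lemma T_commute: "\<lbrakk>t \<in> T; a \<in> carrier A; m \<in> carrier M\<rbrakk> \<Longrightarrow> t \<bullet> a \<bullet> m = a \<bullet> t \<bullet> m"
  using T_central unfolding central_on_def by blast

lemma ore_step_torsion_axiomsI:
  assumes "ore_step A M W x N" "stable M T N"
  shows "ore_step_torsion A M W x N T"
  by (intro ore_step_torsion.intro ore_step_torsion_axioms.intro assms)
     (auto intro: T_one T_mult T_commute)

lemma eval_F: "set p \<subseteq> F \<Longrightarrow> eval p c \<in> carrier A"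
  by (rule eval_in_carrier) (auto dest: subsetD)

abbreviation shift_product :: "'a list \<Rightarrow> 'a"
  where "shift_product ms \<equiv> foldr (\<lambda>\<mu> a. (c \<ominus> \<mu>) \<otimes> a) ms \<one>"

lemma shift_product_T: "set ms \<subseteq> F \<Longrightarrow> shift_product ms \<in> T"
  by (induction ms) (simp_all add: T_one T_mult shift_T)

text \<open>Distinct shifts are coprime:
  \<open>(c \<ominus> k) \<ominus> (c \<ominus> \<mu>)\<close> is a nonzero scalar, so if both
  shifts send \<open>z\<close> into \<open>L\<close>, then \<open>z\<close> lies in
  \<open>L\<close>. The factors of the product are peeled off in this way.\<close>

lemma shift_injective_mod:
  assumes "stable M (insert c F) L" "set ms \<subseteq> F" "k \<in> F" "k \<notin> set ms" "y \<in> carrier M"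
    and "shift_product ms \<bullet> y \<in> L" "(c \<ominus> k) \<bullet> y \<in> L"
  shows "y \<in> L"
  using assms(2,4,6)
proof (induction ms)
  case Nil
  then show ?case using assms(5) by simp
next
  case (Cons \<mu> ms)
  define z where "z = shift_product ms \<bullet> y"
  have mu [simp]: "\<mu> \<in> F" "\<mu> \<noteq> k" "k \<in> F" using Cons.prems assms(3) by auto
  have P: "shift_product ms \<in> T" using Cons.prems shift_product_T by simp
  have [simp]: "z \<in> carrier M" unfolding z_def using P assms(5) by simp
  have 1: "(c \<ominus> \<mu>) \<bullet> z \<in> L" using Cons.prems(3) P assms(5) unfolding z_def by (simp add: smult_assoc1)
  have "(c \<ominus> k) \<bullet> z = shift_product ms \<bullet> (c \<ominus> k) \<bullet> y"
    unfolding z_def using T_commute[OF P, of "c \<ominus> k" y] assms(5) by simp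
  then have 2: "(c \<ominus> k) \<bullet> z \<in> L" using stable_smult[OF T_stable[OF assms(1)] P assms(7)] by simp
  have "(c \<ominus> k) \<ominus> (c \<ominus> \<mu>) = \<mu> \<ominus> k"
    by (simp add: A.minus_eq A.minus_add A.a_ac A.r_neg1 A.r_neg2)
  then have 3: "(\<mu> \<ominus> k) \<bullet> z \<in> L"
    using stable_diff[OF assms(1) 2 1] smult_l_diff[of "c \<ominus> k" "c \<ominus> \<mu>" z] by simp
  have "\<mu> \<ominus> k \<noteq> \<zero>" using mu by (simp add: A.r_right_minus_eq)
  then obtain k' where k': "k' \<in> F" "k' \<otimes> (\<mu> \<ominus> k) = \<one>" using F_inverse[of "\<mu> \<ominus> k"] mu by auto
  have "z = k' \<bullet> (\<mu> \<ominus> k) \<bullet> z" using k' by (simp add: smult_assoc1[symmetric])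
  then have "z \<in> L" using stable_smult[OF assms(1) _ 3, of k'] k' by simp
  then show ?case using Cons unfolding z_def by simp
qed

section \<open>Finiteness of the bad shifts, starting from the module of polynomials in c applied to
  s\<close>

context
  fixes s assumes s: "s \<in> carrier M"
begin

interpretation base: ore_step A M F c "{k \<bullet> s |k. k \<in> F}"
  by (rule ore_step_B[OF _ _ c_B line_stable[OF s]]) auto

lemma fil_eval: "y \<in> base.fil i \<Longrightarrow> \<exists>p. set p \<subseteq> F \<and> length p = i \<and> y = eval p c \<bullet> s"
proof (induction i arbitrary: y)
  case 0
  then show ?case using s by simp
next
  case (Suc i)
  obtain n l where nl: "n \<in> {k \<bullet> s |k. k \<in> F}" "l \<in> base.fil i" "y = base.xpow i \<bullet> n \<boxplus> l"
    by (rule base.filE[OF Suc.prems])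
  obtain k where k: "k \<in> F" "n = k \<bullet> s" using nl(1) by blast
  obtain p where p: "set p \<subseteq> F" "length p = i" "l = eval p c \<bullet> s" using Suc.IH nl(2) by blast
  have ci: "c [^] i \<in> B" using c_B by (induction i) simp_all
  have ep: "eval p c \<in> carrier A" by (rule eval_F[OF p(1)])
  have "(c [^] i \<otimes> k \<oplus> eval p c) \<bullet> s = (c [^] i) \<bullet> k \<bullet> s \<boxplus> eval p c \<bullet> s"
    using k(1) ep s ci by (simp add: smult_l_distr smult_assoc1)
  then have "y = (c [^] i \<otimes> k \<oplus> eval p c) \<bullet> s"
    unfolding nl(3) k(2) p(3) base.xpow_eq by simp
  also have "c [^] i \<otimes> k \<oplus> eval p c = eval (k # p) c" using p(2) B_comm[OF ci, of k] k by simp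
  finally show ?case using p k by (intro exI[of _ "k # p"]) simp
qed

text \<open>Here \<open>span\<close> is \<open>F[c] s\<close>. If some leading coefficient of
  \<open>L\<close> is nonzero, \<open>L\<close> contains a monic polynomial \<open>Q\<close> in
  \<open>c\<close> applied to \<open>s\<close>; then \<open>Q\<close> kills \<open>span\<close>
  modulo \<open>L\<close>, so everything is torsion, and only the roots of \<open>Q\<close> can be
  bad. Otherwise \<open>L\<close> is zero and \<open>span\<close> is free over \<open>F[c]\<close>,
  where each shift raises degrees and none is bad.\<close>

lemma finite_bad_base:
  assumes L: "stable M (insert c F) L" "L \<subseteq> base.span"
  shows "finite {k \<in> F. c \<ominus> k \<in> T \<and> \<not> separates T (c \<ominus> k) L base.span}"
proof -
  have LF: "stable M F L" using L by (simp add: stable_insert)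
  have LT: "stable M T L" by (rule T_stable[OF L(1)])
  have span_c: "y \<in> base.span \<Longrightarrow> y \<in> carrier M" for y using stable_carrier[OF base.span_stable] .
  have spanT: "stable M T base.span" by (rule T_stable[OF base.span_stable])
  show ?thesis
  proof (cases "\<exists>i. base.lead i L \<noteq> {\<zero>\<zero>}")
    case True
    then obtain i where i: "base.lead i L \<noteq> {\<zero>\<zero>}" by blast
    have "s \<in> base.lead i L" by (rule line_simple[OF s base.lead_stable[OF LF] base.lead_subset i])
    then have "base.xpow i \<bullet> s \<in> msum L (base.fil i)" using base.leadD by blast
    then obtain u l where ul: "u \<in> L" "l \<in> base.fil i" "base.xpow i \<bullet> s = u \<boxplus> l" by (auto elim: msumE)
    have uc: "u \<in> carrier M" "l \<in> carrier M" using ul stable_carrier[OF LF] base.fil_carrier by auto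
    obtain p where p: "set p \<subseteq> F" "length p = i" "\<ominus>\<^bsub>M\<^esub> l = eval p c \<bullet> s"
      using fil_eval[OF stable_minus[OF base.fil_additive ul(2)]] by blast
    have ep: "eval p c \<in> carrier A" by (rule eval_F[OF p(1)])
    have "eval (\<one> # p) c \<bullet> s = base.xpow i \<bullet> s \<boxplus> eval p c \<bullet> s"
      using p(2) ep s by (simp add: smult_l_distr base.xpow_eq)
    also have "\<dots> = u" using ul uc p(3)[symmetric] by (simp add: M.a_assoc M.r_neg)
    finally have pL: "eval (\<one> # p) c \<bullet> s \<in> L" using ul by simp
    have F_subcring: "subcring F A" by (rule subcringI[OF F_subring]) (auto intro: B_comm)
    have "\<exists>ms. set ms \<subseteq> F \<and> eval (\<one> # p) c = shift_product ms"
      by (rule monic_factorisation[OF F_subcring c_closed _ F_roots])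
         (simp_all add: p(1) B_comm[OF _ c_B])
    then obtain ms where ms: "set ms \<subseteq> F" "eval (\<one> # p) c = shift_product ms" by blast
    define Q where "Q = shift_product ms"
    have Q: "Q \<in> T" unfolding Q_def by (rule shift_product_T[OF ms(1)])
    \<comment> \<open>\<open>Q\<close> sends \<open>s\<close> into \<open>L\<close> and acts
      centrally, so the elements it sends into \<open>L\<close> are stable under \<open>c\<close>
      and \<open>F\<close> and exhaust \<open>span\<close>.\<close>
    have D: "base.span \<subseteq> {y \<in> base.span. Q \<bullet> y \<in> L}"
    proof (rule base.span_least)
      show "stable M (insert c F) {y \<in> base.span. Q \<bullet> y \<in> L}"
      proof (rule stableI_diff)
        show "\<zero>\<zero> \<in> {y \<in> base.span. Q \<bullet> y \<in> L}"
          using stable_zero[OF base.span_stable] stable_zero[OF LF] Q by simp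
        show "u \<boxminus> v \<in> {y \<in> base.span. Q \<bullet> y \<in> L}"
          if "u \<in> {y \<in> base.span. Q \<bullet> y \<in> L}" "v \<in> {y \<in> base.span. Q \<bullet> y \<in> L}" for u v
          using that Q span_c stable_diff[OF base.span_stable] stable_diff[OF LF] by (simp add: smult_r_diff)
        show "a \<bullet> u \<in> {y \<in> base.span. Q \<bullet> y \<in> L}"
          if a: "a \<in> insert c F" and "u \<in> {y \<in> base.span. Q \<bullet> y \<in> L}" for a u
          using that T_commute[OF Q, of a u] span_c[of u] stable_smult[OF base.span_stable a] stable_smult[OF L(1) a]
          by auto
      qed (use span_c in auto)
      show "{k \<bullet> s |k. k \<in> F} \<subseteq> {y \<in> base.span. Q \<bullet> y \<in> L}"
        using base.N0_subset_span T_commute[OF Q _ s] stable_smult[OF LF] pL ms(2) unfolding Q_def by auto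
    qed
    have "separates T (c \<ominus> k) L base.span" if "k \<in> F" "k \<notin> set ms" for k
      unfolding separates_def
      using shift_injective_mod[OF L(1) ms(1) that] D Q span_c unfolding Q_def by blast
    then have "{k \<in> F. c \<ominus> k \<in> T \<and> \<not> separates T (c \<ominus> k) L base.span} \<subseteq> set ms" by blast
    then show ?thesis using finite_subset by blast
  next
    case False
    then have lead0: "base.lead i L = {\<zero>\<zero>}" for i by blast
    have Z: "stable M F {\<zero>\<zero>}" by (rule stable_zero_set) auto
    have L0: "L = {\<zero>\<zero>}"
    proof
      show "L \<subseteq> {\<zero>\<zero>}"
        by (rule base.subset_by_lead[OF Z LF _ L(2)])
           (use stable_zero[OF LF] lead0 stable_zero[OF base.lead_stable[OF Z]] in auto)
    qed (use stable_zero[OF LF] in simp)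
    have "separates T (c \<ominus> k) L base.span" if k: "k \<in> F" for k
    proof -
      define t where "t = c \<ominus> k"
      have t: "t \<in> T" "t \<in> carrier A" unfolding t_def using shift_T[OF k] by auto
      \<comment> \<open>\<open>t \<bullet> y\<close> and \<open>c \<bullet> y\<close> differ by
        \<open>k \<bullet> y\<close>, which has no higher degree than \<open>y\<close>. If
        \<open>t \<bullet> y\<close> did not gain a degree, the leading coefficient of
        \<open>y\<close> would lie in \<open>lead (Suc i) L\<close>, which is zero.\<close>
      have step: "t \<bullet> y \<notin> base.fil (Suc i)" if y: "y \<in> base.fil (Suc i)" "y \<notin> base.fil i" for y i
      proof
        assume ty: "t \<bullet> y \<in> base.fil (Suc i)"
        obtain n l where nl: "n \<in> {k \<bullet> s |k. k \<in> F}" "l \<in> base.fil i" "y = base.xpow i \<bullet> n \<boxplus> l"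
          by (rule base.filE[OF y(1)])
        have [simp]: "n \<in> carrier M" "l \<in> carrier M" "y \<in> carrier M"
          using base.N0_carrier[OF nl(1)] base.fil_carrier nl(2) y(1) by auto
        have "t \<bullet> y = c \<bullet> y \<boxminus> k \<bullet> y" unfolding t_def using k by (simp add: smult_l_diff)
        then have "c \<bullet> y \<in> base.fil (Suc i)"
          using stable_diff_cancel[OF base.fil_additive, of "c \<bullet> y" "k \<bullet> y" "Suc i"] ty
            stable_smult[OF base.fil_stable k y(1)] by simp
        moreover have "c \<bullet> y = base.xpow (Suc i) \<bullet> n \<boxplus> c \<bullet> l" using nl(3) by (simp add: smult_r_distr)
        ultimately have "base.xpow (Suc i) \<bullet> n \<in> base.fil (Suc i)"
          using stable_add_cancel[OF base.fil_additive, of "base.xpow (Suc i) \<bullet> n" "c \<bullet> l" "Suc i"]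
            base.x_fil[OF nl(2)] by simp
        then have "n \<in> base.lead (Suc i) L"
          unfolding base.lead_def using nl(1) msum_right[OF LF base.fil_stable] by blast
        then have "n = \<zero>\<zero>" using lead0 by blast
        then show False using nl y(2) by simp
      qed
      have step': "t \<bullet> y \<notin> base.fil (Suc i)" if y: "y \<in> base.span" "y \<notin> base.fil i" for y i
      proof -
        obtain j0 where "y \<in> base.fil j0" using base.spanE y(1) by blast
        define j where "j = (LEAST j. y \<in> base.fil j)"
        have j: "y \<in> base.fil j" "\<And>i. y \<in> base.fil i \<Longrightarrow> j \<le> i"
          unfolding j_def using \<open>y \<in> base.fil j0\<close> by (auto intro: LeastI Least_le)
        have "i < j" using y(2) j(1) base.fil_mono[of j i] by (meson not_less subsetD)
        then obtain j' where j': "j = Suc j'" "i \<le> j'" by (metis less_eq_Suc_le Suc_le_D Suc_le_mono)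
        have "y \<notin> base.fil j'" using j(2)[of j'] j' by auto
        then have "t \<bullet> y \<notin> base.fil (Suc j')" using step j(1) j' by blast
        then show ?thesis using base.fil_mono[of "Suc i" "Suc j'"] j'(2) by auto
      qed
      have pow: "(t [^] n) \<bullet> z \<in> base.span \<and> (t [^] n) \<bullet> z \<notin> base.fil n"
        if z: "z \<in> base.span" "z \<noteq> \<zero>\<zero>" for z and n :: nat
      proof (induction n)
        case 0
        then show ?case using z span_c by simp
      next
        case (Suc n)
        have "(t [^] Suc n) \<bullet> z = t \<bullet> (t [^] n) \<bullet> z"
          using t span_c[OF z(1)] T_commute[OF t(1), of "t [^] n" z] by (simp add: smult_assoc1)
        then show ?case using step'[of "(t [^] n) \<bullet> z" n] Suc stable_smult[OF spanT t(1)] by auto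
      qed
      show ?thesis
        unfolding separates_def t_def[symmetric] L0
      proof (intro conjI ballI impI)
        fix y assume y: "y \<in> base.span" "t \<bullet> y \<in> {\<zero>\<zero>}"
        then show "y \<in> {\<zero>\<zero>}" using T_injective[OF t(1) span_c[OF y(1)]] by simp
      next
        fix y assume y: "y \<in> base.span" "\<forall>n::nat. \<exists>z\<in>base.span. y \<boxminus> (t [^] n) \<bullet> z \<in> {\<zero>\<zero>}"
        obtain i where i: "y \<in> base.fil i" using y(1) base.spanE by blast
        obtain z where z: "z \<in> base.span" "y \<boxminus> (t [^] i) \<bullet> z = \<zero>\<zero>" using y(2) by blast
        then have eq: "y = (t [^] i) \<bullet> z" using t span_c y(1) diff_eq_zero_iff by simp
        \<comment> \<open>The exponent was chosen to be the filtration index of \<open>y\<close>: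
          for nonzero \<open>z\<close> the element \<open>(t [^] i) \<bullet> z\<close> would lie
          outside \<open>fil i\<close>.\<close>
        then have "z = \<zero>\<zero>" using pow[OF z(1), of i] i by blast
        then have "y = \<zero>\<zero>" using eq t by simp
        then show "\<exists>\<tau>\<in>T. \<tau> \<bullet> y \<in> {\<zero>\<zero>}" using T_one by (intro bexI[of _ \<one>]) simp_all
      qed
    qed
    then have bad: "{k \<in> F. c \<ominus> k \<in> T \<and> \<not> separates T (c \<ominus> k) L base.span} = {}" by blast
    show ?thesis unfolding bad by simp
  qed
qed

text \<open>\<open>T\<close> is kept among the operators so that every leading coefficient set is
  \<open>T\<close>-stable at the next step. At the start this is free, since stability under
  \<open>c\<close> and \<open>F\<close> implies stability under \<open>T\<close>.\<close>

lemma finite_bad_generators: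
  assumes "set gs \<subseteq> B"
  shows "\<exists>N. s \<in> N \<and> stable M (insert c F \<union> T \<union> set gs) N
    \<and> acc_family (stable_within (insert c F \<union> T \<union> set gs) N)
    \<and> (\<forall>L. stable M (insert c F \<union> T \<union> set gs) L \<and> L \<subseteq> N \<longrightarrow>
        finite {k \<in> F. c \<ominus> k \<in> T \<and> \<not> separates T (c \<ominus> k) L N})"
  using assms
proof (induction gs)
  case Nil
  have "stable M (insert c F \<union> T \<union> set []) N \<longleftrightarrow> stable M (insert c F) N" for N
    using T_stable[of N] unfolding stable_Un list.set by (meson empty_subsetI stable_mono)
  then show ?case
    using base.span_stable base.N0_subset_span line_self[OF s] base.acc_step[OF line_acc[OF s]] finite_bad_base
    by (intro exI[of _ base.span]) auto
next
  case (Cons g gs)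
  define W where "W = insert c F \<union> T \<union> set gs"
  obtain N where N: "s \<in> N" "stable M W N" "acc_family (stable_within W N)"
    and bad: "\<And>L. \<lbrakk>stable M W L; L \<subseteq> N\<rbrakk> \<Longrightarrow> finite {k \<in> F. c \<ominus> k \<in> T \<and> \<not> separates T (c \<ominus> k) L N}"
    using Cons unfolding W_def by auto
  have "ore_step A M W g N"
    by (rule ore_step_B) (use Cons.prems N c_B T_B F_B in \<open>auto simp: W_def\<close>)
  moreover have TW: "T \<subseteq> W" unfolding W_def by blast
  ultimately interpret step: ore_step_torsion A M W g N T
    using stable_mono[OF N(2)] ore_step_torsion_axiomsI by blast
  have "insert g W = insert c F \<union> T \<union> set (g # gs)" unfolding W_def by auto
  then show ?case
    using step.acc_step[OF N(3)] step.span_stable step.N0_subset_span N(1)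
      step.finite_bad_step[OF N(3) TW bad] by (intro exI[of _ step.span]) auto
qed

end

text \<open>Since \<open>F\<close> is infinite, some shift \<open>t\<close> separates the zero
  submodule. On a simple module \<open>t\<close> is bijective, so a nonzero \<open>s\<close> is
  divisible by every power of \<open>t\<close>; hence some element of \<open>T\<close> kills it,
  against injectivity.\<close>

theorem not_simple:
  assumes "\<And>L. stable M (carrier A) L \<Longrightarrow> L = {\<zero>\<zero>} \<or> L = carrier M" "carrier M \<noteq> {\<zero>\<zero>}"
  shows False
proof -
  obtain s where s: "s \<in> carrier M" "s \<noteq> \<zero>\<zero>" using assms(2) by blast
  obtain gs where gs: "set gs = G" using finite_list[OF G_finite] by blast
  define W where "W = insert c F \<union> T \<union> G"
  obtain N where N: "s \<in> N" "stable M W N" "acc_family (stable_within W N)"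
    and bad: "\<And>L. \<lbrakk>stable M W L; L \<subseteq> N\<rbrakk> \<Longrightarrow> finite {k \<in> F. c \<ominus> k \<in> T \<and> \<not> separates T (c \<ominus> k) L N}"
    using finite_bad_generators[OF s(1), of gs] gs G_B unfolding W_def by auto
  have WB: "W \<subseteq> B" unfolding W_def using c_B T_B F_B G_B by auto
  have stB: "stable M B U" if "stable M W U" for U
    by (rule stable_B, rule stable_mono[OF that]) (auto simp: W_def)
  have stW: "stable M W U" if "stable M B U" for U by (rule stable_mono[OF that WB])
  have acc: "acc_family (stable_within B N)" by (rule acc_family_subset[OF N(3)]) (use stW in blast)
  have TB: "T \<subseteq> B" by (rule T_B)
  interpret step: ore_step_torsion A M B \<theta> N T
    by (rule ore_step_torsion_axiomsI[OF ore_step_theta[OF stB[OF N(2)]]])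
       (rule stable_mono[OF stB[OF N(2)] T_B])
  have "step.span = carrier M"
    using assms(1)[OF stable_A[OF step.span_stable]] step.N0_subset_span N(1) s(2) by blast
  moreover have "stable M (insert \<theta> B) {\<zero>\<zero>}" by (rule stable_zero_set) auto
  ultimately have "finite {k \<in> F. c \<ominus> k \<in> T \<and> \<not> separates T (c \<ominus> k) {\<zero>\<zero>} (carrier M)}"
    using step.finite_bad_step[OF acc TB bad[OF stW], where L = "{\<zero>\<zero>}"] by simp
  then have fin: "finite {k \<in> F. c \<ominus> k \<in> T \<and> \<not> separates T (c \<ominus> k) {\<zero>\<zero>} (carrier M)}" .
  have "\<exists>k\<in>F. separates T (c \<ominus> k) {\<zero>\<zero>} (carrier M)"
  proof (rule ccontr)
    assume "\<not> ?thesis"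
    then have "F \<subseteq> {k \<in> F. c \<ominus> k \<in> T \<and> \<not> separates T (c \<ominus> k) {\<zero>\<zero>} (carrier M)}"
      using shift_T by blast
    then show False using F_infinite finite_subset[OF _ fin] by blast
  qed
  then obtain k where k: "k \<in> F" "separates T (c \<ominus> k) {\<zero>\<zero>} (carrier M)" by blast
  define t where "t = c \<ominus> k"
  have t: "t \<in> T" unfolding t_def by (rule shift_T[OF k(1)])
  have Mst: "stable M (carrier A) (carrier M)" by (rule stable_carrier_set) simp
  have "(\<lambda>m. t \<bullet> m) ` carrier M = carrier M"
    using assms(1)[OF stable_image[OF Mst T_central[OF t]]] T_injective[OF t s(1)] s by blast
  then have surj: "\<exists>z\<in>carrier M. m = t \<bullet> z" if "m \<in> carrier M" for m using that by blast
  have "\<exists>z\<in>carrier M. s = (t [^] n) \<bullet> z" for n :: nat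
  proof (induction n)
    case 0
    then show ?case using s by (intro bexI[of _ s]) simp_all
  next
    case (Suc n)
    then obtain z where z: "z \<in> carrier M" "s = (t [^] n) \<bullet> z" by blast
    obtain w where "w \<in> carrier M" "z = t \<bullet> w" using surj[OF z(1)] by blast
    then show ?case using z t by (intro bexI[of _ w]) (simp_all add: smult_assoc1)
  qed
  then have "\<exists>z\<in>carrier M. s \<boxminus> (t [^] n) \<bullet> z \<in> {\<zero>\<zero>}" for n :: nat
    using s(1) diff_eq_zero_iff[OF s(1) s(1)] by (metis singletonI)
  then obtain \<tau> where "\<tau> \<in> T" "\<tau> \<bullet> s = \<zero>\<zero>"
    using k(2) s(1) unfolding separates_def t_def by blast
  then show False using T_injective s by blast
qed

end

context fg_diff_module
begin

text \<open>The operators commuting with \<open>b\<close> on \<open>N\<close> form a subring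
  containing the commutative ring \<open>B\<close> and, by assumption, \<open>\<theta>\<close>; so
  they are all of \<open>A\<close>.\<close>

lemma central_onI:
  assumes "stable M (carrier A) N" "b \<in> B" "\<And>m. m \<in> N \<Longrightarrow> \<theta> \<bullet> b \<bullet> m = b \<bullet> \<theta> \<bullet> m"
  shows "central_on b N"
proof -
  have b: "b \<in> carrier A" using assms(2) by simp
  have "b \<bullet> a \<bullet> m = a \<bullet> b \<bullet> m" if "a \<in> B" "m \<in> N" for a m
    using that B_comm[OF assms(2) that(1)] assms(2) stable_carrier[OF assms(1)]
    by (simp add: smult_assoc1[symmetric])
  then have "carrier A \<subseteq> {a \<in> carrier A. \<forall>m\<in>N. b \<bullet> a \<bullet> m = a \<bullet> b \<bullet> m}"
    by (intro A_generated[OF commutant_subring[OF assms(1) b]]) (use assms in auto)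
  then show ?thesis using b unfolding central_on_def by blast
qed

text \<open>If \<open>c\<close> is no scalar, then for each \<open>k\<close> the kernel of
  \<open>c \<ominus> k\<close> is a proper submodule, hence zero, and all shifts belong to a set
  \<open>T\<close> as above.\<close>

theorem central_scalar:
  assumes simple: "\<And>L. stable M (carrier A) L \<Longrightarrow> L = {\<zero>\<zero>} \<or> L = carrier M" "carrier M \<noteq> {\<zero>\<zero>}"
    and c: "c \<in> B" "\<And>m. m \<in> carrier M \<Longrightarrow> \<theta> \<bullet> c \<bullet> m = c \<bullet> \<theta> \<bullet> m"
  shows "\<exists>k\<in>F. \<forall>m\<in>carrier M. c \<bullet> m = k \<bullet> m"
proof (rule ccontr)
  assume not: "\<not> (\<exists>k\<in>F. \<forall>m\<in>carrier M. c \<bullet> m = k \<bullet> m)"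
  \<comment> \<open>The last condition stands in for membership in \<open>F[c]\<close>: it is what
    makes \<open>T\<close> harmless on the module of polynomials in \<open>c\<close>.\<close>
  define T where "T = {t \<in> B. central_on t (carrier M) \<and> (\<forall>m\<in>carrier M. t \<bullet> m = \<zero>\<zero> \<longrightarrow> m = \<zero>\<zero>)
    \<and> (\<forall>N. stable M (insert c F) N \<longrightarrow> (\<forall>n\<in>N. t \<bullet> n \<in> N))}"
  have Mst: "stable M (carrier A) (carrier M)" by (rule stable_carrier_set) simp
  have "torsion_module A F B G \<theta> M c T"
  proof (intro torsion_module.intro torsion_module_axioms.intro fg_diff_module_axioms)
    show "\<one> \<in> T" unfolding T_def central_on_def using stable_carrier by auto
    show "s \<otimes> t \<in> T" if st: "s \<in> T" "t \<in> T" for s t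
    proof -
      have B: "s \<in> B" "t \<in> B" using st unfolding T_def by auto
      then have act: "(s \<otimes> t) \<bullet> m = s \<bullet> t \<bullet> m" if "m \<in> carrier M" for m
        using that by (simp add: smult_assoc1)
      have "central_on (s \<otimes> t) (carrier M)"
        unfolding central_on_def
      proof (intro conjI ballI)
        fix a m assume am: "a \<in> carrier A" "m \<in> carrier M"
        have "s \<bullet> t \<bullet> a \<bullet> m = s \<bullet> a \<bullet> t \<bullet> m"
          using st(2) am unfolding T_def central_on_def by simp
        also have "\<dots> = a \<bullet> s \<bullet> t \<bullet> m"
          using st(1) am smult_closed[OF B_closed[OF B(2)] am(2)] unfolding T_def central_on_def by simp
        finally show "(s \<otimes> t) \<bullet> a \<bullet> m = a \<bullet> (s \<otimes> t) \<bullet> m" using am by (simp add: act)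
      qed (use B in simp)
      moreover have "(s \<otimes> t) \<bullet> n \<in> N" if "stable M (insert c F) N" "n \<in> N" for N n
        using st that act[OF stable_carrier[OF that]] unfolding T_def by simp
      moreover have "m = \<zero>\<zero>" if "m \<in> carrier M" "(s \<otimes> t) \<bullet> m = \<zero>\<zero>" for m
      proof -
        have "t \<bullet> m \<in> carrier M" "s \<bullet> t \<bullet> m = \<zero>\<zero>" using that B act by simp_all
        then show ?thesis using st that(1) unfolding T_def by blast
      qed
      ultimately show ?thesis using B unfolding T_def by simp
    qed
    show "stable M T N" if "stable M (insert c F) N" for N
      using that unfolding T_def stable_def by blast
    show "c \<ominus> k \<in> T" if k: "k \<in> F" for k
    proof -
      have cB: "c \<ominus> k \<in> B" using c(1) k by simp
      have act: "(c \<ominus> k) \<bullet> m = c \<bullet> m \<boxminus> k \<bullet> m" if "m \<in> carrier M" for m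
        using that c(1) k by (simp add: smult_l_diff)
      have k\<theta>: "\<theta> \<bullet> k \<bullet> m = k \<bullet> \<theta> \<bullet> m" if "m \<in> carrier M" for m
        using that F_theta[OF k] k by (simp add: smult_assoc1[symmetric])
      have cent: "central_on (c \<ominus> k) (carrier M)"
        by (rule central_onI[OF Mst cB]) (use c k act k\<theta> in \<open>simp add: smult_r_diff\<close>)
      have "{m \<in> carrier M. (c \<ominus> k) \<bullet> m = \<zero>\<zero>} \<noteq> carrier M"
      proof
        assume eq: "{m \<in> carrier M. (c \<ominus> k) \<bullet> m = \<zero>\<zero>} = carrier M"
        have "c \<bullet> m = k \<bullet> m" if m: "m \<in> carrier M" for m
        proof -
          have "(c \<ominus> k) \<bullet> m = \<zero>\<zero>" using eq m by blast
          then show ?thesis using act[OF m] diff_eq_zero_iff m c(1) k by simp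
        qed
        then show False using not k by blast
      qed
      then have "{m \<in> carrier M. (c \<ominus> k) \<bullet> m = \<zero>\<zero>} = {\<zero>\<zero>}"
        using simple(1)[OF stable_kernel[OF Mst cent]] by blast
      moreover have "(c \<ominus> k) \<bullet> n \<in> N" if N: "stable M (insert c F) N" "n \<in> N" for N n
        using act[OF stable_carrier[OF N]] stable_diff[OF N(1)] stable_smult[OF N(1) _ N(2)] k by simp
      ultimately show ?thesis unfolding T_def using cB cent by blast
    qed
  qed (use c in \<open>auto simp: T_def\<close>)
  then show False using torsion_module.not_simple[OF _ simple] by blast
qed

end

section \<open>Descending chains over the constants\<close>

context left_module
begin

lemma stable_restrict_iff:
  assumes "stable M V N"
  shows "stable (M\<lparr>carrier := N\<rparr>) W L \<longleftrightarrow> stable M W L \<and> L \<subseteq> N"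
proof -
  have N: "subgroup N (add_monoid M)" using assms unfolding stable_def by simp
  have eq: "add_monoid (M\<lparr>carrier := N\<rparr>) = (add_monoid M)\<lparr>carrier := N\<rparr>" by simp
  have "subgroup L (add_monoid (M\<lparr>carrier := N\<rparr>)) \<longleftrightarrow> subgroup L (add_monoid M) \<and> L \<subseteq> N"
  proof
    assume L: "subgroup L (add_monoid (M\<lparr>carrier := N\<rparr>))"
    then have "L \<subseteq> N" using subgroup.subset by fastforce
    then show "subgroup L (add_monoid M) \<and> L \<subseteq> N"
      using M.add.incl_subgroup[OF N] L unfolding eq by simp
  next
    assume "subgroup L (add_monoid M) \<and> L \<subseteq> N"
    then show "subgroup L (add_monoid (M\<lparr>carrier := N\<rparr>))"
      using M.add.subgroup_incl[OF _ N] unfolding eq by simp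
  qed
  then show ?thesis unfolding stable_def by auto
qed

lemma restrict_left_module:
  assumes "stable M (carrier R) N"
  shows "left_module R (M\<lparr>carrier := N\<rparr>)"
proof (intro left_module.intro left_module_axioms.intro)
  show "ring R" by (rule R.ring_axioms)
  note c = stable_carrier[OF assms]
  show "abelian_group (M\<lparr>carrier := N\<rparr>)"
  proof (rule abelian_groupI)
    fix x assume x: "x \<in> carrier (M\<lparr>carrier := N\<rparr>)"
    then show "\<exists>y\<in>carrier (M\<lparr>carrier := N\<rparr>). y \<oplus>\<^bsub>M\<lparr>carrier := N\<rparr>\<^esub> x = \<zero>\<^bsub>M\<lparr>carrier := N\<rparr>\<^esub>"
      using stable_minus[OF assms, of x] M.l_neg[of x] c by auto
  qed (use stable_add[OF assms] stable_zero[OF assms] c in \<open>auto simp: M.a_ac\<close>)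
qed (use stable_smult[OF assms] stable_carrier[OF assms] in
      \<open>auto simp: smult_l_distr smult_r_distr smult_assoc1\<close>)

end

locale diff_essential = fg_diff_module A F B G \<theta> M + essential_simple A M S
  for A :: "('a, 'x) ring_scheme" (structure) and F B G \<theta>
    and M :: "('a, 'm, 'c) module_scheme" (structure) and S
begin

definition I :: "'a set" where "I = {b \<in> B. \<forall>s\<in>S. b \<bullet> s = \<zero>\<zero>}"

lemma S_carrier [simp]: "s \<in> S \<Longrightarrow> s \<in> carrier M"
  using stable_carrier[OF S_stable] .

lemma I_B [simp]: "a \<in> I \<Longrightarrow> a \<in> B"
  unfolding I_def by simp

lemma I_zero [simp]: "\<zero> \<in> I"
  unfolding I_def by simp

lemma I_add [simp]: "\<lbrakk>a \<in> I; b \<in> I\<rbrakk> \<Longrightarrow> a \<oplus> b \<in> I"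
  unfolding I_def by (simp add: smult_l_distr)

lemma I_minus [simp]: "a \<in> I \<Longrightarrow> \<ominus> a \<in> I"
  unfolding I_def by (simp add: smult_l_minus)

lemma I_diff [simp]: "\<lbrakk>a \<in> I; b \<in> I\<rbrakk> \<Longrightarrow> a \<ominus> b \<in> I"
  by (simp add: A.minus_eq)

lemma I_mult [simp]: "\<lbrakk>a \<in> B; b \<in> I\<rbrakk> \<Longrightarrow> a \<otimes> b \<in> I"
  unfolding I_def by (simp add: smult_assoc1)

lemma delta_act: "\<lbrakk>b \<in> B; m \<in> carrier M\<rbrakk> \<Longrightarrow> \<delta> b \<bullet> m = \<theta> \<bullet> b \<bullet> m \<boxminus> b \<bullet> \<theta> \<bullet> m"
  unfolding \<delta>_def by (simp add: smult_l_diff smult_assoc1)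

lemma delta_I [simp]:
  assumes "b \<in> I"
  shows "\<delta> b \<in> I"
proof -
  have "\<delta> b \<bullet> s = \<zero>\<zero>" if "s \<in> S" for s
  proof -
    have "\<theta> \<bullet> s \<in> S" by (rule stable_smult[OF S_stable theta_closed that])
    then show ?thesis
      using assms that delta_act[of b s] unfolding I_def by (simp add: M.minus_eq)
  qed
  then show ?thesis using assms unfolding I_def by simp
qed

lemma delta_pow_I: "b \<in> I \<Longrightarrow> (\<delta> ^^ n) b \<in> I"
  by (induction n) simp_all

lemma F_I:
  assumes "k \<in> F" "k \<in> I"
  shows "k = \<zero>"
proof (rule ccontr)
  assume "k \<noteq> \<zero>"
  then obtain k' where k': "k' \<in> F" "k' \<otimes> k = \<one>" using F_inverse assms by metis
  then have "\<one> \<in> I" using I_mult[of k' k] assms by simp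
  then show False using S_elem unfolding I_def by auto
qed

text \<open>As \<open>\<delta> c\<close> kills \<open>S\<close>, the operator \<open>c\<close>
  commutes with \<open>\<theta>\<close> on \<open>S\<close>. The scalar theorem is applied to
  \<open>S\<close> as a module in its own right, and equal action on \<open>S\<close> means
  congruence modulo \<open>I\<close>.\<close>

lemma scalar_mod_I:
  assumes "c \<in> B" "\<delta> c \<in> I"
  shows "\<exists>k\<in>F. c \<ominus> k \<in> I"
proof -
  let ?S = "M\<lparr>carrier := S\<rparr>"
  interpret res: left_module A ?S by (rule restrict_left_module[OF S_stable])
  interpret res: fg_diff_module A F B G \<theta> ?S ..
  have "\<exists>k\<in>F. \<forall>m\<in>carrier ?S. c \<odot>\<^bsub>?S\<^esub> m = k \<odot>\<^bsub>?S\<^esub> m"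
  proof (rule res.central_scalar[OF _ _ assms(1)])
    show "L = {\<zero>\<^bsub>?S\<^esub>} \<or> L = carrier ?S" if "stable ?S (carrier A) L" for L
      using S_simple[of L] that stable_restrict_iff[OF S_stable] by simp
    show "carrier ?S \<noteq> {\<zero>\<^bsub>?S\<^esub>}" using S_nonzero by simp
    fix m assume "m \<in> carrier ?S"
    then have m: "m \<in> S" by simp
    then have "\<theta> \<bullet> c \<bullet> m \<boxminus> c \<bullet> \<theta> \<bullet> m = \<zero>\<zero>"
      using assms delta_act[OF assms(1), of m] unfolding I_def by simp
    then have "\<theta> \<bullet> c \<bullet> m = c \<bullet> \<theta> \<bullet> m"
      using diff_eq_zero_iff[of "\<theta> \<bullet> c \<bullet> m" "c \<bullet> \<theta> \<bullet> m"] assms(1) m by simp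
    then show "\<theta> \<odot>\<^bsub>?S\<^esub> (c \<odot>\<^bsub>?S\<^esub> m) = c \<odot>\<^bsub>?S\<^esub> (\<theta> \<odot>\<^bsub>?S\<^esub> m)" by simp
  qed
  then obtain k where k: "k \<in> F" "\<And>m. m \<in> S \<Longrightarrow> c \<bullet> m = k \<bullet> m" by auto
  then have "c \<ominus> k \<in> I"
    unfolding I_def using assms(1) by (simp add: smult_l_diff diff_eq_zero_iff)
  then show ?thesis using k by blast
qed

text \<open>Modulo \<open>I\<close>, \<open>b\<close> is polynomial in a slice; \<open>k\<close> is its coefficient of degree \<open>n\<close>, up to \<open>n!\<close>.\<close>

definition has_lc :: "nat \<Rightarrow> 'a \<Rightarrow> 'a \<Rightarrow> bool"
  where "has_lc n b k \<longleftrightarrow> b \<in> B \<and> k \<in> F \<and> (\<delta> ^^ n) b \<ominus> k \<in> I"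

lemma has_lcD: "has_lc n b k \<Longrightarrow> b \<in> B \<and> k \<in> F \<and> (\<delta> ^^ n) b \<ominus> k \<in> I"
  unfolding has_lc_def .

lemma delta_pow_add: "\<lbrakk>a \<in> B; b \<in> B\<rbrakk> \<Longrightarrow> (\<delta> ^^ n) (a \<oplus> b) = (\<delta> ^^ n) a \<oplus> (\<delta> ^^ n) b"
  by (induction n) (simp_all add: delta_add)

lemma delta_pow_F_mult: "\<lbrakk>k \<in> F; b \<in> B\<rbrakk> \<Longrightarrow> (\<delta> ^^ n) (k \<otimes> b) = k \<otimes> (\<delta> ^^ n) b"
  by (induction n) (simp_all add: delta_F_mult)

lemma has_lc_add:
  assumes "has_lc n a k" "has_lc n b l"
  shows "has_lc n (a \<oplus> b) (k \<oplus> l)"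
proof -
  note ab = has_lcD[OF assms(1)] has_lcD[OF assms(2)]
  have "((\<delta> ^^ n) a \<ominus> k) \<oplus> ((\<delta> ^^ n) b \<ominus> l) = (\<delta> ^^ n) (a \<oplus> b) \<ominus> (k \<oplus> l)"
    using ab by (simp add: delta_pow_add A.minus_eq A.minus_add A.a_ac)
  then show ?thesis using ab I_add[of "(\<delta> ^^ n) a \<ominus> k" "(\<delta> ^^ n) b \<ominus> l"] unfolding has_lc_def by simp
qed

lemma has_lc_F_mult:
  assumes "k \<in> F" "has_lc n b l"
  shows "has_lc n (k \<otimes> b) (k \<otimes> l)"
proof -
  note b = has_lcD[OF assms(2)]
  have "k \<otimes> ((\<delta> ^^ n) b \<ominus> l) = (\<delta> ^^ n) (k \<otimes> b) \<ominus> k \<otimes> l"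
    using b assms(1) by (simp add: delta_pow_F_mult A.minus_eq A.r_distr A.r_minus)
  then show ?thesis using b assms(1) I_mult[of k "(\<delta> ^^ n) b \<ominus> l"] unfolding has_lc_def by simp
qed

lemma has_lc_I: "b \<in> I \<Longrightarrow> has_lc n b \<zero>"
  unfolding has_lc_def using delta_pow_I by (simp add: A.minus_eq)

lemma has_lc_zero: "has_lc n b \<zero> \<longleftrightarrow> b \<in> B \<and> (\<delta> ^^ n) b \<in> I"
  unfolding has_lc_def by (auto simp: A.minus_eq)

lemma has_lc_delta: "has_lc (Suc n) b k \<Longrightarrow> has_lc n (\<delta> b) k"
  unfolding has_lc_def by (simp add: funpow_swap1)

lemma has_lc_mult_0:
  assumes "has_lc 0 a k" "has_lc n b l"
  shows "has_lc n (a \<otimes> b) (k \<otimes> l)"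
proof -
  note ab = has_lcD[OF assms(1)] has_lcD[OF assms(2)]
  have "b \<otimes> (a \<ominus> k) \<in> I" using ab by simp
  moreover have "b \<otimes> (a \<ominus> k) = (a \<ominus> k) \<otimes> b" using ab by (intro B_comm) auto
  ultimately have "has_lc n ((a \<ominus> k) \<otimes> b) \<zero>" using has_lc_I by simp
  then have "has_lc n ((a \<ominus> k) \<otimes> b \<oplus> k \<otimes> b) (\<zero> \<oplus> k \<otimes> l)"
    using has_lc_F_mult[of k n b l] has_lc_add assms ab by blast
  moreover have "(a \<ominus> k) \<otimes> b \<oplus> k \<otimes> b = a \<otimes> b"
    using ab by (simp add: A.minus_eq A.l_distr A.l_minus A.a_assoc A.l_neg)
  ultimately show ?thesis using ab by simp
qed

text \<open>The factor \<open>q\<close> is the binomial coefficient of \<open>m + n\<close> over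
  \<open>m\<close>: the Leibniz rule yields Pascal's recursion \<open>q1 + q2\<close>. Only its
  positivity is recorded, which in characteristic zero makes it nonzero in \<open>F\<close>.\<close>

lemma has_lc_mult:
  assumes "has_lc m a k" "has_lc n b l"
  shows "\<exists>q::nat. q > 0 \<and> has_lc (m + n) (a \<otimes> b) (add_pow A q \<one> \<otimes> (k \<otimes> l))"
  using assms
proof (induction "m + n" arbitrary: m n a b)
  case 0
  then show ?case using has_lc_mult_0[of a k n b l] has_lcD by (intro exI[of _ 1]) auto
next
  case (Suc h)
  note ab = has_lcD[OF Suc.prems(1)] has_lcD[OF Suc.prems(2)]
  show ?case
  proof (cases m)
    case 0
    then show ?thesis using has_lc_mult_0[of a k n b l] Suc.prems ab by (intro exI[of _ 1]) auto
  next
    case m: (Suc m')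
    show ?thesis
    proof (cases n)
      case 0
      then have "has_lc m (b \<otimes> a) (l \<otimes> k)" using has_lc_mult_0[of b l m a k] Suc.prems by simp
      then show ?thesis using 0 ab B_comm[of a b] B_comm[of k l] by (intro exI[of _ 1]) auto
    next
      case n: (Suc n')
      obtain q1 :: nat where q1: "q1 > 0" "has_lc (m' + n) (\<delta> a \<otimes> b) (add_pow A q1 \<one> \<otimes> (k \<otimes> l))"
        using Suc.hyps(1)[of m' n "\<delta> a" b] Suc.hyps(2) Suc.prems m has_lc_delta by auto
      obtain q2 :: nat where q2: "q2 > 0" "has_lc (m + n') (a \<otimes> \<delta> b) (add_pow A q2 \<one> \<otimes> (k \<otimes> l))"
        using Suc.hyps(1)[of m n' a "\<delta> b"] Suc.hyps(2) Suc.prems n has_lc_delta by auto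
      have "has_lc h (\<delta> (a \<otimes> b)) (add_pow A q1 \<one> \<otimes> (k \<otimes> l) \<oplus> add_pow A q2 \<one> \<otimes> (k \<otimes> l))"
        using has_lc_add q1(2) q2(2) Suc.hyps(2) m n ab by (simp add: delta_mult)
      moreover have "add_pow A q1 \<one> \<otimes> (k \<otimes> l) \<oplus> add_pow A q2 \<one> \<otimes> (k \<otimes> l)
          = add_pow A (q1 + q2) \<one> \<otimes> (k \<otimes> l)"
        using ab by (simp add: A.add.nat_pow_mult[symmetric] A.l_distr)
      ultimately have "has_lc (Suc h) (a \<otimes> b) (add_pow A (q1 + q2) \<one> \<otimes> (k \<otimes> l))"
        using ab unfolding has_lc_def by (simp add: funpow_swap1)
      then show ?thesis using q1(1) Suc.hyps(2) by (intro exI[of _ "q1 + q2"]) simp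
    qed
  qed
qed

lemma F_mult_nonzero: "\<lbrakk>k \<in> F; l \<in> F; k \<noteq> \<zero>; l \<noteq> \<zero>\<rbrakk> \<Longrightarrow> k \<otimes> l \<noteq> \<zero>"
  using subfieldE(5)[OF F_subfield] by blast

lemma has_lc_mult_nonzero:
  assumes "has_lc m a k" "k \<noteq> \<zero>" "has_lc n b l" "l \<noteq> \<zero>"
  obtains e where "e \<noteq> \<zero>" "has_lc (m + n) (a \<otimes> b) e"
proof -
  note ab = has_lcD[OF assms(1)] has_lcD[OF assms(3)]
  obtain q :: nat where q: "q > 0" "has_lc (m + n) (a \<otimes> b) (add_pow A q \<one> \<otimes> (k \<otimes> l))"
    using has_lc_mult[OF assms(1,3)] by blast
  have "add_pow A q \<one> \<otimes> (k \<otimes> l) \<noteq> \<zero>"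
    by (intro F_mult_nonzero) (use ab assms F_char_zero[OF q(1)] in auto)
  then show ?thesis using that q(2) by blast
qed

lemma has_lc_nonzero_notin_I: "\<lbrakk>has_lc n b k; k \<noteq> \<zero>\<rbrakk> \<Longrightarrow> b \<notin> I"
proof
  assume b: "has_lc n b k" "k \<noteq> \<zero>" "b \<in> I"
  note k = has_lcD[OF b(1)]
  have "(\<delta> ^^ n) b \<ominus> ((\<delta> ^^ n) b \<ominus> k) \<in> I" using k delta_pow_I[OF b(3)] by simp
  moreover have "(\<delta> ^^ n) b \<ominus> ((\<delta> ^^ n) b \<ominus> k) = k"
    using k by (simp add: A.minus_eq A.minus_add A.r_neg1 A.r_neg2)
  ultimately show False using F_I k b(2) by simp
qed

lemma lc_exists:
  assumes "b \<in> B" "(\<delta> ^^ Suc n) b \<in> I"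
  shows "\<exists>k. has_lc n b k"
  using scalar_mod_I[of "(\<delta> ^^ n) b"] assms unfolding has_lc_def by auto

text \<open>By local nilpotence there is a last derivative of \<open>b\<close> outside
  \<open>I\<close>. Its own derivative lies in \<open>I\<close>, so it is a constant modulo
  \<open>I\<close>, hence a scalar, and nonzero by the choice of \<open>n\<close>.\<close>

lemma height_exists:
  assumes "b \<in> B" "b \<notin> I"
  shows "\<exists>n k. k \<noteq> \<zero> \<and> has_lc n b k \<and> (\<delta> ^^ Suc n) b \<in> I"
proof -
  define n where "n = (LEAST n. (\<delta> ^^ n) b \<in> I)"
  obtain n0 where "(\<delta> ^^ n0) b = \<zero>" using delta_nilpotent[OF assms(1)] by blast
  then have "(\<delta> ^^ n0) b \<in> I" by simp
  then have n: "(\<delta> ^^ n) b \<in> I" "\<And>m. (\<delta> ^^ m) b \<in> I \<Longrightarrow> n \<le> m"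
    unfolding n_def by (auto intro: LeastI Least_le)
  then obtain m where m: "n = Suc m" using assms(2) by (cases n) auto
  then obtain k where k: "has_lc m b k" using lc_exists[OF assms(1)] n(1) by blast
  have "k \<noteq> \<zero>"
  proof
    assume "k = \<zero>"
    then have "(\<delta> ^^ m) b \<in> I" using k by (simp add: has_lc_zero)
    then show False using n(2)[of m] m by simp
  qed
  then show ?thesis using k n(1) m by blast
qed

text \<open>Both factors have nonzero leading coefficients, and then so has the product; such an
  element is outside \<open>I\<close>.\<close>

lemma I_prime:
  assumes "a \<in> B" "a \<notin> I" "b \<in> B" "b \<notin> I"
  shows "a \<otimes> b \<notin> I"
proof -
  obtain m k where a: "k \<noteq> \<zero>" "has_lc m a k" using height_exists[OF assms(1,2)] by blast
  obtain n l where b: "l \<noteq> \<zero>" "has_lc n b l" using height_exists[OF assms(3,4)] by blast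
  show ?thesis using has_lc_mult_nonzero[OF a(2,1) b(2,1)] has_lc_nonzero_notin_I by metis
qed

text \<open>These are the ideals of \<open>B/I\<close>, written as ideals of \<open>B\<close> above
  \<open>I\<close>. Negatives are covered by multiplication with
  \<open>\<ominus> \<one>\<close>.\<close>

definition b_ideal :: "'a set \<Rightarrow> bool"
  where "b_ideal J \<longleftrightarrow> I \<subseteq> J \<and> J \<subseteq> B \<and> (\<forall>a\<in>J. \<forall>b\<in>J. a \<oplus> b \<in> J) \<and> (\<forall>a\<in>B. \<forall>b\<in>J. a \<otimes> b \<in> J)"

lemma b_ideal_diff: "\<lbrakk>b_ideal J; a \<in> J; b \<in> J\<rbrakk> \<Longrightarrow> a \<ominus> b \<in> J"
proof -
  assume J: "b_ideal J" "a \<in> J" "b \<in> J"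
  then have B: "a \<in> B" "b \<in> B" unfolding b_ideal_def by auto
  have "(\<ominus> \<one>) \<otimes> b \<in> J" using J unfolding b_ideal_def by simp
  then have "a \<oplus> (\<ominus> \<one>) \<otimes> b \<in> J" using J unfolding b_ideal_def by blast
  then show ?thesis using B by (simp add: A.minus_eq A.l_minus)
qed

end

section \<open>The slice and the division algorithm modulo I\<close>

locale diff_essential_slice = diff_essential A F B G \<theta> M S
  for A :: "('a, 'x) ring_scheme" (structure) and F B G \<theta>
    and M :: "('a, 'm, 'c) module_scheme" (structure) and S +
  assumes not_central: "\<exists>b\<in>B. \<delta> b \<notin> I"
begin

text \<open>Differentiating a nonconstant \<open>b\<close> until its next derivative is the last one
  outside \<open>I\<close> gives an element whose derivative is a nonzero scalar modulo
  \<open>I\<close>: the variable \<open>x\<close> of \<open>K[x]\<close>, up to a factor.\<close>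

lemma slice_exists: "\<exists>y k. k \<noteq> \<zero> \<and> has_lc 1 y k"
proof -
  obtain b where b: "b \<in> B" "\<delta> b \<notin> I" using not_central by blast
  obtain n k where nk: "k \<noteq> \<zero>" "has_lc n (\<delta> b) k" using height_exists[OF delta_B[OF b(1)] b(2)] by blast
  then have "has_lc 1 ((\<delta> ^^ n) b) k"
    using b(1) unfolding has_lc_def by (simp add: funpow_swap1)
  then show ?thesis using nk by blast
qed

text \<open>Powers of the slice supply every degree.\<close>

lemma lc_witness: "\<exists>w k. k \<noteq> \<zero> \<and> has_lc n w k"
proof (induction n)
  case 0
  have "has_lc 0 \<one> \<one>" unfolding has_lc_def by (simp add: A.minus_eq A.r_neg)
  then show ?case using one_not_zero by blast
next
  case (Suc n)
  then show ?case using slice_exists has_lc_mult_nonzero[of 1 _ _ n] by (metis plus_1_eq_Suc)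
qed

text \<open>Division with remainder as in \<open>K[x]\<close>: \<open>h\<close> in the smaller ideal
  has the least degree occurring in the larger one, so multiples of \<open>h\<close> cancel leading
  terms of any \<open>b \<in> J\<close> until it lies in \<open>I\<close>.\<close>

lemma b_ideal_eqI:
  assumes J: "b_ideal J" "b_ideal J'" "J' \<subseteq> J"
    and h: "h \<in> J'" "has_lc n h k" "k \<noteq> \<zero>"
    and min: "\<And>b m l. \<lbrakk>b \<in> J; has_lc m b l; l \<noteq> \<zero>\<rbrakk> \<Longrightarrow> n \<le> m"
  shows "J = J'"
proof -
  have JB: "J \<subseteq> B" "J' \<subseteq> B" "I \<subseteq> J'" using J unfolding b_ideal_def by auto
  have "b \<in> J'" if "b \<in> J" "(\<delta> ^^ m) b \<in> I" for m b
    using that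
  proof (induction m arbitrary: b)
    case 0
    then show ?case using JB by auto
  next
    case (Suc m)
    have bB: "b \<in> B" using Suc.prems JB by blast
    obtain l where l: "has_lc m b l" using lc_exists[OF bB Suc.prems(2)] by blast
    show ?case
    proof (cases "l = \<zero>")
      case True
      then show ?thesis using Suc.IH[OF Suc.prems(1)] l by (simp add: has_lc_zero)
    next
      case False
      then have nm: "n \<le> m" using min Suc.prems(1) l by blast
      obtain w k' where w: "k' \<noteq> \<zero>" "has_lc (m - n) w k'" using lc_witness by blast
      obtain e where e: "e \<noteq> \<zero>" "has_lc m (w \<otimes> h) e"
        using has_lc_mult_nonzero[OF w(2,1) h(2,3)] nm by auto
      have eF: "e \<in> F" and lF: "l \<in> F" and wB: "w \<in> B" using has_lcD e l w by blast+
      obtain e' where e': "e' \<in> F" "e' \<otimes> e = \<one>" using F_inverse[OF eF e(1)] by metis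
      \<comment> \<open>The witness \<open>w\<close> raises \<open>h\<close> to degree
        \<open>m\<close>, and \<open>l \<otimes> e'\<close> rescales the leading coefficient
        \<open>e\<close> of \<open>w \<otimes> h\<close> to that of \<open>b\<close>.\<close>
      define x where "x = (l \<otimes> e') \<otimes> (w \<otimes> h)"
      have xJ': "x \<in> J'" unfolding x_def
        using J(2) h(1) wB lF e' unfolding b_ideal_def by simp
      have xB: "x \<in> B" using xJ' JB by blast
      have "has_lc m x ((l \<otimes> e') \<otimes> e)" unfolding x_def by (rule has_lc_F_mult) (use lF e' e in auto)
      then have "has_lc m x l" using lF e' eF by (simp add: A.m_assoc)
      then have "has_lc m ((\<ominus> \<one>) \<otimes> x) ((\<ominus> \<one>) \<otimes> l)" by (intro has_lc_F_mult) auto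
      then have "has_lc m (b \<oplus> (\<ominus> \<one>) \<otimes> x) (l \<oplus> (\<ominus> \<one>) \<otimes> l)" using has_lc_add l by blast
      then have "has_lc m (b \<ominus> x) \<zero>" using xB bB lF by (simp add: A.l_minus A.minus_eq A.r_neg)
      then have "b \<ominus> x \<in> J'"
        using Suc.IH[of "b \<ominus> x"] b_ideal_diff[OF J(1) Suc.prems(1)] xJ' J(3) by (auto simp: has_lc_zero)
      then have "(b \<ominus> x) \<oplus> x \<in> J'" using J(2) xJ' unfolding b_ideal_def by blast
      then show ?thesis using bB xB by (simp add: A.minus_eq A.a_assoc A.l_neg)
    qed
  qed
  moreover have "\<exists>m. (\<delta> ^^ m) b \<in> I" if "b \<in> J" for b
    using delta_nilpotent[of b] that JB by (metis I_zero subsetD)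
  ultimately show ?thesis using J(3) by blast
qed

text \<open>The least degree \<open>\<nu> i\<close> in \<open>J i\<close> grows along the chain but
  is bounded by the degree of \<open>r\<close>. Once it has reached its maximum, the division
  argument makes the ideals equal.\<close>

lemma b_ideal_dcc:
  assumes "\<And>i. b_ideal (J i)" "\<And>i. J (Suc i) \<subseteq> J i" "\<And>i. r \<in> J i" "r \<notin> I"
  shows "\<exists>k. \<forall>i\<ge>k. J i = J k"
proof -
  define P where "P = (\<lambda>i n. \<exists>b\<in>J i. \<exists>l. l \<noteq> \<zero> \<and> has_lc n b l)"
  define \<nu> where "\<nu> = (\<lambda>i. LEAST n. P i n)"
  have "r \<in> B" using assms(1,3) unfolding b_ideal_def by blast
  then obtain n0 where n0: "P i n0" for i
    using height_exists[OF _ assms(4)] assms(3) unfolding P_def by blast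
  have P\<nu>: "P i (\<nu> i)" for i unfolding \<nu>_def using n0 by (rule LeastI)
  have le: "\<nu> i \<le> n" if "P i n" for i n unfolding \<nu>_def using that by (rule Least_le)
  have sub: "J j \<subseteq> J i" if "i \<le> j" for i j by (rule chain_antimono[of J, OF assms(2) that])
  have mono: "\<nu> i \<le> \<nu> j" if "i \<le> j" for i j
    using le[of i "\<nu> j"] P\<nu>[of j] sub[OF that] unfolding P_def by blast
  have bound: "\<nu> i \<le> n0" for i using le n0 by blast
  obtain k where k: "\<And>i. \<nu> i \<le> \<nu> k"
  proof -
    have fin: "finite (range \<nu>)" using bound by (meson finite_atMost finite_subset image_subsetI atMost_iff)
    then have "Max (range \<nu>) \<in> range \<nu>" by (intro Max_in) auto
    then obtain k where "\<nu> k = Max (range \<nu>)" by (metis imageE)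
    then show ?thesis using that[of k] Max_ge[OF fin] by simp
  qed
  have "J k = J i" if "k \<le> i" for i
  proof -
    obtain h l where h: "h \<in> J i" "has_lc (\<nu> i) h l" "l \<noteq> \<zero>" using P\<nu>[of i] unfolding P_def by blast
    show ?thesis
    proof (rule b_ideal_eqI[OF assms(1) assms(1) sub[OF that] h])
      fix b m l assume "b \<in> J k" "has_lc m b l" "l \<noteq> \<zero>"
      then have "\<nu> k \<le> m" using le[of k m] unfolding P_def by blast
      then show "\<nu> i \<le> m" using k[of i] by simp
    qed
  qed
  then show ?thesis by metis
qed

section \<open>Descending chains between S and a cyclic submodule\<close>

context
  fixes v assumes v: "v \<in> carrier M" "v \<noteq> \<zero>\<zero>" and Iv: "\<And>b m. \<lbrakk>b \<in> I; m \<in> cyclic v\<rbrakk> \<Longrightarrow> b \<bullet> m = \<zero>\<zero>"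
begin

lemma Bv_stable: "stable M B {b \<bullet> v |b. b \<in> B}"
proof (rule stableI_diff)
  show "\<zero>\<zero> \<in> {b \<bullet> v |b. b \<in> B}" using v by (auto intro!: exI[of _ \<zero>])
  show "x \<boxminus> y \<in> {b \<bullet> v |b. b \<in> B}" if xy: "x \<in> {b \<bullet> v |b. b \<in> B}" "y \<in> {b \<bullet> v |b. b \<in> B}" for x y
  proof -
    obtain a b where "a \<in> B" "b \<in> B" "x = a \<bullet> v" "y = b \<bullet> v" using xy by blast
    then show ?thesis using v by (auto intro!: exI[of _ "a \<ominus> b"] simp: smult_l_diff)
  qed
  show "a \<bullet> y \<in> {b \<bullet> v |b. b \<in> B}" if ay: "a \<in> B" "y \<in> {b \<bullet> v |b. b \<in> B}" for a y
  proof -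
    obtain b where "b \<in> B" "y = b \<bullet> v" using ay by blast
    then show ?thesis using v ay(1) by (auto intro!: exI[of _ "a \<otimes> b"] simp: smult_assoc1)
  qed
qed (use v in auto)

interpretation ore: ore_step A M B \<theta> "{b \<bullet> v |b. b \<in> B}"
  by (rule ore_step_theta[OF Bv_stable])

lemma span_cyclic: "ore.span = cyclic v"
proof
  have "v \<in> {b \<bullet> v |b. b \<in> B}" using v by (auto intro!: exI[of _ \<one>])
  then show "cyclic v \<subseteq> ore.span"
    using cyclic_least[OF stable_A[OF ore.span_stable]] ore.N0_subset_span by blast
  have "insert \<theta> B \<subseteq> carrier A" by auto
  then show "ore.span \<subseteq> cyclic v"
    by (intro ore.span_least stable_mono[OF cyclic_stable[OF v(1)]]) (auto simp: cyclic_def)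
qed

text \<open>Leading coefficients are vectors \<open>b \<bullet> v\<close>; pulling them back along
  the action on \<open>v\<close> turns them into ideals of \<open>B/I\<close>.\<close>

definition coeff :: "nat \<Rightarrow> 'm set \<Rightarrow> 'a set"
  where "coeff i L = {b \<in> B. b \<bullet> v \<in> ore.lead i L}"

lemma coeff_ideal:
  assumes "stable M B L"
  shows "b_ideal (coeff i L)"
proof -
  note l = ore.lead_stable[OF assms, of i]
  have "I \<subseteq> coeff i L"
    using Iv[OF _ cyclic_self[OF v(1)]] stable_zero[OF l] unfolding coeff_def by auto
  then show ?thesis
    using stable_add[OF l] stable_smult[OF l] v unfolding b_ideal_def coeff_def
    by (auto simp: smult_l_distr smult_assoc1)
qed

lemma coeff_mono: "L \<subseteq> L' \<Longrightarrow> coeff i L \<subseteq> coeff i L'"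
  unfolding coeff_def using ore.lead_mono by blast

lemma coeff_le: "\<lbrakk>stable M (insert \<theta> B) L; i \<le> j\<rbrakk> \<Longrightarrow> coeff i L \<subseteq> coeff j L"
  unfolding coeff_def using ore.lead_le by blast

lemma fil_lead:
  assumes "y \<in> L" "y \<in> ore.fil (Suc i)"
  obtains b l where "b \<in> coeff i L" "l \<in> ore.fil i" "y = ore.xpow i \<bullet> b \<bullet> v \<boxplus> l"
proof -
  obtain n l where nl: "n \<in> {b \<bullet> v |b. b \<in> B}" "l \<in> ore.fil i" "y = ore.xpow i \<bullet> n \<boxplus> l"
    by (rule ore.filE[OF assms(2)])
  obtain b where b: "b \<in> B" "n = b \<bullet> v" using nl(1) by blast
  have [simp]: "l \<in> carrier M" using ore.fil_carrier[OF nl(2)] .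
  have "ore.xpow i \<bullet> n = y \<boxplus> (\<ominus>\<^bsub>M\<^esub> l)" using nl(3) b v by (simp add: M.a_assoc M.r_neg)
  also have "\<dots> \<in> msum L (ore.fil i)"
    by (rule msumI[OF assms(1) stable_minus[OF ore.fil_stable nl(2)]])
  finally have "n \<in> ore.lead i L" unfolding ore.lead_def using nl(1) by simp
  then show ?thesis using that b nl unfolding coeff_def by simp
qed

text \<open>Take a nonzero \<open>s \<in> S\<close> in its lowest filtration step. If its leading
  coefficient \<open>b\<close> were in \<open>I\<close>, the term \<open>b \<bullet> v\<close> would
  vanish and \<open>s\<close> would lie one step lower. The resulting \<open>r\<close> belongs to
  every submodule above \<open>S\<close> and bounds degrees uniformly.\<close>

lemma socle_coeff: "\<exists>i r. r \<in> coeff i S \<and> r \<notin> I"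
proof -
  obtain s where s: "s \<in> S" "s \<noteq> \<zero>\<zero>" using S_elem by blast
  have "cyclic v \<noteq> {\<zero>\<zero>}" using cyclic_self v by blast
  then have "s \<in> ore.span" using S_least[OF cyclic_stable[OF v(1)]] s span_cyclic by blast
  then obtain j0 where "s \<in> ore.fil j0" by (rule ore.spanE)
  then obtain j where j: "s \<in> ore.fil j" "\<And>i. s \<in> ore.fil i \<Longrightarrow> j \<le> i"
    using LeastI[of "\<lambda>j. s \<in> ore.fil j" j0] Least_le[of "\<lambda>j. s \<in> ore.fil j"] by blast
  then obtain i where i: "j = Suc i" using s(2) by (cases j) auto
  obtain b l where bl: "b \<in> coeff i S" "l \<in> ore.fil i" "s = ore.xpow i \<bullet> b \<bullet> v \<boxplus> l"
    using fil_lead[OF s(1)] j(1) i by blast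
  have "b \<notin> I"
  proof
    assume "b \<in> I"
    then have "s = l" using bl(3) Iv cyclic_self[OF v(1)] ore.fil_carrier[OF bl(2)] by simp
    then show False using j(2)[of i] bl(2) i by simp
  qed
  then show ?thesis using bl(1) by blast
qed

text \<open>Multiplication by \<open>p\<close> moves the leading coefficient of \<open>y\<close>
  into that of an element \<open>u\<close> of \<open>L'\<close>, and moving \<open>p\<close> past
  the power of \<open>\<theta>\<close> costs only lower terms. So
  \<open>p \<bullet> y \<boxminus> u\<close> lies in \<open>L\<close> and in \<open>fil i\<close>,
  where \<open>P\<close> takes over.\<close>

lemma torsion_step:
  assumes L: "stable M B L" "stable M B L'" "L' \<subseteq> L"
    and p: "p \<in> B" "\<And>b. b \<in> coeff i L \<Longrightarrow> p \<otimes> b \<in> coeff i L'"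
    and P: "P \<in> B" "\<And>y. \<lbrakk>y \<in> L; y \<in> ore.fil i\<rbrakk> \<Longrightarrow> P \<bullet> y \<in> L'"
    and y: "y \<in> L" "y \<in> ore.fil (Suc i)"
  shows "(P \<otimes> p) \<bullet> y \<in> L'"
proof -
  obtain b l where bl: "b \<in> coeff i L" "l \<in> ore.fil i" "y = ore.xpow i \<bullet> b \<bullet> v \<boxplus> l"
    using fil_lead[OF y] by blast
  have bB: "b \<in> B" using bl(1) unfolding coeff_def by simp
  have c [simp]: "l \<in> carrier M" "y \<in> carrier M" "v \<in> carrier M" "b \<in> carrier A" "p \<in> carrier A" "P \<in> carrier A"
    using ore.fil_carrier bl(2) y(2) v bB p(1) P(1) by auto
  have "p \<bullet> b \<bullet> v \<in> ore.lead i L'"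
    using p(2)[OF bl(1)] unfolding coeff_def by (simp add: smult_assoc1)
  then have "ore.xpow i \<bullet> p \<bullet> b \<bullet> v \<in> msum L' (ore.fil i)" using ore.leadD by blast
  then obtain u l' where ul: "u \<in> L'" "l' \<in> ore.fil i" "ore.xpow i \<bullet> p \<bullet> b \<bullet> v = u \<boxplus> l'"
    by (rule msumE)
  have uc [simp]: "u \<in> carrier M" "l' \<in> carrier M" using ul stable_carrier[OF L(2)] ore.fil_carrier by auto
  have bv: "b \<bullet> v \<in> {b \<bullet> v |b. b \<in> B}" using bB by blast
  define e where "e = p \<bullet> ore.xpow i \<bullet> b \<bullet> v \<boxminus> ore.xpow i \<bullet> p \<bullet> b \<bullet> v"
  have e: "e \<in> ore.fil i" unfolding e_def by (rule ore.commute_pow[OF p(1) bv])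
  have [simp]: "e \<in> carrier M" using ore.fil_carrier[OF e] .
  have "p \<bullet> ore.xpow i \<bullet> b \<bullet> v = e \<boxplus> (u \<boxplus> l')" unfolding e_def ul(3)[symmetric] by simp
  then have py: "p \<bullet> y = (e \<boxplus> (l' \<boxplus> p \<bullet> l)) \<boxplus> u"
    unfolding bl(3) by (simp add: smult_r_distr M.a_ac)
  have "e \<boxplus> (l' \<boxplus> p \<bullet> l) \<in> ore.fil i"
    by (intro stable_add[OF ore.fil_stable] e ul(2) stable_smult[OF ore.fil_stable p(1) bl(2)])
  moreover have "p \<bullet> y \<boxminus> u = e \<boxplus> (l' \<boxplus> p \<bullet> l)" unfolding py by simp
  moreover have "p \<bullet> y \<boxminus> u \<in> L"
    using stable_diff[OF L(1) stable_smult[OF L(1) p(1) y(1)]] ul(1) L(3) by blast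
  ultimately have "P \<bullet> (p \<bullet> y \<boxminus> u) \<in> L'" using P(2) by simp
  then have "P \<bullet> p \<bullet> y \<boxminus> P \<bullet> u \<in> L'" by (simp add: smult_r_diff)
  then have "P \<bullet> p \<bullet> y \<in> L'"
    by (rule stable_diff_cancel[OF L(2) _ stable_smult[OF L(2) P(1) ul(1)]]) simp
  then show ?thesis by (simp add: smult_assoc1)
qed

lemma equal_of_torsion:
  assumes L: "stable M (carrier A) L" "stable M (carrier A) L'" "L' \<subseteq> L" "L \<subseteq> cyclic v"
    and P: "P \<in> B" "P \<notin> I" "\<And>y. y \<in> L \<Longrightarrow> P \<bullet> y \<in> L'"
  shows "L = L'"
proof -
  define D where "D = {b \<in> B. \<forall>y\<in>L. b \<bullet> y \<in> L'}"
  have c: "y \<in> carrier M" if "y \<in> L" for y using stable_carrier[OF L(1) that] .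
  have "\<delta> b \<in> D" if b: "b \<in> D" for b
  proof -
    have "\<delta> b \<bullet> y \<in> L'" if y: "y \<in> L" for y
    proof -
      have "\<theta> \<bullet> b \<bullet> y \<in> L'" using b y stable_smult[OF L(2) theta_closed] unfolding D_def by blast
      moreover have "b \<bullet> \<theta> \<bullet> y \<in> L'" using b stable_smult[OF L(1) theta_closed y] unfolding D_def by blast
      ultimately show ?thesis
        using delta_act[of b y] b c[OF y] stable_diff[OF L(2)] unfolding D_def by simp
    qed
    then show ?thesis using b unfolding D_def by simp
  qed
  then have pow: "(\<delta> ^^ n) P \<in> D" for n using P by (induction n) (auto simp: D_def)
  obtain n k where k: "k \<noteq> \<zero>" "has_lc n P k" using height_exists[OF P(1,2)] by blast
  obtain k' where k': "k' \<in> F" "k' \<otimes> k = \<one>" using F_inverse[of k] has_lcD[OF k(2)] k(1) by metis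
  have "y \<in> L'" if y: "y \<in> L" for y
  proof -
    \<comment> \<open>\<open>I\<close> kills the whole cyclic module, so a congruence modulo
      \<open>I\<close> becomes an equality of operators: this derivative of \<open>P\<close> acts as
      the scalar \<open>k\<close>.\<close>
    have "((\<delta> ^^ n) P \<ominus> k) \<bullet> y = \<zero>\<zero>" using Iv has_lcD[OF k(2)] y L(4) by blast
    then have "k \<bullet> y = (\<delta> ^^ n) P \<bullet> y"
      using smult_l_diff[of "(\<delta> ^^ n) P" k y] diff_eq_zero_iff[of "(\<delta> ^^ n) P \<bullet> y" "k \<bullet> y"]
        has_lcD[OF k(2)] c[OF y] by simp
    then have "k \<bullet> y \<in> L'" using pow[of n] y unfolding D_def by simp
    then have "k' \<bullet> k \<bullet> y \<in> L'" using stable_smult[OF L(2), of k'] k' by simp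
    then show ?thesis using k' has_lcD[OF k(2)] c[OF y] by (simp add: smult_assoc1[symmetric])
  qed
  then show ?thesis using L(3) by blast
qed

text \<open>In degrees below \<open>i0\<close> the coefficient ideals need not contain
  \<open>r\<close>, so the chain condition above a fixed ideal cannot be applied to each of them.
  There one only waits until it is settled whether the ideal is \<open>I\<close>; while it is
  larger, any of its elements outside \<open>I\<close> serves as the factor
  \<open>p\<close>.\<close>

theorem dcc_cyclic: "dcc_family (interval S (cyclic v))"
  unfolding dcc_family_def
proof (intro allI impI)
  fix L :: "nat \<Rightarrow> 'm set"
  assume "\<forall>j. L j \<in> interval S (cyclic v) \<and> L (Suc j) \<subseteq> L j"
  then have L: "stable M (carrier A) (L j)" "S \<subseteq> L j" "L j \<subseteq> cyclic v" "L (Suc j) \<subseteq> L j" for j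
    by simp_all
  have LB: "stable M B (L j)" and L\<theta>: "stable M (insert \<theta> B) (L j)" for j
    by (rule stable_mono[OF L(1)], auto)+
  have anti: "L j \<subseteq> L i" if "i \<le> j" for i j by (rule chain_antimono[of L, OF L(4) that])
  obtain i0 r where r: "r \<in> coeff i0 S" "r \<notin> I" using socle_coeff by blast
  have rL: "r \<in> coeff i (L j)" if "i0 \<le> i" for i j
    using r(1) coeff_mono[OF L(2)] coeff_le[OF L\<theta> that] by blast
  have IC: "I \<subseteq> coeff i (L j)" for i j using coeff_ideal[OF LB] unfolding b_ideal_def by blast
  \<comment> \<open>The union over all degrees contains \<open>r\<close> for every \<open>j\<close>,
    so its chain stabilises by \<open>b_ideal_dcc\<close>.\<close>
  define J where "J = (\<lambda>j. \<Union>i. coeff i (L j))"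
  have J_ideal: "b_ideal (J j)" for j
    unfolding b_ideal_def
  proof (intro conjI ballI)
    show "I \<subseteq> J j" using IC unfolding J_def by blast
    show "J j \<subseteq> B" unfolding J_def coeff_def by blast
    fix a b assume b: "b \<in> J j"
    then obtain i2 where i2: "b \<in> coeff i2 (L j)" unfolding J_def by blast
    show "a \<otimes> b \<in> J j" if "a \<in> B"
      using coeff_ideal[OF LB, of i2 j] i2 that unfolding b_ideal_def J_def by blast
    show "a \<oplus> b \<in> J j" if a: "a \<in> J j"
    proof -
      obtain i1 where "a \<in> coeff i1 (L j)" using a unfolding J_def by blast
      then have "a \<in> coeff (max i1 i2) (L j)" "b \<in> coeff (max i1 i2) (L j)"
        using coeff_le[OF L\<theta>, of i1 "max i1 i2"] coeff_le[OF L\<theta>, of i2 "max i1 i2"] i2 by auto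
      then show ?thesis using coeff_ideal[OF LB, of "max i1 i2" j] unfolding b_ideal_def J_def by blast
    qed
  qed
  have "\<exists>k. \<forall>j\<ge>k. J j = J k"
  proof (rule b_ideal_dcc[OF J_ideal _ _ r(2)])
    show "J (Suc j) \<subseteq> J j" for j unfolding J_def using coeff_mono[OF L(4)] by blast
    show "r \<in> J j" for j unfolding J_def using rL[of i0] by blast
  qed
  then obtain k1 where k1: "\<And>j. j \<ge> k1 \<Longrightarrow> J j = J k1" by blast
  \<comment> \<open>Each ideal contains \<open>I\<close> and shrinks with \<open>j\<close>, so once
    it equals \<open>I\<close> it stays so.\<close>
  have "\<exists>m. \<forall>j\<ge>m. coeff i (L j) = I \<longleftrightarrow> coeff i (L m) = I" for i
  proof (cases "\<exists>m. coeff i (L m) = I")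
    case True
    then obtain m where "coeff i (L m) = I" by blast
    moreover have "coeff i (L j) = I" if "m \<le> j" for j
      using coeff_mono[OF anti[OF that], of i] IC[of i j] \<open>coeff i (L m) = I\<close> by simp
    ultimately show ?thesis by metis
  qed blast
  then obtain m where m: "\<And>i j. j \<ge> m i \<Longrightarrow> coeff i (L j) = I \<longleftrightarrow> coeff i (L (m i)) = I" by metis
  \<comment> \<open>Degrees up to \<open>i0\<close> suffice: from \<open>i0\<close> on the ideals
    contain \<open>r\<close> and are never \<open>I\<close>.\<close>
  define k where "k = Max (insert k1 (m ` {..i0}))"
  have k: "k1 \<le> k" "\<And>i. i \<le> i0 \<Longrightarrow> m i \<le> k" unfolding k_def by (rule Max_ge; simp)+
  have "L j = L (Suc j)" if j: "j \<ge> k" for j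
  proof -
    have JJ: "J j = J (Suc j)" using k1[of j] k1[of "Suc j"] j k(1) by simp
    obtain gs where gs: "set gs = G" using finite_list[OF G_finite] by blast
    have "acc_family (stable_within B {b \<bullet> v |b. b \<in> B})"
    proof -
      obtain N where N: "v \<in> N" "stable M (F \<union> G) N" "acc_family (stable_within (F \<union> G) N)"
        using acc_generators[OF v(1), of gs] gs G_B by auto
      have "{b \<bullet> v |b. b \<in> B} \<subseteq> N" using stable_smult[OF stable_B[OF N(2)]] N(1) by blast
      moreover have "stable M (F \<union> G) U" if "stable M B U" for U
        by (rule stable_mono[OF that]) (use F_B G_B in auto)
      ultimately show ?thesis by (intro acc_family_subset[OF N(3)]) auto
    qed
    \<comment> \<open>The bound \<open>i1\<close> may depend on \<open>j\<close>, as each equality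
      \<open>L j = L (Suc j)\<close> is proved on its own.\<close>
    then obtain i1 where i1: "\<And>i. i \<ge> i1 \<Longrightarrow> ore.lead i (L (Suc j)) = ore.lead i1 (L (Suc j))"
      using ore.lead_stabilises[OF _ L\<theta>] by blast
    have J1: "J (Suc j) = coeff i1 (L (Suc j))"
    proof
      show "J (Suc j) \<subseteq> coeff i1 (L (Suc j))"
      proof
        fix b assume "b \<in> J (Suc j)"
        then obtain i where "b \<in> coeff i (L (Suc j))" unfolding J_def by blast
        then have "b \<in> coeff (max i i1) (L (Suc j))" using coeff_le[OF L\<theta>, of i "max i i1"] by auto
        then show "b \<in> coeff i1 (L (Suc j))" using i1[of "max i i1"] unfolding coeff_def by simp
      qed
    qed (auto simp: J_def)
    have large: "coeff i (L j) \<subseteq> coeff i (L (Suc j))" if "i1 \<le> i" for i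
    proof -
      have "coeff i (L j) \<subseteq> J j" unfolding J_def by (rule UN_upper) simp
      also have "\<dots> = coeff i1 (L (Suc j))" unfolding JJ J1 ..
      also have "\<dots> \<subseteq> coeff i (L (Suc j))" by (rule coeff_le[OF L\<theta> that])
      finally show ?thesis .
    qed
    \<comment> \<open>If the smaller ideal is \<open>I\<close>, then \<open>i\<close> is below
      \<open>i0\<close> and the choice of \<open>k\<close> makes the larger one \<open>I\<close>
      too, so \<open>p = \<one>\<close> works. Otherwise the ideal property absorbs the product with
      any \<open>p\<close> in it.\<close>
    have small: "\<exists>p\<in>B. p \<notin> I \<and> (\<forall>b\<in>coeff i (L j). p \<otimes> b \<in> coeff i (L (Suc j)))" for i
    proof (cases "coeff i (L (Suc j)) = I")
      case True
      then have "i < i0" using rL[of i "Suc j"] r(2) by (cases "i0 \<le> i") auto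
      then have "coeff i (L j) = I"
        using m[of i j] m[of i "Suc j"] k(2)[of i] j True by simp
      moreover have "\<one> \<notin> I" using F_I[of \<one>] one_not_zero by auto
      ultimately show ?thesis using True by (intro bexI[of _ \<one>]) auto
    next
      case False
      then obtain p where p: "p \<in> coeff i (L (Suc j))" "p \<notin> I" using IC by blast
      have pB: "p \<in> B" using p(1) unfolding coeff_def by simp
      have "p \<otimes> b \<in> coeff i (L (Suc j))" if b: "b \<in> coeff i (L j)" for b
      proof -
        have "b \<in> B" using b unfolding coeff_def by simp
        then show ?thesis
          using coeff_ideal[OF LB, of i "Suc j"] p(1) B_comm[OF pB, of b] unfolding b_ideal_def by auto
      qed
      then show ?thesis using p(2) pB by blast
    qed
    have "\<exists>P\<in>B. P \<notin> I \<and> (\<forall>y\<in>L j. y \<in> ore.fil i \<longrightarrow> P \<bullet> y \<in> L (Suc j))" for i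
    proof (induction i)
      case 0
      have "\<one> \<notin> I" using F_I[of \<one>] one_not_zero by auto
      then show ?case using stable_zero[OF LB] by (intro bexI[of _ \<one>]) auto
    next
      case (Suc i)
      then obtain P where P: "P \<in> B" "P \<notin> I" "\<And>y. \<lbrakk>y \<in> L j; y \<in> ore.fil i\<rbrakk> \<Longrightarrow> P \<bullet> y \<in> L (Suc j)" by blast
      obtain p where p: "p \<in> B" "p \<notin> I" "\<And>b. b \<in> coeff i (L j) \<Longrightarrow> p \<otimes> b \<in> coeff i (L (Suc j))"
        using small by blast
      show ?case
        using torsion_step[OF LB LB L(4) p(1,3) P(1,3)] I_prime[OF P(1,2) p(1,2)] P(1) p(1)
        by (intro bexI[of _ "P \<otimes> p"]) auto
    qed
    then obtain P where P: "P \<in> B" "P \<notin> I" "\<And>y. \<lbrakk>y \<in> L j; y \<in> ore.fil i1\<rbrakk> \<Longrightarrow> P \<bullet> y \<in> L (Suc j)" by blast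
    \<comment> \<open>From degree \<open>i1\<close> on, \<open>L j\<close> and
      \<open>L (Suc j)\<close> have the same leading coefficients, so \<open>p = \<one>\<close> and
      \<open>P\<close> acquires no further factors: finitely many steps determine it for all
      degrees.\<close>
    have P_all: "P \<bullet> y \<in> L (Suc j)" if "y \<in> L j" "y \<in> ore.fil (i1 + d)" for y d
      using that
    proof (induction d arbitrary: y)
      case 0
      then show ?case using P(3) by simp
    next
      case (Suc d)
      have "(P \<otimes> \<one>) \<bullet> y \<in> L (Suc j)"
      proof (rule torsion_step[OF LB LB L(4) _ _ P(1) Suc.IH Suc.prems(1)])
        show "y \<in> ore.fil (Suc (i1 + d))" using Suc.prems by simp
        show "\<one> \<otimes> b \<in> coeff (i1 + d) (L (Suc j))" if "b \<in> coeff (i1 + d) (L j)" for b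
          using large[of "i1 + d"] that by (auto simp: coeff_def)
      qed simp_all
      then show ?case using P(1) by simp
    qed
    show "L j = L (Suc j)"
    proof (rule equal_of_torsion[OF L(1) L(1) L(4) L(3) P(1,2)])
      fix y assume y: "y \<in> L j"
      then obtain i where "y \<in> ore.fil i" using L(3) span_cyclic ore.spanE by blast
      then have "y \<in> ore.fil (i1 + i)" using ore.fil_mono[of i "i1 + i"] by auto
      then show "P \<bullet> y \<in> L (Suc j)" by (rule P_all[OF y])
    qed
  qed
  then have step: "L (Suc j) = L j" if "k \<le> j" for j using that by metis
  have "L j = L k" if "k \<le> j" for j
    using that by (induction j rule: dec_induct) (simp_all add: step)
  then show "\<exists>k. \<forall>i\<ge>k. L i = L k" by blast
qed

end

end

section \<open>The descending chain condition for finitely generated essential extensions\<close>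

context diff_essential
begin

lemma acc_left_ideals: "acc_family {J. stable (regular_module A) (carrier A) J}"
proof -
  interpret reg: left_module A "regular_module A" by (rule A.regular_left_module)
  interpret reg: fg_diff_module A F B G \<theta> "regular_module A" ..
  have "reg.cyclic \<one> = carrier A" unfolding reg.cyclic_def by force
  then have "{J. stable (regular_module A) (carrier A) J} \<subseteq> reg.stable_within (carrier A) (reg.cyclic \<one>)"
    using reg.stable_subset by auto
  then show ?thesis using reg.acc_cyclic[of \<one>] acc_family_subset by auto
qed

lemma dcc_S: "dcc_family (stable_within (carrier A) S)"
  unfolding dcc_family_def
proof (intro allI impI)
  fix N :: "nat \<Rightarrow> 'm set" assume N: "\<forall>i. N i \<in> stable_within (carrier A) S \<and> N (Suc i) \<subseteq> N i"
  have st: "stable M (carrier A) (N i)" "N i \<subseteq> S" for i using N[rule_format, of i] by simp_all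
  have cases: "N i = {\<zero>\<zero>} \<or> N i = S" for i by (rule S_simple[OF st])
  have Z: "\<zero>\<zero> \<in> N i" for i by (rule stable_zero[OF st(1)])
  show "\<exists>k. \<forall>i\<ge>k. N i = N k"
  proof (cases "\<exists>k. N k = {\<zero>\<zero>}")
    case True
    then obtain k where k: "N k = {\<zero>\<zero>}" by blast
    have "N i = N k" if "k \<le> i" for i using chain_antimono[of N k i] N that Z[of i] k by auto
    then show ?thesis by blast
  next
    case False
    then have "N i = S" for i using cases[of i] by blast
    then show ?thesis by simp
  qed
qed

section \<open>Reduced extensions: every operator central on N that kills S kills N\<close>

context
  fixes N
  assumes N: "stable M (carrier A) N" "S \<subseteq> N" "acc_family (stable_within (carrier A) N)"
    and reduced: "\<And>z. \<lbrakk>central_on z N; z \<in> annihilator S\<rbrakk> \<Longrightarrow> z \<in> annihilator N"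
begin

text \<open>Let \<open>j\<close> be the last derivative of \<open>i\<close> that does not kill
  \<open>N\<close>. Since \<open>\<delta> j\<close> kills \<open>N\<close>, the operator
  \<open>j\<close> commutes with \<open>\<theta>\<close> on \<open>N\<close>, so it is central
  there; it also kills \<open>S\<close>, and reducedness contradicts its choice.\<close>

lemma I_kills_N:
  assumes "i \<in> I" "n \<in> N"
  shows "i \<bullet> n = \<zero>\<zero>"
proof (rule ccontr)
  assume not: "i \<bullet> n \<noteq> \<zero>\<zero>"
  define p where "p = (LEAST p. (\<delta> ^^ p) i \<in> annihilator N)"
  obtain p0 where "(\<delta> ^^ p0) i = \<zero>" using delta_nilpotent[OF I_B[OF assms(1)]] by blast
  then have "(\<delta> ^^ p0) i \<in> annihilator N" using stable_carrier[OF N(1)] unfolding annihilator_def by simp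
  then have p: "(\<delta> ^^ p) i \<in> annihilator N" "\<And>q. (\<delta> ^^ q) i \<in> annihilator N \<Longrightarrow> p \<le> q"
    unfolding p_def by (auto intro: LeastI Least_le)
  have "i \<notin> annihilator N" using not assms unfolding annihilator_def by blast
  then obtain q where q: "p = Suc q" using p(1) by (cases p) auto
  define j where "j = (\<delta> ^^ q) i"
  have j: "j \<in> I" "j \<in> B" "\<delta> j \<in> annihilator N" "j \<notin> annihilator N"
    unfolding j_def using delta_pow_I[OF assms(1)] p q by (auto dest: p(2))
  have "\<theta> \<bullet> j \<bullet> m = j \<bullet> \<theta> \<bullet> m" if m: "m \<in> N" for m
  proof -
    have mc: "m \<in> carrier M" using stable_carrier[OF N(1) m] .
    then have "\<theta> \<bullet> j \<bullet> m \<boxminus> j \<bullet> \<theta> \<bullet> m = \<zero>\<zero>"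
      using delta_act[OF j(2) mc] j(3) m unfolding annihilator_def by simp
    then show ?thesis
      using diff_eq_zero_iff[of "\<theta> \<bullet> j \<bullet> m" "j \<bullet> \<theta> \<bullet> m"] j(2) mc by simp
  qed
  then have "central_on j N" by (rule central_onI[OF N(1) j(2)])
  moreover have "j \<in> annihilator S" using j(1) unfolding annihilator_def I_def by auto
  ultimately show False using reduced j(4) by blast
qed

text \<open>All operators commute on \<open>N\<close>, so reducedness applies to each of them. Some
  \<open>a\<close> sends \<open>n\<close> to a nonzero element of \<open>S\<close>; it cannot kill
  \<open>S\<close>, hence has an inverse \<open>a'\<close> on \<open>S\<close>, and reducedness
  transfers \<open>a' a = 1\<close> from \<open>S\<close> to \<open>N\<close>. So
  \<open>n = a' \<bullet> a \<bullet> n\<close> is in \<open>S\<close>.\<close>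

lemma commutative_case:
  assumes "\<And>b. b \<in> B \<Longrightarrow> \<delta> b \<in> I"
  shows "N = S"
proof -
  note c = stable_carrier[OF N(1)]
  have \<theta>b: "\<theta> \<bullet> b \<bullet> m = b \<bullet> \<theta> \<bullet> m" if "b \<in> B" "m \<in> N" for b m
    using delta_act[OF that(1) c[OF that(2)]] I_kills_N[OF assms[OF that(1)] that(2)] c[OF that(2)] that(1)
      diff_eq_zero_iff[of "\<theta> \<bullet> b \<bullet> m" "b \<bullet> \<theta> \<bullet> m"] by simp
  have Bc: "central_on b N" if "b \<in> B" for b by (rule central_onI[OF N(1) that \<theta>b[OF that]])
  have central: "central_on a N" if a: "a \<in> carrier A" for a
  proof -
    have "carrier A \<subseteq> {x \<in> carrier A. \<forall>m\<in>N. \<theta> \<bullet> x \<bullet> m = x \<bullet> \<theta> \<bullet> m}"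
      by (rule A_generated[OF commutant_subring[OF N(1) theta_closed]]) (use \<theta>b in auto)
    then have "\<theta> \<bullet> a \<bullet> m = a \<bullet> \<theta> \<bullet> m" if "m \<in> N" for m using a that by blast
    moreover have "b \<bullet> a \<bullet> m = a \<bullet> b \<bullet> m" if "b \<in> B" "m \<in> N" for b m
      using Bc[OF that(1)] that(2) a unfolding central_on_def by blast
    ultimately have "insert \<theta> B \<subseteq> {x \<in> carrier A. \<forall>m\<in>N. a \<bullet> x \<bullet> m = x \<bullet> a \<bullet> m}" by auto
    then have "carrier A \<subseteq> {x \<in> carrier A. \<forall>m\<in>N. a \<bullet> x \<bullet> m = x \<bullet> a \<bullet> m}"
      by (rule A_generated[OF commutant_subring[OF N(1) a]])
    then show ?thesis using a unfolding central_on_def by blast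
  qed
  have "n \<in> S" if n: "n \<in> N" "n \<noteq> \<zero>\<zero>" for n
  proof -
    have nc: "n \<in> carrier M" using c n by blast
    have "cyclic n \<noteq> {\<zero>\<zero>}" using cyclic_self[OF nc] n(2) by blast
    then have sub: "S \<subseteq> cyclic n" by (rule S_least[OF cyclic_stable[OF nc]])
    obtain s0 where s0: "s0 \<in> S" "s0 \<noteq> \<zero>\<zero>" using S_elem by blast
    then obtain a where a: "a \<in> carrier A" "s0 = a \<bullet> n" using sub unfolding cyclic_def by blast
    have "a \<notin> annihilator N" using a s0 n unfolding annihilator_def by blast
    then have "a \<notin> annihilator S" using reduced central[OF a(1)] by blast
    then obtain s where s: "s \<in> S" "a \<bullet> s \<noteq> \<zero>\<zero>" using a(1) unfolding annihilator_def by blast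
    have as: "a \<bullet> s \<in> S" by (rule stable_smult[OF S_stable a(1) s(1)])
    have asc: "a \<bullet> s \<in> carrier M" using as by simp
    have "cyclic (a \<bullet> s) \<noteq> {\<zero>\<zero>}" using cyclic_self[OF asc] s(2) by auto
    then have "s \<in> cyclic (a \<bullet> s)" using S_least[OF cyclic_stable[OF asc]] s(1) by blast
    then obtain a' where a': "a' \<in> carrier A" "s = a' \<bullet> a \<bullet> s" unfolding cyclic_def by blast
    \<comment> \<open>By construction \<open>z\<close> kills only the single vector
      \<open>s\<close>; as \<open>z\<close> is central on \<open>N\<close> and \<open>s\<close>
      generates \<open>S\<close>, it kills all of \<open>S\<close>.\<close>
    define z where "z = a' \<otimes> a \<ominus> \<one>"
    have z: "z \<in> carrier A" unfolding z_def using a a' by simp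
    have zm: "z \<bullet> m = a' \<bullet> a \<bullet> m \<boxminus> m" if "m \<in> carrier M" for m
      unfolding z_def using a a' that by (simp add: smult_l_diff smult_assoc1)
    have zs: "z \<bullet> s = \<zero>\<zero>" using zm[of s] a'(2) s(1) diff_eq_zero_iff[of s s] by simp
    have "s \<noteq> \<zero>\<zero>" using s a(1) by auto
    then have "cyclic s \<noteq> {\<zero>\<zero>}" using cyclic_self[of s] s(1) by auto
    then have S_cyc: "S \<subseteq> cyclic s" by (rule S_least[OF cyclic_stable[OF S_carrier[OF s(1)]]])
    have "z \<bullet> u = \<zero>\<zero>" if u: "u \<in> S" for u
    proof -
      have "u \<in> cyclic s" using S_cyc u by blast
      then obtain e where e: "e \<in> carrier A" "u = e \<bullet> s" unfolding cyclic_def by blast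
      have "s \<in> N" using s(1) N(2) by blast
      then have "z \<bullet> u = e \<bullet> z \<bullet> s" using central[OF z] e(1) unfolding central_on_def e(2) by simp
      then show ?thesis using zs e(1) by simp
    qed
    then have "z \<in> annihilator N" using reduced[OF central[OF z]] z unfolding annihilator_def by blast
    then have "a' \<bullet> a \<bullet> n = n"
      using zm[OF nc] n(1) diff_eq_zero_iff[of "a' \<bullet> a \<bullet> n" n] a a' nc unfolding annihilator_def by simp
    then show ?thesis using stable_smult[OF S_stable a'(1) s0(1)] a(2) by simp
  qed
  then show ?thesis using N(2) stable_zero[OF S_stable] by blast
qed

text \<open>A maximal \<open>Y\<close> with the chain condition above \<open>S\<close> absorbs every
  \<open>v\<close>: both \<open>Y\<close> and the cyclic module of \<open>v\<close> contain
  \<open>S\<close>, so the condition extends to their sum.\<close>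

lemma slice_case:
  assumes "\<exists>b\<in>B. \<delta> b \<notin> I"
  shows "dcc_family (interval S N)"
proof -
  interpret slice: diff_essential_slice A F B G \<theta> M S by unfold_locales (rule assms)
  have cyc: "dcc_family (interval S (cyclic v))" if v: "v \<in> N" "v \<noteq> \<zero>\<zero>" for v
  proof (rule slice.dcc_cyclic[OF _ v(2)])
    show "v \<in> carrier M" using stable_carrier[OF N(1) v(1)] .
    show "b \<bullet> m = \<zero>\<zero>" if "b \<in> I" "m \<in> cyclic v" for b m
      using I_kills_N[OF that(1)] cyclic_least[OF N(1) v(1)] that(2) by blast
  qed
  have "interval S S \<subseteq> {S}" by blast
  moreover have "dcc_family {S}" unfolding dcc_family_def by blast
  ultimately have "dcc_family (interval S S)" by (rule dcc_family_subset[rotated])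
  then obtain Y where Y: "Y \<in> stable_within (carrier A) N" "S \<subseteq> Y \<and> dcc_family (interval S Y)"
    and max: "\<And>Z. \<lbrakk>Z \<in> stable_within (carrier A) N; S \<subseteq> Z \<and> dcc_family (interval S Z); Y \<subseteq> Z\<rbrakk> \<Longrightarrow> Z = Y"
    using acc_family_maximal[OF N(3), of S "\<lambda>Y. S \<subseteq> Y \<and> dcc_family (interval S Y)"] S_stable N(2) by auto
  have Yst: "stable M (carrier A) Y" "Y \<subseteq> N" using Y by auto
  have "v \<in> Y" if v: "v \<in> N" for v
  proof (rule ccontr)
    assume vY: "v \<notin> Y"
    then have v0: "v \<noteq> \<zero>\<zero>" using stable_zero[OF Yst(1)] by blast
    have vc: "v \<in> carrier M" using stable_carrier[OF N(1) v] .
    note C = cyclic_stable[OF vc]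
    have "cyclic v \<noteq> {\<zero>\<zero>}" using cyclic_self[OF vc] v0 by blast
    then have SC: "S \<subseteq> cyclic v" by (rule S_least[OF C])
    let ?Z = "msum Y (cyclic v)"
    have Z: "stable M (carrier A) ?Z" by (rule stable_msum_carrier[OF Yst(1) C])
    have YZ: "Y \<subseteq> ?Z" by (rule msum_left[OF Yst(1) C])
    have "dcc_family (interval Y ?Z)"
      by (rule dcc_sum[OF Yst(1) C _ cyc[OF v v0] SC]) (use Y in blast)
    then have "dcc_family (interval S ?Z)"
      using dcc_trans[OF Yst(1) _ YZ Z, of S] Y by blast
    moreover have "?Z \<subseteq> N" by (rule msum_least[OF N(1) Yst(2) cyclic_least[OF N(1) v]])
    ultimately have "?Z = Y" using max[of ?Z] Z Y YZ by blast
    then show False using msum_right[OF Yst(1) C] cyclic_self[OF vc] vY by blast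
  qed
  then show ?thesis using Y Yst(2) by (metis subset_antisym subsetI)
qed

lemma reduced_dcc: "dcc_family (stable_within (carrier A) N)"
proof (cases "\<exists>b\<in>B. \<delta> b \<notin> I")
  case True
  have I0: "stable_within (carrier A) U = interval {\<zero>\<zero>} U" for U
    using stable_zero by blast
  show ?thesis
    unfolding I0 by (rule dcc_trans[OF S_stable _ N(2,1) dcc_S[unfolded I0] slice_case[OF True]])
      (use stable_zero[OF S_stable] in simp)
next
  case False
  then show ?thesis using commutative_case dcc_S by blast
qed

end

theorem dcc_of_acc:
  assumes "stable M (carrier A) N" "S \<subseteq> N" "acc_family (stable_within (carrier A) N)"
  shows "dcc_family (stable_within (carrier A) N)"
proof (rule reduction[OF acc_left_ideals assms])
  fix N' assume N': "stable M (carrier A) N'" "S \<subseteq> N'" "N' \<subseteq> N"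
    and red: "\<And>z. \<lbrakk>central_on z N'; z \<in> annihilator S\<rbrakk> \<Longrightarrow> z \<in> annihilator N'"
  have "acc_family (stable_within (carrier A) N')"
    by (rule acc_family_subset[OF assms(3)]) (use N'(3) in blast)
  then show "dcc_family (stable_within (carrier A) N')" by (rule reduced_dcc[OF N'(1,2) _ red])
qed

end

section \<open>From algebras with a derivation to the internal setting, and the conclusion\<close>

lemma fg_diff_ring_of_algebra:
  fixes K :: "('k, 'b) ring_scheme" and R :: "('k, 'r, 'c) module_scheme"
    and A :: "('a, 'x) ring_scheme"
  assumes K: "algebraically_closed K" "char_zero K"
    and R: "algebra K R" and gens: "finite Q" "Q \<subseteq> carrier R"
      "\<And>C. \<lbrakk>subring C R; submodule C K R; Q \<subseteq> C\<rbrakk> \<Longrightarrow> C = carrier R"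
    and d: "linear_derivation K R d" "locally_nilpotent R d"
    and A: "differential_operator_ring R d A \<phi> \<theta>" and nontrivial: "\<one>\<^bsub>A\<^esub> \<noteq> \<zero>\<^bsub>A\<^esub>"
  shows "fg_diff_ring A ((\<lambda>k. \<phi> (k \<odot>\<^bsub>R\<^esub> \<one>\<^bsub>R\<^esub>)) ` carrier K) (\<phi> ` carrier R) (\<phi> ` Q) \<theta>"
proof -
  interpret K: algebraically_closed K by (rule K(1))
  interpret RR: ring R by (rule differential_operator_ring.axioms(1)[OF A])
  interpret AA: ring A by (rule differential_operator_ring.axioms(2)[OF A])
  interpret R: algebra K R by (rule R)
  interpret A: differential_operator_ring R d A \<phi> \<theta> by (rule A)
  interpret phi: ring_hom_ring R A \<phi>
    by (intro ring_hom_ringI2) (use A.embedding RR.ring_axioms AA.ring_axioms in auto)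
  define \<kappa> where "\<kappa> = (\<lambda>k. \<phi> (k \<odot>\<^bsub>R\<^esub> \<one>\<^bsub>R\<^esub>))"
  have "(\<lambda>k. k \<odot>\<^bsub>R\<^esub> \<one>\<^bsub>R\<^esub>) \<in> ring_hom K R"
  proof (rule ring_hom_memI)
    fix k l assume kl: "k \<in> carrier K" "l \<in> carrier K"
    show "(k \<otimes>\<^bsub>K\<^esub> l) \<odot>\<^bsub>R\<^esub> \<one>\<^bsub>R\<^esub> = (k \<odot>\<^bsub>R\<^esub> \<one>\<^bsub>R\<^esub>) \<otimes>\<^bsub>R\<^esub> (l \<odot>\<^bsub>R\<^esub> \<one>\<^bsub>R\<^esub>)"
      using kl by (simp add: R.smult_assoc1 R.smult_assoc2)
    show "(k \<oplus>\<^bsub>K\<^esub> l) \<odot>\<^bsub>R\<^esub> \<one>\<^bsub>R\<^esub> = (k \<odot>\<^bsub>R\<^esub> \<one>\<^bsub>R\<^esub>) \<oplus>\<^bsub>R\<^esub> (l \<odot>\<^bsub>R\<^esub> \<one>\<^bsub>R\<^esub>)"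
      using kl by (simp add: R.smult_l_distr)
  qed (use R.smult_closed R.smult_one in auto)
  then have "\<kappa> \<in> ring_hom K A"
    using ring_hom_trans[OF _ A.embedding(1)] unfolding \<kappa>_def comp_def by blast
  then interpret kappa: ring_hom_ring K A \<kappa>
    by (intro ring_hom_ringI2) (use K.ring_axioms AA.ring_axioms in auto)
  \<comment> \<open>A field maps injectively into any ring with \<open>1 \<noteq> 0\<close>;
    \<open>nontrivial\<close> excludes the zero algebra.\<close>
  have kinj: "inj_on \<kappa> (carrier K)" and kfield: "subfield (\<kappa> ` carrier K) A"
    using kappa.img_is_subfield[OF K.carrier_is_subfield nontrivial] by auto
  have d_closed: "d r \<in> carrier R" if "r \<in> carrier R" for r
    using d(1) that unfolding linear_derivation_def by blast
  have comm: "\<theta> \<otimes>\<^bsub>A\<^esub> \<phi> r \<ominus>\<^bsub>A\<^esub> \<phi> r \<otimes>\<^bsub>A\<^esub> \<theta> = \<phi> (d r)" if "r \<in> carrier R" for r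
  proof -
    have c: "\<phi> r \<otimes>\<^bsub>A\<^esub> \<theta> \<in> carrier A" "\<phi> (d r) \<in> carrier A"
      using that d_closed A.theta_closed by auto
    show ?thesis
      unfolding A.commutation[OF that] using c
      by (simp add: AA.minus_eq AA.a_comm[of "\<phi> r \<otimes>\<^bsub>A\<^esub> \<theta>"] AA.a_assoc AA.r_neg)
  qed
  have d_one: "d \<one>\<^bsub>R\<^esub> = \<zero>\<^bsub>R\<^esub>"
  proof -
    have "d (\<one>\<^bsub>R\<^esub> \<otimes>\<^bsub>R\<^esub> \<one>\<^bsub>R\<^esub>) = d \<one>\<^bsub>R\<^esub> \<otimes>\<^bsub>R\<^esub> \<one>\<^bsub>R\<^esub> \<oplus>\<^bsub>R\<^esub> \<one>\<^bsub>R\<^esub> \<otimes>\<^bsub>R\<^esub> d \<one>\<^bsub>R\<^esub>"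
      using d(1) RR.one_closed unfolding linear_derivation_def by blast
    then have "d \<one>\<^bsub>R\<^esub> = d \<one>\<^bsub>R\<^esub> \<oplus>\<^bsub>R\<^esub> d \<one>\<^bsub>R\<^esub>" using d_closed by simp
    then show ?thesis using d_closed[OF RR.one_closed] RR.add.r_cancel_one'[of "d \<one>\<^bsub>R\<^esub>" "d \<one>\<^bsub>R\<^esub>"] by simp
  qed
  show ?thesis
    unfolding \<kappa>_def[symmetric]
  proof (intro fg_diff_ring.intro fg_diff_ring_axioms.intro)
    show "ring A" by (rule AA.ring_axioms)
    show "subfield (\<kappa> ` carrier K) A" by (rule kfield)
    have "subring (\<phi> ` carrier R) A" by (rule phi.img_is_subring[OF RR.carrier_is_subring])
    then show "subcring (\<phi> ` carrier R) A"
    proof (rule AA.subcringI)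
      fix a b assume "a \<in> \<phi> ` carrier R" "b \<in> \<phi> ` carrier R"
      then obtain x y where xy: "x \<in> carrier R" "y \<in> carrier R" "a = \<phi> x" "b = \<phi> y" by blast
      then show "a \<otimes>\<^bsub>A\<^esub> b = b \<otimes>\<^bsub>A\<^esub> a" using phi.hom_mult[of x y] phi.hom_mult[of y x] R.m_comm[of x y] by simp
    qed
    show "\<kappa> ` carrier K \<subseteq> \<phi> ` carrier R" unfolding \<kappa>_def using R.smult_closed by auto
    show "\<phi> ` Q \<subseteq> \<phi> ` carrier R" "finite (\<phi> ` Q)" using gens by auto
    show "\<theta> \<in> carrier A" by (rule A.theta_closed)
    fix C assume C: "subring C A"
    note Ci = subringE[OF C]
    show "\<phi> ` carrier R \<subseteq> C" if FG: "\<kappa> ` carrier K \<union> \<phi> ` Q \<subseteq> C"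
    proof -
      let ?C = "{r \<in> carrier R. \<phi> r \<in> C}"
      have 1: "subring ?C R"
        by (rule RR.subringI) (use Ci in auto)
      \<comment> \<open>Scaling by \<open>k\<close> is multiplication by \<open>k\<close> times the
        unit, whose image lies in \<open>C\<close> because the field does.\<close>
      have 2: "k \<odot>\<^bsub>R\<^esub> r \<in> ?C" if "k \<in> carrier K" "r \<in> ?C" for k r
      proof -
        have "k \<odot>\<^bsub>R\<^esub> r = (k \<odot>\<^bsub>R\<^esub> \<one>\<^bsub>R\<^esub>) \<otimes>\<^bsub>R\<^esub> r" using that by (simp add: R.smult_assoc2)
        moreover have "\<kappa> k \<in> C" using FG that by blast
        ultimately show ?thesis
          using that Ci(6)[of "\<kappa> k" "\<phi> r"] R.smult_closed[OF that(1)] unfolding \<kappa>_def by simp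
      qed
      have 3: "submodule ?C K R"
        by (rule R.submoduleI[OF subringE(1)[OF 1] subringE(2)[OF 1] subringE(5)[OF 1] subringE(7)[OF 1] 2])
      have "Q \<subseteq> ?C" using gens(2) FG by blast
      then have "?C = carrier R" by (rule gens(3)[OF 1 3])
      then show ?thesis by blast
    qed
    show "carrier A \<subseteq> C" if \<theta>B: "insert \<theta> (\<phi> ` carrier R) \<subseteq> C"
    proof
      fix x assume "x \<in> carrier A"
      then obtain n c where nc: "c \<in> {..<n} \<rightarrow> carrier R"
        "x = (\<Oplus>\<^bsub>A\<^esub> i \<in> {..<n::nat}. \<phi> (c i) \<otimes>\<^bsub>A\<^esub> \<theta> [^]\<^bsub>A\<^esub> i)" using A.powers_span by blast
      have pow: "\<theta> [^]\<^bsub>A\<^esub> (i::nat) \<in> C" for i by (induction i) (use Ci \<theta>B in auto)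
      have "(\<Oplus>\<^bsub>A\<^esub> i \<in> {..<n::nat}. \<phi> (c i) \<otimes>\<^bsub>A\<^esub> \<theta> [^]\<^bsub>A\<^esub> i) \<in> C"
        using nc(1)
      proof (induction n)
        case 0
        then show ?case using Ci by simp
      next
        case (Suc n)
        have t: "\<phi> (c i) \<otimes>\<^bsub>A\<^esub> \<theta> [^]\<^bsub>A\<^esub> i \<in> C" if "i < Suc n" for i
        proof -
          have "c i \<in> carrier R" using Suc.prems that by auto
          then show ?thesis using Ci(6)[OF _ pow] \<theta>B by blast
        qed
        have "(\<Oplus>\<^bsub>A\<^esub> i \<in> {..<Suc n}. \<phi> (c i) \<otimes>\<^bsub>A\<^esub> \<theta> [^]\<^bsub>A\<^esub> i)
            = \<phi> (c n) \<otimes>\<^bsub>A\<^esub> \<theta> [^]\<^bsub>A\<^esub> n \<oplus>\<^bsub>A\<^esub> (\<Oplus>\<^bsub>A\<^esub> i \<in> {..<n}. \<phi> (c i) \<otimes>\<^bsub>A\<^esub> \<theta> [^]\<^bsub>A\<^esub> i)"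
          unfolding lessThan_Suc
          by (rule AA.finsum_insert) (use t Ci(1) in \<open>auto simp: less_Suc_eq subset_iff\<close>)
        moreover have "(\<Oplus>\<^bsub>A\<^esub> i \<in> {..<n}. \<phi> (c i) \<otimes>\<^bsub>A\<^esub> \<theta> [^]\<^bsub>A\<^esub> i) \<in> C" using Suc by (simp add: Pi_def)
        ultimately show ?case using t[of n] Ci(7) by simp
      qed
      then show "x \<in> C" using nc by simp
    qed
  next
    fix k assume "k \<in> \<kappa> ` carrier K"
    then obtain l where l: "l \<in> carrier K" "k = \<phi> (l \<odot>\<^bsub>R\<^esub> \<one>\<^bsub>R\<^esub>)" unfolding \<kappa>_def by blast
    have c: "l \<odot>\<^bsub>R\<^esub> \<one>\<^bsub>R\<^esub> \<in> carrier R" using l(1) by simp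
    have "d (l \<odot>\<^bsub>R\<^esub> \<one>\<^bsub>R\<^esub>) = l \<odot>\<^bsub>R\<^esub> d \<one>\<^bsub>R\<^esub>"
      using d(1) l(1) RR.one_closed unfolding linear_derivation_def by blast
    also have "\<dots> = \<zero>\<^bsub>R\<^esub>" unfolding d_one using l(1) by simp
    finally show "\<theta> \<otimes>\<^bsub>A\<^esub> k = k \<otimes>\<^bsub>A\<^esub> \<theta>"
      using A.commutation[OF c] l(2) c A.theta_closed by simp
  next
    show "\<theta> \<otimes>\<^bsub>A\<^esub> b \<ominus>\<^bsub>A\<^esub> b \<otimes>\<^bsub>A\<^esub> \<theta> \<in> \<phi> ` carrier R" if "b \<in> \<phi> ` carrier R" for b
      using that comm d_closed by auto
    show "\<exists>n. ((\<lambda>b. \<theta> \<otimes>\<^bsub>A\<^esub> b \<ominus>\<^bsub>A\<^esub> b \<otimes>\<^bsub>A\<^esub> \<theta>) ^^ n) b = \<zero>\<^bsub>A\<^esub>" if b: "b \<in> \<phi> ` carrier R" for b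
    proof -
      obtain r where r: "r \<in> carrier R" "b = \<phi> r" using b by blast
      have "((\<lambda>b. \<theta> \<otimes>\<^bsub>A\<^esub> b \<ominus>\<^bsub>A\<^esub> b \<otimes>\<^bsub>A\<^esub> \<theta>) ^^ n) b = \<phi> ((d ^^ n) r) \<and> (d ^^ n) r \<in> carrier R" for n
        by (induction n) (use r comm d_closed in auto)
      moreover obtain n where "(d ^^ n) r = \<zero>\<^bsub>R\<^esub>" using d(2) r(1) unfolding locally_nilpotent_def by blast
      ultimately show ?thesis by (metis phi.hom_zero)
    qed
  next
    fix p assume p: "set p \<subseteq> \<kappa> ` carrier K" "2 \<le> length p" "hd p = \<one>\<^bsub>A\<^esub>"
    define q where "q = map (inv_into (carrier K) \<kappa>) p"
    have q: "set q \<subseteq> carrier K" "p = map \<kappa> q"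
      using p(1) unfolding q_def
      by (auto intro: inv_into_into simp: comp_def f_inv_into_f subset_iff intro!: map_idI[symmetric])
    have q0: "q \<noteq> []" "length q = length p" using q p(2) by auto
    have "\<kappa> (hd q) = \<kappa> \<one>\<^bsub>K\<^esub>" using p(3) q q0 by (simp add: hd_map)
    moreover have "hd q \<in> carrier K" using q(1) q0(1) by (meson hd_in_set subsetD)
    ultimately have hd: "hd q = \<one>\<^bsub>K\<^esub>" by (rule inj_onD[OF kinj _ _ K.one_closed])
    have pq: "q \<in> carrier (poly_ring K)"
      unfolding univ_poly_carrier[symmetric] polynomial_def using q(1) hd by simp
    \<comment> \<open>Over an algebraically closed field the number of roots with multiplicity is
      the degree, here at least 1.\<close>
    have "size (K.roots q) = length q - 1"
      using K.roots_over_carrier[OF pq] unfolding K.splitted_def .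
    then have "K.roots q \<noteq> {#}" using q0 p(2) by auto
    then obtain \<mu> where "\<mu> \<in># K.roots q" by blast
    then have "K.is_root q \<mu>" using K.roots_mem_iff_is_root[OF pq] by blast
    then have mu: "\<mu> \<in> carrier K" "K.eval q \<mu> = \<zero>\<^bsub>K\<^esub>" unfolding K.is_root_def by auto
    then have "AA.eval p (\<kappa> \<mu>) = \<zero>\<^bsub>A\<^esub>"
      using kappa.eval_hom'[OF mu(1) q(1)] q(2) by simp
    then show "\<exists>\<mu>\<in>\<kappa> ` carrier K. AA.eval p \<mu> = \<zero>\<^bsub>A\<^esub>" using mu(1) by blast
  next
    fix n :: nat assume n: "0 < n"
    have hom: "\<kappa> (add_pow K m \<one>\<^bsub>K\<^esub>) = add_pow A m \<one>\<^bsub>A\<^esub>" for m :: nat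
      by (induction m) (simp_all add: K.add.nat_pow_Suc AA.add.nat_pow_Suc)
    have "add_pow K n \<one>\<^bsub>K\<^esub> \<noteq> \<zero>\<^bsub>K\<^esub>" using K(2) n unfolding char_zero_def by blast
    then have "\<kappa> (add_pow K n \<one>\<^bsub>K\<^esub>) \<noteq> \<kappa> \<zero>\<^bsub>K\<^esub>"
      using inj_onD[OF kinj] K.add.nat_pow_closed[OF K.one_closed] by blast
    then show "add_pow A n \<one>\<^bsub>A\<^esub> \<noteq> \<zero>\<^bsub>A\<^esub>" using hom by simp
  qed
qed

text \<open>Preimages under \<open>\<iota>\<close> carry submodules of the image back to submodules
  of the abstract simple module, which transports simplicity into the ambient module.\<close>

lemma (in left_module) essential_simple_image:
  fixes T :: "('a, 's) module"
  assumes simple: "simple_module R T" and hom: "\<iota> \<in> left_module_hom R T M"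
    and inj: "inj_on \<iota> (carrier T)" and ess: "essential_submodule (\<iota> ` carrier T) R M"
  shows "essential_simple R M (\<iota> ` carrier T)"
proof -
  interpret T: left_module R T using simple unfolding simple_module_def by blast
  have hc: "\<iota> x \<in> carrier M" if "x \<in> carrier T" for x
    using hom that unfolding left_module_hom_def by blast
  have hadd: "\<iota> (x \<oplus>\<^bsub>T\<^esub> y) = \<iota> x \<boxplus> \<iota> y" if "x \<in> carrier T" "y \<in> carrier T" for x y
    using hom that unfolding left_module_hom_def by blast
  have hsm: "\<iota> (a \<odot>\<^bsub>T\<^esub> x) = a \<bullet> \<iota> x" if "a \<in> carrier R" "x \<in> carrier T" for a x
    using hom that unfolding left_module_hom_def by blast
  have h0: "\<iota> \<zero>\<^bsub>T\<^esub> = \<zero>\<zero>" using hsm[of \<zero> "\<zero>\<^bsub>T\<^esub>"] hc by simp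
  have hdiff: "\<iota> (x \<ominus>\<^bsub>T\<^esub> y) = \<iota> x \<boxminus> \<iota> y" if "x \<in> carrier T" "y \<in> carrier T" for x y
  proof -
    have "\<iota> (x \<ominus>\<^bsub>T\<^esub> y) \<boxplus> \<iota> y = \<iota> x" using hadd[of "x \<ominus>\<^bsub>T\<^esub> y" y] that by simp
    then show ?thesis using add_diff_cancel[of "\<iota> (x \<ominus>\<^bsub>T\<^esub> y)" "\<iota> y"] hc that by simp
  qed
  show ?thesis
  proof (intro essential_simple.intro essential_simple_axioms.intro left_module_axioms)
    show st: "stable M (carrier R) (\<iota> ` carrier T)"
      using ess unfolding essential_submodule_def submodule_iff_stable by blast
    show "L = {\<zero>\<zero>}" if "stable M (carrier R) L" "L \<inter> \<iota> ` carrier T = {\<zero>\<zero>}" for L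
      using ess that unfolding essential_submodule_def submodule_iff_stable by blast
    have "carrier T \<noteq> {\<zero>\<^bsub>T\<^esub>}" using simple unfolding simple_module_def by blast
    then obtain x where "x \<in> carrier T" "x \<noteq> \<zero>\<^bsub>T\<^esub>" using T.M.zero_closed by blast
    then show "\<iota> ` carrier T \<noteq> {\<zero>\<zero>}" using inj_onD[OF inj, of x "\<zero>\<^bsub>T\<^esub>"] h0 by auto
    fix L assume L: "stable M (carrier R) L" "L \<subseteq> \<iota> ` carrier T"
    let ?P = "{x \<in> carrier T. \<iota> x \<in> L}"
    have "stable T (carrier R) ?P"
      by (rule T.stableI_diff)
         (use h0 hdiff hsm stable_zero[OF L(1)] stable_diff[OF L(1)] stable_smult[OF L(1)] in auto)
    then have "?P = {\<zero>\<^bsub>T\<^esub>} \<or> ?P = carrier T"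
      using simple unfolding simple_module_def submodule_iff_stable by blast
    moreover have "L = \<iota> ` ?P" using L(2) by blast
    moreover have "\<iota> ` {\<zero>\<^bsub>T\<^esub>} = {\<zero>\<zero>}" using h0 by simp
    ultimately show "L = {\<zero>\<zero>} \<or> L = \<iota> ` carrier T" by (elim disjE) simp_all
  qed
qed

lemma (in left_module) generated_submodule_stable:
  assumes "Q \<subseteq> carrier M"
  shows "stable M (carrier R) (generated_submodule R M Q)" "Q \<subseteq> generated_submodule R M Q"
    "\<And>N. \<lbrakk>stable M (carrier R) N; Q \<subseteq> N\<rbrakk> \<Longrightarrow> generated_submodule R M Q \<subseteq> N"
proof -
  have "stable M (carrier R) (carrier M)" by (rule stable_carrier_set) simp
  then have sub: "generated_submodule R M Q \<subseteq> carrier M"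
    using assms unfolding generated_submodule_def submodule_iff_stable by blast
  show "stable M (carrier R) (generated_submodule R M Q)"
    by (rule stableI_diff[OF sub])
       (auto simp: generated_submodule_def submodule_iff_stable intro: stable_zero stable_diff stable_smult)
  show "Q \<subseteq> generated_submodule R M Q" unfolding generated_submodule_def by blast
  show "generated_submodule R M Q \<subseteq> N" if "stable M (carrier R) N" "Q \<subseteq> N" for N
    using that unfolding generated_submodule_def submodule_iff_stable by blast
qed

lemma (in left_module) artinian_moduleI:
  assumes "stable M (carrier R) N" "dcc_family (stable_within (carrier R) N)"
  shows "artinian_module R (M\<lparr>carrier := N\<rparr>)"
  using assms(2) restrict_left_module[OF assms(1)]
  unfolding artinian_module_def submodule_iff_stable stable_restrict_iff[OF assms(1)] dcc_family_def
  by auto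

theorem proposition2p1:
  fixes K :: "('k, 'b) ring_scheme"
    and R :: "('k, 'r, 'c) module_scheme"
    and d :: "'r \<Rightarrow> 'r"
    and A :: "('a, 'x) ring_scheme"
    and \<phi> :: "'r \<Rightarrow> 'a" and \<theta> :: 'a
  assumes "algebraically_closed K" and "char_zero K"
    and "algebra K R" and "finitely_generated_algebra K R"
    and "linear_derivation K R d" and "locally_nilpotent R d"
    and "differential_operator_ring R d A \<phi> \<theta>"
  shows "diamond_property TYPE('s) TYPE('e) TYPE('n) A"
  unfolding diamond_property_def
proof (intro allI impI)
  fix T :: "('a, 's) module" and E :: "('a, 'e) module" and \<iota>
  assume TE: "simple_module A T \<and> injective_hull TYPE('n) A T E \<iota>"
  then interpret left_module A E
    unfolding injective_hull_def injective_module_def by blast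
  interpret ess: essential_simple A E "\<iota> ` carrier T"
    by (rule essential_simple_image) (use TE in \<open>auto simp: injective_hull_def\<close>)
  obtain s where s: "s \<in> carrier E" "s \<noteq> \<zero>\<^bsub>E\<^esub>" using ess.S_elem by blast
  \<comment> \<open>The unit fixes the nonzero vector \<open>s\<close>, while zero annihilates
    it.\<close>
  then have "\<one>\<^bsub>A\<^esub> \<noteq> \<zero>\<^bsub>A\<^esub>" using smult_one[OF s(1)] smult_l_null[OF s(1)] by metis
  moreover obtain Q where "finite Q" "Q \<subseteq> carrier R"
    "\<And>C. \<lbrakk>subring C R; submodule C K R; Q \<subseteq> C\<rbrakk> \<Longrightarrow> C = carrier R"
    using assms(4) unfolding finitely_generated_algebra_def by blast
  ultimately interpret fg: fg_diff_ring A "(\<lambda>k. \<phi> (k \<odot>\<^bsub>R\<^esub> \<one>\<^bsub>R\<^esub>)) ` carrier K" "\<phi> ` carrier R" "\<phi> ` Q" \<theta>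
    using assms by (intro fg_diff_ring_of_algebra) auto
  interpret diff_essential A "(\<lambda>k. \<phi> (k \<odot>\<^bsub>R\<^esub> \<one>\<^bsub>R\<^esub>)) ` carrier K" "\<phi> ` carrier R" "\<phi> ` Q" \<theta> E
    "\<iota> ` carrier T" ..
  show "locally_artinian A E"
    unfolding locally_artinian_def
  proof (intro conjI allI impI left_module_axioms)
    fix P assume P: "finite P \<and> P \<subseteq> carrier E"
    define N where "N = generated_submodule A E P"
    have N: "stable E (carrier A) N" and least: "\<And>L. \<lbrakk>stable E (carrier A) L; P \<subseteq> L\<rbrakk> \<Longrightarrow> N \<subseteq> L"
      unfolding N_def using generated_submodule_stable P by blast+
    obtain L where L: "stable E (carrier A) L" "P \<subseteq> L" "acc_family (stable_within (carrier A) L)"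
      using acc_finitely_generated P by blast
    have acc: "acc_family (stable_within (carrier A) N)"
      by (rule acc_family_subset[OF L(3)]) (use least[OF L(1,2)] in blast)
    \<comment> \<open>The zero submodule is treated apart because it does not contain the simple
      submodule.\<close>
    have "dcc_family (stable_within (carrier A) N)"
    proof (cases "N = {\<zero>\<^bsub>E\<^esub>}")
      case True
      then show ?thesis using dcc_zero by simp
    next
      case False
      then show ?thesis using dcc_of_acc[OF N ess.S_least[OF N] acc] by blast
    qed
    then show "artinian_module A (E\<lparr>carrier := generated_submodule A E P\<rparr>)"
      using artinian_moduleI[OF N] unfolding N_def by blast
  qed
qed

end
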